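(* Let $f$ be a holomorphic cusp form of weight $k$ for $\mathrm{SL}_2(\mathbb{Z})$ which is a normalized Hecke eigenform, with Fourier expansion $f(z)=\sum_{m=1}^\infty\lambda_f(m)m^{(k-1)/2}\mathrm{e}^{2\pi imz}$ for $\Im(z)>0$, so that $\lambda_f(1)=1$. For all smooth homogeneous $F\in\mathbb{Z}[x_1,\ldots,x_n]$ of degree $d$ with $n>2^d(d-1)$ and all boxes $\mathcal{B}\subset[-1,1]^n$ (as in the context) we have $$\lim_{P\to\infty}\frac{1}{P^n}\sum_{\substack{\mathbf{x}\in\mathbb{Z}^n\cap P\mathcal{B}\\ F(\mathbf{x})\neq 0}}\lambda_f(|F(\mathbf{x})|)=0.$$
   Context: A form $F\in\mathbb{Z}[x_1,\ldots,x_n]$ of degree $d$ is smooth if the projective hypersurface $F=0$ is smooth, i.e. the partial derivatives of $F$ have no common zero in $\mathbb{C}^n\setminus\{0\}$. A box is a set $\mathcal{B}\subset[-1,1]^n$ of the form $\mathcal{B}=\prod_{j=1}^n[a_j,a'_j]$ with real $a_j,a_j'$ satisfying $\max_j|a'_j-a_j|\leq 1$; $P\mathcal{B}=\{P\mathbf{t}:\mathbf{t}\in\mathcal{B}\}$. *)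

theory Defs
  imports "HOL-Complex_Analysis.Complex_Analysis" "HOL-Library.Poly_Mapping"
begin

text \<open>
  Polynomials in \<open>CARD('n)\<close> variables with integer coefficients: finitely supported maps
  from exponent vectors to coefficients.
\<close>
type_synonym 'n int_mpoly = "('n \<Rightarrow>\<^sub>0 nat) \<Rightarrow>\<^sub>0 int"

definition eval_mpoly :: "'n::finite int_mpoly \<Rightarrow> 'a::comm_ring_1 ^ 'n \<Rightarrow> 'a" where
  "eval_mpoly F x =
     (\<Sum>e\<in>Poly_Mapping.keys F. of_int (Poly_Mapping.lookup F e) *
        (\<Prod>j\<in>UNIV. (x $ j) ^ Poly_Mapping.lookup e j))"

definition homogeneous :: "nat \<Rightarrow> 'n::finite int_mpoly \<Rightarrow> bool" where
  "homogeneous d F \<longleftrightarrow>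
     (\<forall>e\<in>Poly_Mapping.keys F. (\<Sum>j\<in>UNIV. Poly_Mapping.lookup e j) = d)"

text \<open>
  The formal partial derivative.  The subtraction of exponent vectors is truncated, but if
  \<open>x\<^sub>i\<close> does not occur in a monomial then the coefficient of the resulting monomial is 0.
\<close>
definition partial_deriv :: "'n::finite \<Rightarrow> 'n int_mpoly \<Rightarrow> 'n int_mpoly" where
  "partial_deriv i F =
     (\<Sum>e\<in>Poly_Mapping.keys F.
        Poly_Mapping.single (e - Poly_Mapping.single i 1)
          (int (Poly_Mapping.lookup e i) * Poly_Mapping.lookup F e))"

definition smooth_form :: "'n::finite int_mpoly \<Rightarrow> bool" where
  "smooth_form F \<longleftrightarrow>
     \<not> (\<exists>z::complex ^ 'n. z \<noteq> 0 \<and> (\<forall>i. eval_mpoly (partial_deriv i F) z = 0))"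

definition is_box :: "(real ^ 'n::finite) set \<Rightarrow> bool" where
  "is_box B \<longleftrightarrow>
     B \<subseteq> {t. \<forall>j. t $ j \<in> {-1..1}} \<and>
     (\<exists>a a'. B = {t. \<forall>j. t $ j \<in> {a $ j..a' $ j}} \<and> (\<forall>j. \<bar>a' $ j - a $ j\<bar> \<le> 1))"

definition real_vec :: "int ^ 'n \<Rightarrow> real ^ 'n" where
  "real_vec x = (\<chi> j. real_of_int (x $ j))"

definition upper_half_plane :: "complex set" where
  "upper_half_plane = {z. Im z > 0}"

definition weakly_modular :: "int \<Rightarrow> (complex \<Rightarrow> complex) \<Rightarrow> bool" where
  "weakly_modular k f \<longleftrightarrow>
     (\<forall>a b c d :: int. a * d - b * c = 1 \<longrightarrow>
        (\<forall>z\<in>upper_half_plane.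
           f ((of_int a * z + of_int b) / (of_int c * z + of_int d)) =
             (of_int c * z + of_int d) powi k * f z))"

text \<open>
  \<open>f\<close> has the Fourier expansion \<open>\<Sum>m\<ge>1. a m * exp (2 \<pi> i m z)\<close> on the upper half plane;
  there is no constant term, and the value \<open>a 0\<close> is irrelevant.
\<close>
definition has_cuspidal_fourier_expansion :: "(complex \<Rightarrow> complex) \<Rightarrow> (nat \<Rightarrow> complex) \<Rightarrow> bool" where
  "has_cuspidal_fourier_expansion f a \<longleftrightarrow>
     (\<forall>z\<in>upper_half_plane.
        ((\<lambda>m. a m * exp (2 * of_real pi * \<i> * of_nat m * z)) has_sum f z) {1..})"

definition cusp_form :: "int \<Rightarrow> (complex \<Rightarrow> complex) \<Rightarrow> bool" where
  "cusp_form k f \<longleftrightarrow>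
     f holomorphic_on upper_half_plane \<and> weakly_modular k f \<and>
     (\<exists>a. has_cuspidal_fourier_expansion f a)"

text \<open>
  \<open>T\<^sub>m f(z) = m\<^bsup>k-1\<^esup> \<Sum> d\<^bsup>-k\<^esup> f((a z + b)/d)\<close>, the sum being over
  \<open>a d = m\<close> and \<open>0 \<le> b < d\<close>.
\<close>
definition hecke_operator ::
    "int \<Rightarrow> nat \<Rightarrow> (complex \<Rightarrow> complex) \<Rightarrow> complex \<Rightarrow> complex" where
  "hecke_operator k m f z =
     of_nat m powi (k - 1) *
       (\<Sum>d | d dvd m. of_nat d powi (- k) *
          (\<Sum>b<d. f ((of_nat (m div d) * z + of_nat b) / of_nat d)))"

definition hecke_eigenform :: "int \<Rightarrow> (complex \<Rightarrow> complex) \<Rightarrow> bool" where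
  "hecke_eigenform k f \<longleftrightarrow>
     (\<exists>z\<in>upper_half_plane. f z \<noteq> 0) \<and>
     (\<forall>m\<ge>1. \<exists>c. \<forall>z\<in>upper_half_plane. hecke_operator k m f z = c * f z)"

end

theory Submission
  imports Defs "HOL-Computational_Algebra.Fundamental_Theorem_Algebra"
begin

text \<open>
  Write \<open>S(\<alpha>)\<close> for the exponential sum of \<open>\<alpha> F\<close> over the integer points of the dilated box and
  \<open>T(\<alpha>)\<close> for the sum of \<open>\<lambda>\<^sub>f(m) e(m \<alpha>)\<close> over the possible values \<open>m\<close>. The sum in question is,
  for each sign of \<open>F\<close>, the mean of \<open>T(-\<alpha>) S(\<plusminus>\<alpha>)\<close> over the rationals with a large fixed denominator.
  Wilton's bound gives \<open>T(\<alpha>) \<lless> P\<^bsup>d/2+\<epsilon>\<^esup>\<close> uniformly in \<open>\<alpha>\<close>, so any bound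
  \<open>P\<^bsup>n-d/2-\<delta>\<^esup>\<close> for the mean of \<open>|S|\<close> suffices. For \<open>d \<ge> 2\<close> it follows from Birch's form of Weyl's
  inequality: with \<open>B = P\<^bsup>\<theta>\<^esup>\<close>, either \<open>|S(\<alpha>)|\<close> is at most about \<open>P\<^sup>n B\<^bsup>-n/2^(d-1)\<^esup>\<close>,
  or \<open>\<alpha>\<close> lies in a set of measure \<open>B\<^bsup>2(d-1)\<^esup> P\<^bsup>-d\<^esup>\<close>, where \<open>S\<close> is estimated trivially; the
  condition \<open>n > 2\<^sup>d (d-1)\<close> is what makes a suitable \<open>\<theta>\<close> exist. For \<open>d = 1\<close> the mean of \<open>|S|\<close> is
  computed directly.

  The count of integral zeros of the polar forms of \<open>F\<close>, usually done by dimension theory, is obtained from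
  a uniform bound for the number of common zeros of \<open>n\<close> polynomials in \<open>n\<close> variables whose leading
  forms have no common zero but \<open>0\<close>.
\<close>

no_notation fps_nth (infixl "$" 75)

subsection \<open>Polynomial functions of bounded degree\<close>

text \<open>The cusp form enters only through a bound for T that is uniform in \<alpha>; what
  remains is an L^1 estimate for S. With \<open>r = n / 2^(d-1)\<close> and
  \<open>B = P^\<theta>\<close>, the minor arcs beat the loss P^(d/2) when
  \<open>\<theta> * r > d/2\<close>, and the arcs around rationals do so when
  \<open>2 * (d-1) * \<theta> < d/2\<close>; some \<theta> satisfies both exactly when
  \<open>r > 2 * (d-1)\<close>. The obstacle in Weyl's inequality is to count zeros of the polar
  forms uniformly over a family of systems whose lower-order terms vary. Their leading forms do not
  vary: they are multiples of the partial derivatives of F. Smoothness is therefore used once, to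
  express a power of each variable through these forms, and the number of zeros is bounded by the
  dimension of a space of polynomials of bounded degree. Polynomials are treated as functions, so
  that differencing, shifting and substituting are plain operations on functions and only a degree
  bound has to be carried along.\<close>

definition monom_fun :: "('n::finite \<Rightarrow> nat) \<Rightarrow> 'a::comm_ring_1 ^ 'n \<Rightarrow> 'a" where
  "monom_fun e x = (\<Prod>j\<in>UNIV. x $ j ^ e j)"

text \<open>The bound is strict so that only the zero function lies below \<open>0\<close>; a
  function below \<open>m\<close> is then killed by \<open>m\<close> differences. The inductive form
  gives induction over monomials in place of coefficient arithmetic.\<close>

inductive poly_below :: "nat \<Rightarrow> ('a::comm_ring_1 ^ 'n::finite \<Rightarrow> 'a) \<Rightarrow> bool" for m where
  zero: "poly_below m (\<lambda>_. 0)"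
| step: "poly_below m f \<Longrightarrow> sum e UNIV < m \<Longrightarrow> poly_below m (\<lambda>x. f x + c * monom_fun e x)"

lemma poly_below_0: "poly_below 0 f \<longleftrightarrow> f = (\<lambda>_. 0)"
  by (auto elim: poly_below.cases intro: poly_below.zero)

lemma poly_below_monom: "sum e UNIV < m \<Longrightarrow> poly_below m (\<lambda>x. c * monom_fun e x)"
  using poly_below.step[OF poly_below.zero, of e m c] by simp

lemma poly_below_add:
  assumes "poly_below m f" "poly_below m g"
  shows "poly_below m (\<lambda>x. f x + g x)"
  using assms(2)
proof induction
  case zero
  then show ?case using assms(1) by simp
next
  case (step g e c)
  then show ?case
    using poly_below.step[OF step.IH step.hyps(2), of c] by (simp add: add.assoc)
qed

lemma poly_below_cmult: "poly_below m f \<Longrightarrow> poly_below m (\<lambda>x. c * f x)"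
proof (induction rule: poly_below.induct)
  case (step f e c')
  then show ?case
    using poly_below.step[OF step.IH step.hyps(2), of "c * c'"] by (simp add: algebra_simps)
qed (simp add: poly_below.zero)

lemma poly_below_diff:
  "poly_below m f \<Longrightarrow> poly_below m g \<Longrightarrow> poly_below m (\<lambda>x. f x - g x)"
  using poly_below_add[of m f "\<lambda>x. (-1) * g x"] poly_below_cmult[of m g "-1"] by simp

lemma poly_below_sum:
  "(\<And>i. i \<in> I \<Longrightarrow> poly_below m (f i)) \<Longrightarrow> poly_below m (\<lambda>x. \<Sum>i\<in>I. f i x)"
  by (induction I rule: infinite_finite_induct) (auto intro: poly_below.zero poly_below_add)

lemma poly_below_mono: "poly_below m f \<Longrightarrow> m \<le> l \<Longrightarrow> poly_below l f"
  by (induction rule: poly_below.induct) (auto intro: poly_below.intros)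

lemma monom_fun_add: "monom_fun (\<lambda>j. e j + e' j) x = monom_fun e x * monom_fun e' x"
  by (simp add: monom_fun_def power_add prod.distrib)

lemma poly_below_monom_mult:
  assumes "poly_below m f"
  shows "poly_below (sum e UNIV + m) (\<lambda>x. monom_fun e x * f x)"
  using assms
proof induction
  case (step f e' c)
  have "sum (\<lambda>j. e j + e' j) UNIV < sum e UNIV + m"
    using step by (simp add: sum.distrib)
  from poly_below.step[OF step.IH this, of c] show ?case
    by (simp add: monom_fun_add algebra_simps)
qed (simp add: poly_below.zero)

text \<open>One bound is weak (degree at most \<open>a\<close>), the other strict (below
  \<open>b\<close>), and the strictness survives. The Leibniz rule for differences needs products in
  this form, the differenced factor being the strict one.\<close>

lemma poly_below_mult:
  assumes "poly_below (Suc a) f" "poly_below b g"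
  shows "poly_below (a + b) (\<lambda>x. f x * g x)"
  using assms(1)
proof induction
  case (step f e c)
  have "poly_below (a + b) (\<lambda>x. c * (monom_fun e x * g x))"
    using step.hyps(2)
    by (intro poly_below_cmult poly_below_mono[OF poly_below_monom_mult[OF assms(2)]]) simp
  from poly_below_add[OF step.IH this] show ?case
    by (simp add: algebra_simps)
qed (simp add: poly_below.zero)

lemma poly_below_mult':
  "poly_below a f \<Longrightarrow> poly_below (Suc b) g \<Longrightarrow> poly_below (a + b) (\<lambda>x. f x * g x)"
  using poly_below_mult[of b g a f] by (simp add: mult.commute add.commute)

lemma poly_below_mult_Suc:
  "poly_below (Suc a) f \<Longrightarrow> poly_below (Suc b) g \<Longrightarrow> poly_below (Suc (a + b)) (\<lambda>x. f x * g x)"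
  using poly_below_mult[of a f "Suc b" g] by simp

lemma poly_below_const: "0 < m \<Longrightarrow> poly_below m (\<lambda>_. c)"
  using poly_below_monom[of "\<lambda>_. 0" m c] by (simp add: monom_fun_def)

lemma monom_fun_single: "monom_fun (\<lambda>j. if j = i then k else 0) x = x $ i ^ k"
proof -
  have "monom_fun (\<lambda>j. if j = i then k else 0) x = (\<Prod>j\<in>UNIV. if j = i then x $ j ^ k else 1)"
    unfolding monom_fun_def by (rule prod.cong) auto
  then show ?thesis by simp
qed

lemma poly_below_coord_power: "k < m \<Longrightarrow> poly_below m (\<lambda>x. x $ i ^ k)"
  using poly_below_monom[of "\<lambda>j. if j = i then k else 0" m 1] by (simp add: monom_fun_single)

lemma poly_below_coord: "1 < m \<Longrightarrow> poly_below m (\<lambda>x. x $ i)"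
  using poly_below_coord_power[of 1 m i] by simp

lemma poly_below_prod:
  assumes "\<And>i. i \<in> I \<Longrightarrow> poly_below (Suc (a i)) (f i)"
  shows "poly_below (Suc (sum a I)) (\<lambda>x. \<Prod>i\<in>I. f i x)"
  using assms
proof (induction I rule: infinite_finite_induct)
  case (insert i I)
  then show ?case using poly_below_mult_Suc[of "a i" "f i" "sum a I"] by simp
qed (simp_all add: poly_below_const)

lemma poly_below_power:
  "poly_below (Suc a) f \<Longrightarrow> poly_below (Suc (k * a)) (\<lambda>x. f x ^ k)"
  using poly_below_prod[of "{..<k}" "\<lambda>_. a" "\<lambda>_. f"] by simp

lemma poly_below_shift:
  assumes "poly_below m f"
  shows "poly_below m (\<lambda>x. f (x + h))"
  using assms
proof induction
  case (step f e c)
  have "poly_below (Suc (\<Sum>j\<in>UNIV. e j * 1)) (\<lambda>x. \<Prod>j\<in>UNIV. (x $ j + h $ j) ^ e j)"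
    by (intro poly_below_prod poly_below_power poly_below_add poly_below_coord poly_below_const) auto
  then have "poly_below m (\<lambda>x. c * monom_fun e (x + h))"
    using step.hyps(2) by (intro poly_below_cmult) (auto simp: monom_fun_def elim: poly_below_mono)
  from poly_below_add[OF step.IH this] show ?case by simp
qed (simp add: poly_below.zero)

text \<open>Discrete Leibniz rule: the difference of \<open>f\<close> times the shifted
  \<open>g\<close>, plus \<open>f\<close> times the difference of \<open>g\<close>.\<close>

lemma poly_below_diff_mult:
  assumes "poly_below (Suc a) f" "poly_below a (\<lambda>x. f (x + h) - f x)"
    and "poly_below (Suc b) g" "poly_below b (\<lambda>x. g (x + h) - g x)"
  shows "poly_below (a + b) (\<lambda>x. f (x + h) * g (x + h) - f x * g x)"
proof -
  have "poly_below (a + b) (\<lambda>x. (f (x + h) - f x) * g (x + h) + f x * (g (x + h) - g x))"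
    by (intro poly_below_add poly_below_mult' poly_below_mult poly_below_shift assms)
  then show ?thesis by (simp add: algebra_simps)
qed

lemma poly_below_diff_prod:
  assumes "\<And>i. i \<in> I \<Longrightarrow> poly_below (Suc (a i)) (f i)"
    and "\<And>i. i \<in> I \<Longrightarrow> poly_below (a i) (\<lambda>x. f i (x + h) - f i x)"
  shows "poly_below (sum a I) (\<lambda>x. (\<Prod>i\<in>I. f i (x + h)) - (\<Prod>i\<in>I. f i x))"
  using assms
proof (induction I rule: infinite_finite_induct)
  case (insert i I)
  then show ?case
    using poly_below_diff_mult[of "a i" "f i" h "sum a I" "\<lambda>x. \<Prod>i\<in>I. f i x"]
    by (simp add: poly_below_prod)
qed (simp_all add: poly_below.zero)

text \<open>A coordinate power is a product of coordinates, whose differences are constants; the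
  Leibniz rule for products thus covers all monomials without binomial expansions.\<close>

lemma poly_below_difference:
  assumes "poly_below (Suc m) f"
  shows "poly_below m (\<lambda>x. f (x + h) - f x)"
  using assms
proof induction
  case (step f e c)
  have coord: "poly_below (e j) (\<lambda>x. (x + h) $ j ^ e j - x $ j ^ e j)" for j
  proof -
    have "poly_below (\<Sum>i<e j. 1) (\<lambda>x. (\<Prod>i<e j. (x + h) $ j) - (\<Prod>i<e j. x $ j))"
      by (rule poly_below_diff_prod) (auto intro: poly_below_coord poly_below_const)
    then show ?thesis by simp
  qed
  have "poly_below (sum e UNIV) (\<lambda>x. monom_fun e (x + h) - monom_fun e x)"
    unfolding monom_fun_def
    by (intro poly_below_diff_prod coord poly_below_coord_power) simp
  then have "poly_below m (\<lambda>x. c * (monom_fun e (x + h) - monom_fun e x))"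
    using step.hyps(2) by (intro poly_below_cmult) (auto elim: poly_below_mono)
  from poly_below_add[OF step.IH this] show ?case by (simp add: algebra_simps)
qed (simp add: poly_below.zero)

lemma monom_fun_scale: "monom_fun e (c *s x) = c ^ sum e UNIV * monom_fun e x"
  by (simp add: monom_fun_def power_mult_distrib prod.distrib power_sum)

lemma poly_below_scale: "poly_below m f \<Longrightarrow> poly_below m (\<lambda>x. f (c *s x))"
proof (induction rule: poly_below.induct)
  case (step f e c')
  then show ?case
    using poly_below.step[OF step.IH step.hyps(2), of "c' * c ^ sum e UNIV"]
    by (simp add: monom_fun_scale algebra_simps)
qed (simp add: poly_below.zero)

section \<open>Coefficients, extension to complex arguments, and size of polynomial
  functions\<close>

lemma finite_exponents: "finite {e :: 'n::finite \<Rightarrow> nat. sum e UNIV < m}"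
proof (rule finite_subset)
  show "{e :: 'n \<Rightarrow> nat. sum e UNIV < m} \<subseteq> PiE UNIV (\<lambda>_. {..<m})"
  proof safe
    fix e :: "'n \<Rightarrow> nat" and j assume "sum e UNIV < m"
    moreover have "e j \<le> sum e UNIV" by (rule member_le_sum) auto
    ultimately show "e j < m" by simp
  qed auto
  show "finite (PiE (UNIV :: 'n set) (\<lambda>_. {..<m}))" by (intro finite_PiE) auto
qed

lemma poly_below_coeffs:
  assumes "poly_below m f"
  obtains c where "\<And>x. f x = (\<Sum>e | sum e UNIV < m. c e * monom_fun e x)"
proof -
  from assms have "\<exists>c. \<forall>x. f x = (\<Sum>e | sum e UNIV < m. c e * monom_fun e x)"
  proof induction
    case zero
    show ?case by (rule exI[of _ "\<lambda>_. 0"]) simp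
  next
    case (step f e0 c0)
    then obtain c where c: "\<And>x. f x = (\<Sum>e | sum e UNIV < m. c e * monom_fun e x)" by blast
    show ?case
    proof (intro exI allI)
      fix x
      have "(\<Sum>e | sum e UNIV < m. (c e + (if e = e0 then c0 else 0)) * monom_fun e x)
        = f x + (\<Sum>e | sum e UNIV < m. if e = e0 then c0 * monom_fun e x else 0)"
        unfolding c by (simp add: distrib_right sum.distrib if_distrib[of "\<lambda>t. t * _"] cong: if_cong)
      also have "\<dots> = f x + c0 * monom_fun e0 x"
        using step.hyps(2) by (simp add: sum.delta[OF finite_exponents])
      finally show "f x + c0 * monom_fun e0 x
        = (\<Sum>e | sum e UNIV < m. (c e + (if e = e0 then c0 else 0)) * monom_fun e x)" by simp
    qed
  qed
  with that show ?thesis by blast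
qed

definition complex_vec :: "int ^ 'n \<Rightarrow> complex ^ 'n" where
  "complex_vec x = (\<chi> j. of_int (x $ j))"

lemma monom_fun_complex_vec: "monom_fun e (complex_vec x) = of_int (monom_fun e x)"
  by (simp add: monom_fun_def complex_vec_def)

text \<open>The zeros to be counted are integral, while the Nullstellensatz needs \<complex>;
  agreement on the lattice is all that is asked of \<open>g\<close>.\<close>

lemma poly_below_complexify:
  fixes f :: "int ^ 'n::finite \<Rightarrow> int"
  assumes "poly_below m f"
  obtains g where "poly_below m g" "\<And>x. g (complex_vec x) = of_int (f x)"
proof -
  from assms have "\<exists>g. poly_below m g \<and> (\<forall>x. g (complex_vec x) = of_int (f x))"
  proof induction
    case zero
    show ?case by (rule exI[of _ "\<lambda>_. 0"]) (auto intro: poly_below.zero)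
  next
    case (step f e c)
    then obtain g where "poly_below m g" "\<And>x. g (complex_vec x) = of_int (f x)" by blast
    then show ?case
      by (intro exI[of _ "\<lambda>x. g x + of_int c * monom_fun e x"])
        (auto intro: poly_below.step step.hyps simp: monom_fun_complex_vec)
  qed
  with that show ?thesis by blast
qed

lemma poly_below_bound:
  fixes f :: "int ^ 'n::finite \<Rightarrow> int"
  assumes "poly_below (Suc m) f"
  obtains C where "0 \<le> C"
    "\<And>R x. 1 \<le> R \<Longrightarrow> (\<And>j. real_of_int \<bar>x $ j\<bar> \<le> R) \<Longrightarrow> real_of_int \<bar>f x\<bar> \<le> C * R ^ m"
proof -
  from assms have "\<exists>C\<ge>0. \<forall>R x. 1 \<le> R \<longrightarrow> (\<forall>j. real_of_int \<bar>x $ j\<bar> \<le> R) \<longrightarrow> real_of_int \<bar>f x\<bar> \<le> C * R ^ m"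
  proof induction
    case zero
    show ?case by (rule exI[of _ 0]) auto
  next
    case (step f e c)
    then obtain C where C: "C \<ge> 0"
      "\<And>R x. 1 \<le> R \<Longrightarrow> (\<And>j. real_of_int \<bar>x $ j\<bar> \<le> R) \<Longrightarrow> real_of_int \<bar>f x\<bar> \<le> C * R ^ m" by blast
    show ?case
    proof (intro exI[of _ "C + \<bar>c\<bar>"] conjI allI impI)
      fix R :: real and x :: "int ^ 'n"
      assume R: "1 \<le> R" and x: "\<forall>j. real_of_int \<bar>x $ j\<bar> \<le> R"
      have "real_of_int \<bar>monom_fun e x\<bar> = (\<Prod>j\<in>UNIV. real_of_int \<bar>x $ j\<bar> ^ e j)"
        by (simp add: monom_fun_def abs_prod power_abs)
      also have "\<dots> \<le> (\<Prod>j\<in>UNIV. R ^ e j)"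
        using x by (intro prod_mono) (auto intro: power_mono)
      also have "\<dots> = R ^ sum e UNIV" by (simp add: power_sum)
      also have "\<dots> \<le> R ^ m" using step.hyps(2) R by (intro power_increasing) auto
      finally have "real_of_int \<bar>c * monom_fun e x\<bar> \<le> \<bar>c\<bar> * R ^ m"
        by (simp add: abs_mult mult_left_mono)
      moreover have "real_of_int \<bar>f x\<bar> \<le> C * R ^ m" using C(2) R x by blast
      moreover have "real_of_int \<bar>f x + c * monom_fun e x\<bar> \<le> real_of_int \<bar>f x\<bar> + real_of_int \<bar>c * monom_fun e x\<bar>"
        by linarith
      ultimately show "real_of_int \<bar>f x + c * monom_fun e x\<bar> \<le> (C + \<bar>c\<bar>) * R ^ m"
        by (simp add: algebra_simps)
    qed (use C in auto)
  qed
  with that show ?thesis by blast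
qed

lemma continuous_on_monom_fun [continuous_intros]:
  fixes g :: "'b::topological_space \<Rightarrow> complex ^ 'n::finite"
  shows "continuous_on S g \<Longrightarrow> continuous_on S (\<lambda>x. monom_fun e (g x))"
  unfolding monom_fun_def by (intro continuous_intros)

lemma poly_below_continuous:
  fixes f :: "complex ^ 'n::finite \<Rightarrow> complex"
  assumes "poly_below m f"
  shows "continuous_on UNIV f"
  using assms by induction (intro continuous_intros | assumption)+

subsection \<open>Forms and their partial derivatives\<close>

lemma eval_mpoly_monom_fun:
  "eval_mpoly F x = (\<Sum>e\<in>Poly_Mapping.keys F. of_int (Poly_Mapping.lookup F e) * monom_fun (Poly_Mapping.lookup e) x)"
  by (simp add: eval_mpoly_def monom_fun_def)

lemma eval_mpoly_superset:
  assumes "finite K" "Poly_Mapping.keys F \<subseteq> K"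
  shows "eval_mpoly F x = (\<Sum>e\<in>K. of_int (Poly_Mapping.lookup F e) * monom_fun (Poly_Mapping.lookup e) x)"
  unfolding eval_mpoly_monom_fun
  by (rule sum.mono_neutral_left) (use assms in \<open>auto simp: in_keys_iff\<close>)

lemma eval_mpoly_add: "eval_mpoly (F + G) x = eval_mpoly F x + eval_mpoly G x"
proof -
  let ?K = "Poly_Mapping.keys F \<union> Poly_Mapping.keys G"
  have "Poly_Mapping.keys (F + G) \<subseteq> ?K" by (rule Poly_Mapping.keys_add)
  then show ?thesis
    by (simp add: eval_mpoly_superset[of ?K] lookup_add distrib_right sum.distrib)
qed

lemma eval_mpoly_0: "eval_mpoly 0 x = 0"
  by (simp add: eval_mpoly_def)

lemma eval_mpoly_sum: "eval_mpoly (\<Sum>i\<in>I. G i) x = (\<Sum>i\<in>I. eval_mpoly (G i) x)"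
  by (induction I rule: infinite_finite_induct) (auto simp: eval_mpoly_add eval_mpoly_0)

lemma eval_mpoly_single:
  "eval_mpoly (Poly_Mapping.single e c) x = of_int c * monom_fun (Poly_Mapping.lookup e) x"
  by (subst eval_mpoly_superset[of "{e}"]) auto

lemma eval_partial_deriv:
  fixes F :: "'n::finite int_mpoly"
  shows "eval_mpoly (partial_deriv i F) x =
     (\<Sum>e\<in>Poly_Mapping.keys F. of_int (Poly_Mapping.lookup F e) *
        (of_nat (Poly_Mapping.lookup e i) * monom_fun ((Poly_Mapping.lookup e)(i := Poly_Mapping.lookup e i - 1)) x))"
proof -
  have *: "Poly_Mapping.lookup (e - Poly_Mapping.single i 1) = (Poly_Mapping.lookup e)(i := Poly_Mapping.lookup e i - 1)"
    for e :: "'n \<Rightarrow>\<^sub>0 nat"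
    by (auto simp: lookup_minus lookup_single fun_eq_iff)
  show ?thesis
    unfolding partial_deriv_def eval_mpoly_sum eval_mpoly_single *
    by (rule sum.cong) (auto simp: algebra_simps)
qed

lemma eval_mpoly_scale:
  "homogeneous d F \<Longrightarrow> eval_mpoly F (c *s x) = c ^ d * eval_mpoly F x"
  unfolding eval_mpoly_monom_fun sum_distrib_left
  by (rule sum.cong) (auto simp: homogeneous_def monom_fun_scale)

lemma sum_exponent_decr:
  fixes e :: "'n::finite \<Rightarrow> nat"
  assumes "e i \<noteq> 0"
  shows "sum (e(i := e i - 1)) UNIV = sum e UNIV - 1" "0 < sum e UNIV"
proof -
  have "sum e UNIV = e i + sum e (UNIV - {i})" by (rule sum.remove) auto
  moreover have "sum (e(i := e i - 1)) UNIV = (e i - 1) + sum (e(i := e i - 1)) (UNIV - {i})"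
    by (subst sum.remove[of _ i]) auto
  moreover have "sum (e(i := e i - 1)) (UNIV - {i}) = sum e (UNIV - {i})"
    by (rule sum.cong) auto
  ultimately show "sum (e(i := e i - 1)) UNIV = sum e UNIV - 1" "0 < sum e UNIV"
    using assms by auto
qed

lemma eval_partial_deriv_scale:
  assumes "homogeneous d F"
  shows "eval_mpoly (partial_deriv i F) (c *s x) = c ^ (d - 1) * eval_mpoly (partial_deriv i F) x"
  unfolding eval_partial_deriv sum_distrib_left
proof (rule sum.cong[OF refl], goal_cases)
  case (1 e)
  show ?case
  proof (cases "Poly_Mapping.lookup e i = 0")
    case False
    then show ?thesis
      using assms 1 sum_exponent_decr[of "Poly_Mapping.lookup e" i]
      by (simp add: homogeneous_def monom_fun_scale algebra_simps)
  qed simp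
qed

lemma poly_below_eval_mpoly: "homogeneous d F \<Longrightarrow> poly_below (Suc d) (eval_mpoly F)"
  unfolding eval_mpoly_monom_fun[abs_def]
  by (intro poly_below_sum poly_below_monom) (auto simp: homogeneous_def)

lemma poly_below_eval_partial_deriv:
  assumes "homogeneous d F"
  shows "poly_below d (eval_mpoly (partial_deriv i F))"
  unfolding eval_partial_deriv[abs_def]
proof (rule poly_below_sum, rule poly_below_cmult, goal_cases)
  case (1 e)
  show ?case
  proof (cases "Poly_Mapping.lookup e i = 0")
    case False
    then have "sum ((Poly_Mapping.lookup e)(i := Poly_Mapping.lookup e i - 1)) UNIV < d"
      using assms 1 sum_exponent_decr[of "Poly_Mapping.lookup e" i] by (auto simp: homogeneous_def)
    then show ?thesis by (rule poly_below_monom)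
  qed (simp add: poly_below.zero)
qed

lemma poly_below_difference_coord_power:
  "poly_below (k - 1) (\<lambda>x. (x $ i + 1) ^ k - x $ i ^ k - of_nat k * x $ i ^ (k - 1))"
proof (cases k)
  case (Suc m)
  have "(t + 1) ^ k - t ^ k - of_nat k * t ^ (k - 1) = (\<Sum>l<m. of_nat (k choose l) * t ^ l)" for t :: 'a
    unfolding Suc by (subst binomial_ring) (simp add: atMost_Suc lessThan_Suc_atMost[symmetric] algebra_simps)
  moreover have "poly_below m (\<lambda>x::'a^'b. \<Sum>l<m. of_nat (k choose l) * x $ i ^ l)"
    by (intro poly_below_sum poly_below_cmult poly_below_coord_power) auto
  ultimately show ?thesis by (simp add: Suc)
qed (simp add: poly_below.zero)

lemma monom_fun_split:
  "monom_fun e x = x $ i ^ e i * monom_fun (e(i := 0)) x"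
proof -
  have "monom_fun e x = (\<Prod>j\<in>UNIV. (if j = i then x $ i ^ e i else 1) * x $ j ^ (e(i := 0)) j)"
    unfolding monom_fun_def by (rule prod.cong) auto
  then show ?thesis by (simp add: prod.distrib monom_fun_def)
qed

lemma poly_below_taylor_monom:
  "poly_below (sum e UNIV - 1)
    (\<lambda>x. monom_fun e (x + axis i 1) - monom_fun e x - of_nat (e i) * monom_fun (e(i := e i - 1)) x)"
proof (cases "e i = 0")
  case True
  have "monom_fun e (x + axis i 1) = monom_fun e x" for x :: "'a ^ 'b"
    unfolding monom_fun_def using True by (intro prod.cong) (auto simp: axis_def)
  then show ?thesis using True by (simp add: poly_below.zero)
next
  case False
  define e' where "e' = e(i := 0)"
  have s: "sum e UNIV = e i + sum e' UNIV"
    unfolding e'_def by (subst sum.remove[of _ i], simp, simp, subst (2) sum.remove[of _ i], simp, simp)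
      (auto intro: sum.cong)
  have m: "monom_fun e' (x + axis i 1) = monom_fun e' x" for x :: "'a ^ 'b"
    unfolding monom_fun_def e'_def by (intro prod.cong) (auto simp: axis_def)
  have *: "poly_below (e i - 1 + sum e' UNIV)
     (\<lambda>x. ((x $ i + 1) ^ e i - x $ i ^ e i - of_nat (e i) * x $ i ^ (e i - 1)) * (1 * monom_fun e' x :: 'a))"
    by (intro poly_below_mult' poly_below_difference_coord_power poly_below_monom) simp
  have 1: "monom_fun e x = x $ i ^ e i * monom_fun e' x" for x :: "'a ^ 'b"
    unfolding e'_def by (rule monom_fun_split)
  have 2: "monom_fun (e(i := e i - 1)) x = x $ i ^ (e i - 1) * monom_fun e' x" for x :: "'a ^ 'b"
    using monom_fun_split[of "e(i := e i - 1)" x i] by (simp add: e'_def)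
  show ?thesis
    using * False unfolding 1 2 m by (simp add: s algebra_simps axis_def)
qed

text \<open>Links the formal derivative, in which smoothness is stated, with the difference along a
  unit vector. The error has degree at most \<open>d - 2\<close>, so \<open>d - 1\<close> further
  differences erase it.\<close>

lemma poly_below_taylor:
  assumes "homogeneous d F"
  shows "poly_below (d - 1)
    (\<lambda>x. eval_mpoly F (x + axis i 1) - eval_mpoly F x - eval_mpoly (partial_deriv i F) x)"
proof -
  have "poly_below (d - 1) (\<lambda>x. \<Sum>e\<in>Poly_Mapping.keys F. of_int (Poly_Mapping.lookup F e) *
     (monom_fun (Poly_Mapping.lookup e) (x + axis i 1) - monom_fun (Poly_Mapping.lookup e) x
       - of_nat (Poly_Mapping.lookup e i) * monom_fun ((Poly_Mapping.lookup e)(i := Poly_Mapping.lookup e i - 1)) x))"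
    using assms poly_below_taylor_monom
    by (intro poly_below_sum poly_below_cmult) (force simp: homogeneous_def)
  then show ?thesis
    unfolding eval_mpoly_monom_fun[of F] eval_partial_deriv
    by (simp add: sum_subtractf right_diff_distrib)
qed

subsection \<open>The Nullstellensatz for polynomial functions\<close>

text \<open>Gaussian elimination: a pivot \<open>c0\<close> clears the coordinate \<open>e0\<close>
  from the other vectors, and induction applies to one vector and one coordinate fewer. Indexing by
  \<open>C\<close> lets equal vectors count separately.\<close>

lemma ex_nontrivial_relation:
  fixes a :: "'c \<Rightarrow> 'e \<Rightarrow> 'f::field"
  assumes "finite E" "finite C" "card E < card C"
  shows "\<exists>w. (\<exists>c\<in>C. w c \<noteq> 0) \<and> (\<forall>e\<in>E. (\<Sum>c\<in>C. w c * a c e) = 0)"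
  using assms
proof (induction E arbitrary: C a rule: finite_induct)
  case empty
  then have "C \<noteq> {}" by auto
  then show ?case by (intro exI[of _ "\<lambda>_. 1"]) auto
next
  case (insert e0 E)
  show ?case
  proof (cases "\<forall>c\<in>C. a c e0 = 0")
    case True
    have "card E < card C" using insert by auto
    from insert.IH[OF insert.prems(1) this, of a] show ?thesis using True by auto
  next
    case False
    then obtain c0 where c0: "c0 \<in> C" "a c0 e0 \<noteq> 0" by auto
    define C' where "C' = C - {c0}"
    have C': "finite C'" "card E < card C'" "c0 \<notin> C'" "C = insert c0 C'"
      using insert c0 by (auto simp: C'_def)
    from insert.IH[OF C'(1,2), of "\<lambda>c e. a c e - a c e0 / a c0 e0 * a c0 e"]
    obtain w where w: "\<exists>c\<in>C'. w c \<noteq> 0"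
      "\<And>e. e \<in> E \<Longrightarrow> (\<Sum>c\<in>C'. w c * (a c e - a c e0 / a c0 e0 * a c0 e)) = 0" by auto
    define w' where "w' = w(c0 := - (\<Sum>c\<in>C'. w c * a c e0 / a c0 e0))"
    have eq: "(\<Sum>c\<in>C. w' c * a c e) = (\<Sum>c\<in>C'. w c * (a c e - a c e0 / a c0 e0 * a c0 e))" for e
    proof -
      have "(\<Sum>c\<in>C'. w' c * a c e) = (\<Sum>c\<in>C'. w c * a c e)"
        using C'(3) by (intro sum.cong) (auto simp: w'_def)
      then show ?thesis
        using C'(1,3) unfolding C'(4)
        by (simp add: w'_def sum_subtractf right_diff_distrib sum_distrib_right mult.assoc)
    qed
    show ?thesis
    proof (intro exI[of _ w'] conjI ballI)
      show "\<exists>c\<in>C. w' c \<noteq> 0" using w(1) C' by (auto simp: w'_def)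
      show "(\<Sum>c\<in>C. w' c * a c e) = 0" if "e \<in> insert e0 E" for e
        unfolding eq using that w(2) c0 by auto
    qed
  qed
qed

definition is_poly :: "('a::comm_ring_1 ^ 'n::finite \<Rightarrow> 'a) \<Rightarrow> bool" where
  "is_poly f \<longleftrightarrow> (\<exists>m. poly_below (Suc m) f)"

lemma poly_below_imp_is_poly: "poly_below m f \<Longrightarrow> is_poly f"
  unfolding is_poly_def by (rule exI[of _ m]) (auto elim: poly_below_mono)

lemma is_poly_mult: "is_poly f \<Longrightarrow> is_poly g \<Longrightarrow> is_poly (\<lambda>x. f x * g x)"
  unfolding is_poly_def using poly_below_mult_Suc by blast

lemma is_poly_add:
  assumes "is_poly f" "is_poly g"
  shows "is_poly (\<lambda>x. f x + g x)"
proof -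
  obtain m l where "poly_below (Suc m) f" "poly_below (Suc l) g"
    using assms by (auto simp: is_poly_def)
  then have "poly_below (Suc (max m l)) f" "poly_below (Suc (max m l)) g"
    by (auto elim: poly_below_mono)
  then show ?thesis unfolding is_poly_def using poly_below_add by blast
qed

lemma is_poly_const: "is_poly (\<lambda>_. c)"
  by (rule poly_below_imp_is_poly[OF poly_below_const[of 1]]) simp

lemma is_poly_coord: "is_poly (\<lambda>x. x $ i)"
  by (rule poly_below_imp_is_poly[OF poly_below_coord[of 2]]) simp

lemma is_poly_diff: "is_poly f \<Longrightarrow> is_poly g \<Longrightarrow> is_poly (\<lambda>x. f x - g x)"
  using is_poly_add[of f "\<lambda>x. (-1) * g x"] is_poly_mult[OF is_poly_const[of "-1"], of g] by simp

lemma is_poly_sum: "(\<And>i. i \<in> I \<Longrightarrow> is_poly (f i)) \<Longrightarrow> is_poly (\<lambda>x. \<Sum>i\<in>I. f i x)"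
  by (induction I rule: infinite_finite_induct) (auto intro: is_poly_const is_poly_add)

lemma is_poly_prod: "(\<And>i. i \<in> I \<Longrightarrow> is_poly (f i)) \<Longrightarrow> is_poly (\<lambda>x. \<Prod>i\<in>I. f i x)"
  by (induction I rule: infinite_finite_induct) (auto intro: is_poly_const is_poly_mult)

lemma is_poly_poly: "is_poly p \<Longrightarrow> is_poly (\<lambda>x. poly G (p x))"
  by (induction G) (auto intro: is_poly_const is_poly_add is_poly_mult)

lemmas is_poly_intros = is_poly_const is_poly_coord is_poly_add is_poly_diff is_poly_mult
  is_poly_sum is_poly_prod is_poly_poly

definition poly_ideal :: "('a::comm_ring_1 ^ 'n::finite \<Rightarrow> 'a) set \<Rightarrow> bool" where
  "poly_ideal J \<longleftrightarrow> (\<lambda>_. 0) \<in> J \<and> (\<forall>f\<in>J. \<forall>g\<in>J. (\<lambda>x. f x + g x) \<in> J) \<and>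
     (\<forall>f\<in>J. \<forall>g. is_poly g \<longrightarrow> (\<lambda>x. g x * f x) \<in> J)"

lemma poly_ideal_add: "poly_ideal J \<Longrightarrow> f \<in> J \<Longrightarrow> g \<in> J \<Longrightarrow> (\<lambda>x. f x + g x) \<in> J"
  and poly_ideal_mult: "poly_ideal J \<Longrightarrow> f \<in> J \<Longrightarrow> is_poly g \<Longrightarrow> (\<lambda>x. g x * f x) \<in> J"
  and poly_ideal_0: "poly_ideal J \<Longrightarrow> (\<lambda>_. 0) \<in> J"
  by (auto simp: poly_ideal_def)

lemma poly_ideal_sum:
  "poly_ideal J \<Longrightarrow> (\<And>i. i \<in> I \<Longrightarrow> f i \<in> J) \<Longrightarrow> (\<lambda>x. \<Sum>i\<in>I. f i x) \<in> J"
  by (induction I rule: infinite_finite_induct) (auto intro: poly_ideal_0 poly_ideal_add)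

text \<open>Over \<complex> the polynomial \<open>G\<close> splits into linear factors, and each
  \<open>p - c\<close> is invertible modulo \<open>J\<close>; so the factors can be stripped off one
  at a time.\<close>

lemma poly_ideal_cancel_poly:
  fixes J :: "(complex ^ 'n::finite \<Rightarrow> complex) set"
  assumes J: "poly_ideal J" and p: "is_poly p"
    and unit: "\<And>c. \<exists>j\<in>J. \<exists>q. is_poly q \<and> (\<forall>x. 1 = j x + (p x - c) * q x)"
  shows "G \<noteq> 0 \<Longrightarrow> is_poly r \<Longrightarrow> (\<lambda>x. poly G (p x) * r x) \<in> J \<Longrightarrow> r \<in> J"
proof (induction "degree G" arbitrary: G r)
  case 0
  then obtain g where g: "G = [:g:]" "g \<noteq> 0" by (metis degree_eq_zeroE pCons_0_0)
  from poly_ideal_mult[OF J 0(4) is_poly_const[of "1 / g"]] show ?case using g by simp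
next
  case (Suc k)
  then obtain c where "poly G c = 0"
    using alg_closed_imp_poly_has_root[of G] by auto
  then obtain G' where G': "G = [:-c, 1:] * G'" by (auto simp: poly_eq_0_iff_dvd elim: dvdE)
  with Suc(3) have "G' \<noteq> 0" by auto
  then have "degree G = Suc (degree G')" unfolding G' by (subst degree_mult_eq) auto
  with Suc(2) have deg: "k = degree G'" by simp
  have "(\<lambda>x. poly G' (p x) * ((p x - c) * r x)) \<in> J"
    using Suc(5) by (simp add: G' algebra_simps)
  moreover have "is_poly (\<lambda>x. (p x - c) * r x)"
    by (intro is_poly_mult is_poly_diff is_poly_const Suc(4) p)
  ultimately have 1: "(\<lambda>x. (p x - c) * r x) \<in> J"
    by (rule Suc(1)[OF deg \<open>G' \<noteq> 0\<close>, rotated])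
  obtain j q where jq: "j \<in> J" "is_poly q" "\<And>x. 1 = j x + (p x - c) * q x"
    using unit[of c] by blast
  have "(\<lambda>x. r x * j x + q x * ((p x - c) * r x)) \<in> J"
    by (rule poly_ideal_add[OF J poly_ideal_mult[OF J jq(1) Suc(4)] poly_ideal_mult[OF J 1 jq(2)]])
  moreover have "r x * j x + q x * ((p x - c) * r x) = r x" for x
  proof -
    have "r x * j x + q x * ((p x - c) * r x) = r x * (j x + (p x - c) * q x)"
      by (simp add: algebra_simps)
    then show ?thesis using jq(3)[of x] by simp
  qed
  ultimately show ?case by simp
qed

text \<open>
  The field \<open>\<complex>\<close> is uncountable while polynomials have a countable basis, so inverses of
  \<open>p - c\<close> modulo \<open>J\<close> for all \<open>c\<close> would be linearly dependent; hence \<open>p\<close> would be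
  algebraic modulo \<open>J\<close>.
\<close>
lemma poly_ideal_all_units:
  fixes J :: "(complex ^ 'n::finite \<Rightarrow> complex) set"
  assumes J: "poly_ideal J" and p: "is_poly p"
    and unit: "\<And>c. \<exists>j\<in>J. \<exists>q. is_poly q \<and> (\<forall>x. 1 = j x + (p x - c) * q x)"
  shows "(\<lambda>_. 1) \<in> J"
proof -
  have "\<forall>c. \<exists>j q. j \<in> J \<and> is_poly q \<and> (\<forall>x. 1 = j x + (p x - c) * q x)"
    using unit by blast
  then obtain j q where j: "\<And>c. j c \<in> J" and q: "\<And>c. is_poly (q c)"
    and jq: "\<And>c x. 1 = j c x + (p x - c) * q c x" unfolding choice_iff by blast
  from q have "\<forall>c. \<exists>m. poly_below (Suc m) (q c)" unfolding is_poly_def by blast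
  then obtain m where m: "\<And>c. poly_below (Suc (m c)) (q c)" unfolding choice_iff by blast
  \<comment> \<open>Pigeonhole: uncountably many \<open>c\<close>, countably many degree
    bounds.\<close>
  have "\<exists>k. infinite {c. m c = k}"
  proof (rule ccontr)
    assume "\<not> ?thesis"
    then have "countable (\<Union>k. {c. m c = k})" by (intro countable_UN) (auto intro: countable_finite)
    moreover have "(\<Union>k. {c. m c = k}) = UNIV" by auto
    ultimately show False using uncountable_UNIV_complex by simp
  qed
  then obtain k where k: "infinite {c. m c = k}" by blast
  define E where "E = {e :: 'n \<Rightarrow> nat. sum e UNIV < Suc k}"
  have E: "finite E" unfolding E_def by (rule finite_exponents)
  obtain C where C: "C \<subseteq> {c. m c = k}" "finite C" "card C = Suc (card E)"
    using infinite_arbitrarily_large[OF k, of "Suc (card E)"] by blast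
  have "\<forall>c\<in>C. \<exists>a. \<forall>x. q c x = (\<Sum>e\<in>E. a e * monom_fun e x)"
  proof
    fix c assume "c \<in> C"
    then have "m c = k" using C(1) by blast
    with poly_below_coeffs[OF m[of c]] show "\<exists>a. \<forall>x. q c x = (\<Sum>e\<in>E. a e * monom_fun e x)"
      unfolding E_def by blast
  qed
  from bchoice[OF this] obtain a
    where a: "\<And>c x. c \<in> C \<Longrightarrow> q c x = (\<Sum>e\<in>E. a c e * monom_fun e x)" by blast
  obtain w where w: "\<exists>c\<in>C. w c \<noteq> 0" "\<And>e. e \<in> E \<Longrightarrow> (\<Sum>c\<in>C. w c * a c e) = 0"
    using ex_nontrivial_relation[OF E C(2), of a] C(3) by auto
  have wq: "(\<Sum>c\<in>C. w c * q c x) = 0" for x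
  proof -
    have "(\<Sum>c\<in>C. w c * q c x) = (\<Sum>c\<in>C. \<Sum>e\<in>E. w c * a c e * monom_fun e x)"
      by (rule sum.cong) (auto simp: a sum_distrib_left mult.assoc)
    also have "\<dots> = (\<Sum>e\<in>E. (\<Sum>c\<in>C. w c * a c e) * monom_fun e x)"
      by (subst sum.swap) (simp add: sum_distrib_right)
    finally show ?thesis using w(2) by simp
  qed
  \<comment> \<open>The numerator of the rational function
    \<open>\<Sum>c\<in>C. w c / (t - c)\<close>. It is nonzero because at \<open>c0\<close> only the
    summand of \<open>c0\<close> survives, and \<open>wq\<close> puts \<open>poly G (p x)\<close>
    into \<open>J\<close>.\<close>
  define G where "G = (\<Sum>c\<in>C. Polynomial.smult (w c) (\<Prod>c'\<in>C - {c}. [:-c', 1:]))"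
  have poly_G: "poly G t = (\<Sum>c\<in>C. w c * (\<Prod>c'\<in>C - {c}. (t - c')))" for t
    by (simp add: G_def poly_sum poly_prod)
  obtain c0 where c0: "c0 \<in> C" "w c0 \<noteq> 0" using w(1) by blast
  have "poly G c0 = w c0 * (\<Prod>c'\<in>C - {c0}. (c0 - c'))"
    unfolding poly_G using C(2) c0(1) by (subst sum.remove[of _ c0]) (auto intro!: sum.neutral)
  also have "\<dots> \<noteq> 0" using c0 C(2) by auto
  finally have "G \<noteq> 0" by auto
  have "poly G (p x) * 1 = (\<Sum>c\<in>C. (w c * (\<Prod>c'\<in>C - {c}. (p x - c'))) * j c x)" for x
  proof -
    have "poly G (p x) = (\<Sum>c\<in>C. w c * (\<Prod>c'\<in>C - {c}. (p x - c')) * (j c x + (p x - c) * q c x))"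
      unfolding poly_G using jq by simp
    also have "\<dots> = (\<Sum>c\<in>C. (w c * (\<Prod>c'\<in>C - {c}. (p x - c'))) * j c x
         + (\<Prod>c'\<in>C. (p x - c')) * (w c * q c x))"
      by (rule sum.cong) (auto simp: prod.remove[OF C(2)] algebra_simps)
    also have "\<dots> = (\<Sum>c\<in>C. (w c * (\<Prod>c'\<in>C - {c}. (p x - c'))) * j c x)"
      by (simp add: sum.distrib sum_distrib_left[symmetric] wq)
    finally show ?thesis by simp
  qed
  moreover have "(\<lambda>x. \<Sum>c\<in>C. (w c * (\<Prod>c'\<in>C - {c}. (p x - c'))) * j c x) \<in> J"
    using J j p by (intro poly_ideal_sum poly_ideal_mult is_poly_intros)
  ultimately have "(\<lambda>x. poly G (p x) * 1) \<in> J" by simp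
  from poly_ideal_cancel_poly[OF J p unit \<open>G \<noteq> 0\<close> is_poly_const this] show ?thesis .
qed

text \<open>Fixing one coordinate at a time replaces the choice of a maximal ideal. Some
  \<open>x $ i - c\<close> can be adjoined without reaching \<open>1\<close>, for otherwise all of
  them would be units modulo \<open>J'\<close>, which \<open>poly_ideal_all_units\<close>
  excludes.\<close>

lemma poly_ideal_extend:
  fixes J :: "(complex ^ 'n::finite \<Rightarrow> complex) set"
  assumes "finite V" "poly_ideal J" "(\<lambda>_. 1) \<notin> J"
  shows "\<exists>J'. poly_ideal J' \<and> J \<subseteq> J' \<and> (\<lambda>_. 1) \<notin> J' \<and> (\<forall>i\<in>V. \<exists>c. (\<lambda>x. x $ i - c) \<in> J')"
  using assms
proof (induction V rule: finite_induct)
  case (insert i V)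
  then obtain J' where J': "poly_ideal J'" "J \<subseteq> J'" "(\<lambda>_. 1) \<notin> J'"
    "\<forall>i\<in>V. \<exists>c. (\<lambda>x. x $ i - c) \<in> J'" by blast
  have "\<exists>c. \<forall>j\<in>J'. \<forall>q. is_poly q \<longrightarrow> (\<exists>x. 1 \<noteq> j x + (x $ i - c) * q x)"
    using poly_ideal_all_units[OF J'(1) is_poly_coord[of i]] J'(3) by blast
  then obtain c where c: "\<And>j q. j \<in> J' \<Longrightarrow> is_poly q \<Longrightarrow> \<exists>x. 1 \<noteq> j x + (x $ i - c) * q x" by blast
  define K where "K = {f. \<exists>j\<in>J'. \<exists>q. is_poly q \<and> f = (\<lambda>x. j x + (x $ i - c) * q x)}"
  have KI: "(\<lambda>x. j x + (x $ i - c) * q x) \<in> K" if "j \<in> J'" "is_poly q" for j q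
    using that unfolding K_def by blast
  have sub: "J' \<subseteq> K"
    using KI[OF _ is_poly_const[of 0]] by auto
  have ideal: "poly_ideal K"
    unfolding poly_ideal_def
  proof (intro conjI ballI allI impI)
    show "(\<lambda>_. 0) \<in> K" using sub poly_ideal_0[OF J'(1)] by blast
  next
    fix f g assume "f \<in> K" "g \<in> K"
    then obtain j q j' q' where *: "j \<in> J'" "is_poly q" "f = (\<lambda>x. j x + (x $ i - c) * q x)"
      "j' \<in> J'" "is_poly q'" "g = (\<lambda>x. j' x + (x $ i - c) * q' x)" unfolding K_def by blast
    have "(\<lambda>x. (j x + j' x) + (x $ i - c) * (q x + q' x)) \<in> K"
      using * J'(1) by (intro KI poly_ideal_add is_poly_intros)
    then show "(\<lambda>x. f x + g x) \<in> K" using * by (simp add: algebra_simps)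
  next
    fix f g :: "complex ^ 'n \<Rightarrow> complex" assume "f \<in> K" and g: "is_poly g"
    then obtain j q where *: "j \<in> J'" "is_poly q" "f = (\<lambda>x. j x + (x $ i - c) * q x)"
      unfolding K_def by blast
    have "(\<lambda>x. (g x * j x) + (x $ i - c) * (g x * q x)) \<in> K"
      using * g J'(1) by (intro KI poly_ideal_mult is_poly_intros)
    then show "(\<lambda>x. g x * f x) \<in> K" using * by (simp add: algebra_simps)
  qed
  have "(\<lambda>x. x $ i - c) \<in> K"
    using KI[OF poly_ideal_0[OF J'(1)] is_poly_const[of 1]] by simp
  moreover have "(\<lambda>_. 1) \<notin> K"
    using c unfolding K_def by (auto simp: fun_eq_iff)
  ultimately show ?case
    using ideal sub J'(2,4) by (intro exI[of _ K]) blast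
qed auto

text \<open>If the ideal of the \<open>G i\<close> missed \<open>1\<close>, it could be enlarged
  until each coordinate is congruent to a constant. Every polynomial is then congruent to its value
  at the point \<open>z\<close> of these constants, and a nonzero value \<open>G i z\<close> would
  produce \<open>1\<close>; so \<open>z\<close> would be a common zero.\<close>

theorem nullstellensatz:
  fixes G :: "'i::finite \<Rightarrow> complex ^ 'n::finite \<Rightarrow> complex"
  assumes G: "\<And>i. is_poly (G i)" and no_zero: "\<And>x. \<exists>i. G i x \<noteq> 0"
  obtains q where "\<And>i. is_poly (q i)" "\<And>x. 1 = (\<Sum>i\<in>UNIV. q i x * G i x)"
proof -
  define J where "J = {f. \<exists>q. (\<forall>i. is_poly (q i)) \<and> f = (\<lambda>x. \<Sum>i\<in>UNIV. q i x * G i x)}"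
  have JI: "(\<lambda>x. \<Sum>i\<in>UNIV. q i x * G i x) \<in> J" if "\<And>i. is_poly (q i)" for q
    using that unfolding J_def by blast
  have ideal: "poly_ideal J"
    unfolding poly_ideal_def
  proof (intro conjI ballI allI impI)
    show "(\<lambda>_. 0) \<in> J" using JI[of "\<lambda>_ _. 0"] by (simp add: is_poly_const)
  next
    fix f g assume "f \<in> J" "g \<in> J"
    then obtain q q' where *: "\<And>i. is_poly (q i)" "f = (\<lambda>x. \<Sum>i\<in>UNIV. q i x * G i x)"
      "\<And>i. is_poly (q' i)" "g = (\<lambda>x. \<Sum>i\<in>UNIV. q' i x * G i x)" unfolding J_def by blast
    have "(\<lambda>x. \<Sum>i\<in>UNIV. (q i x + q' i x) * G i x) \<in> J"
      using * by (intro JI is_poly_intros)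
    then show "(\<lambda>x. f x + g x) \<in> J" using * by (simp add: distrib_right sum.distrib)
  next
    fix f g :: "complex ^ 'n \<Rightarrow> complex" assume "f \<in> J" and g: "is_poly g"
    then obtain q where *: "\<And>i. is_poly (q i)" "f = (\<lambda>x. \<Sum>i\<in>UNIV. q i x * G i x)"
      unfolding J_def by blast
    have "(\<lambda>x. \<Sum>i\<in>UNIV. (g x * q i x) * G i x) \<in> J"
      using * g by (intro JI is_poly_intros)
    then show "(\<lambda>x. g x * f x) \<in> J" using * by (simp add: sum_distrib_left mult.assoc)
  qed
  have "(\<lambda>_. 1) \<in> J"
  proof (rule ccontr)
    assume "(\<lambda>_. 1) \<notin> J"
    then obtain J' where J': "poly_ideal J'" "J \<subseteq> J'" "(\<lambda>_. 1) \<notin> J'"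
      "\<forall>i\<in>UNIV. \<exists>c. (\<lambda>x. x $ i - c) \<in> J'"
      using poly_ideal_extend[of UNIV J] ideal by auto
    then have "\<forall>i. \<exists>c. (\<lambda>x. x $ i - c) \<in> J'" by blast
    then obtain c where c: "\<And>i. (\<lambda>x. x $ i - c i) \<in> J'" unfolding choice_iff by blast
    define z where "z = (\<chi> i. c i)"
    have cong_mult: "(\<lambda>x. f x * g x - f z * g z) \<in> J'"
      if "is_poly g" "(\<lambda>x. f x - f z) \<in> J'" "(\<lambda>x. g x - g z) \<in> J'" for f g
    proof -
      have "(\<lambda>x. g x * (f x - f z) + f z * (g x - g z)) \<in> J'"
        using that J'(1) by (intro poly_ideal_add poly_ideal_mult is_poly_const)
      then show ?thesis by (simp add: algebra_simps)
    qed
    have cong_power: "(\<lambda>x. x $ i ^ k - z $ i ^ k) \<in> J'" for i k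
    proof (induction k)
      case 0
      then show ?case using poly_ideal_0[OF J'(1)] by simp
    next
      case (Suc k)
      have "is_poly (\<lambda>x::complex^'n. x $ i ^ k)"
        using poly_below_imp_is_poly[OF poly_below_coord_power[of k "Suc k"]] by simp
      from cong_mult[OF this _ Suc, of "\<lambda>x. x $ i"] c[of i] show ?case
        by (simp add: z_def)
    qed
    have cong_prod: "(\<lambda>x. (\<Prod>i\<in>I. x $ i ^ e i) - (\<Prod>i\<in>I. z $ i ^ e i)) \<in> J'" for I and e :: "'n \<Rightarrow> nat"
    proof (induction I rule: infinite_finite_induct)
      case (insert i I)
      have "is_poly (\<lambda>x::complex^'n. \<Prod>i\<in>I. x $ i ^ e i)"
        by (intro is_poly_prod poly_below_imp_is_poly[OF poly_below_coord_power]) (rule lessI)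
      from cong_mult[OF this cong_power insert.IH] insert.hyps show ?case by simp
    qed (use poly_ideal_0[OF J'(1)] in simp_all)
    have cong: "(\<lambda>x. f x - f z) \<in> J'" if "poly_below m f" for m f
      using that
    proof induction
      case zero
      then show ?case using poly_ideal_0[OF J'(1)] by simp
    next
      case (step f e c)
      have "(\<lambda>x. (f x - f z) + c * (monom_fun e x - monom_fun e z)) \<in> J'"
        using step.IH cong_prod[where I = UNIV and e = e] J'(1) unfolding monom_fun_def
        by (intro poly_ideal_add poly_ideal_mult is_poly_const)
      then show ?case by (simp add: algebra_simps)
    qed
    have "G i z = 0" for i
    proof (rule ccontr)
      assume nz: "G i z \<noteq> 0"
      have "(\<lambda>x. \<Sum>k\<in>UNIV. (if k = i then 1 else 0) * G k x) \<in> J"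
        by (intro JI) (auto intro: is_poly_const)
      then have "G i \<in> J'" using J'(2) by (auto simp: if_distrib[of "\<lambda>t. t * _"] cong: if_cong)
      moreover have "(\<lambda>x. G i x - G i z) \<in> J'" using cong G unfolding is_poly_def by blast
      ultimately have "(\<lambda>x. (1 / G i z) * G i x + (- 1 / G i z) * (G i x - G i z)) \<in> J'"
        using J'(1) by (intro poly_ideal_add poly_ideal_mult is_poly_const)
      moreover have "(1 / G i z) * G i x + (- 1 / G i z) * (G i x - G i z) = 1" for x
        using nz by (simp add: field_simps)
      ultimately show False using J'(3) by simp
    qed
    with no_zero show False by blast
  qed
  then show ?thesis using that unfolding J_def by (auto simp: fun_eq_iff)
qed

text \<open>Adding the equation \<open>x $ i = 1\<close> to the forms leaves no common zero at all,
  so the affine theorem applies. Its identity at the point \<open>x / x $ i\<close>, multiplied by a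
  power of \<open>x $ i\<close>, is an identity in \<open>x\<close> with control of the
  degrees.\<close>

lemma homogeneous_nullstellensatz:
  fixes G :: "'i::finite \<Rightarrow> complex ^ 'n::finite \<Rightarrow> complex"
  assumes G: "\<And>j. is_poly (G j)" and hom: "\<And>j c x. G j (c *s x) = c ^ r * G j x"
    and no_zero: "\<And>x. x \<noteq> 0 \<Longrightarrow> \<exists>j. G j x \<noteq> 0"
  shows "\<exists>D q. r \<le> D \<and> (\<forall>j. poly_below (Suc (D - r)) (q j)) \<and> (\<forall>x. x $ i ^ D = (\<Sum>j\<in>UNIV. q j x * G j x))"
proof -
  define G' where "G' = (\<lambda>j. case j of None \<Rightarrow> (\<lambda>x. x $ i - 1) | Some j \<Rightarrow> G j)"
  have "is_poly (G' j)" for j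
    by (cases j) (auto simp: G'_def intro: G is_poly_intros)
  moreover have "\<exists>j. G' j x \<noteq> 0" for x
  proof (cases "x $ i = 1")
    case True
    then have "x \<noteq> 0" by auto
    from no_zero[OF this] obtain j where "G j x \<noteq> 0" by blast
    then show ?thesis by (intro exI[of _ "Some j"]) (simp add: G'_def)
  qed (auto intro!: exI[of _ None] simp: G'_def)
  ultimately obtain q where q: "\<And>j. is_poly (q j)" "\<And>x. 1 = (\<Sum>j\<in>UNIV. q j x * G' j x)"
    using nullstellensatz[of G'] by blast
  from q(1) have "\<forall>j. \<exists>m. poly_below (Suc m) (q j)" unfolding is_poly_def by blast
  then obtain m where m: "\<And>j. poly_below (Suc (m j)) (q j)" unfolding choice_iff by blast
  define M where "M = Max (range m)"
  have "m j \<le> M" for j unfolding M_def by (rule Max_ge) auto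
  then have qM: "poly_below (Suc M) (q j)" for j using poly_below_mono[OF m[of j], of "Suc M"] by simp
  have "\<forall>j. \<exists>a. \<forall>x. q j x = (\<Sum>e | sum e UNIV < Suc M. a e * monom_fun e x)"
    using poly_below_coeffs[OF qM] by blast
  then obtain a where a: "\<And>j x. q j x = (\<Sum>e | sum e UNIV < Suc M. a j e * monom_fun e x)"
    unfolding choice_iff by blast
  \<comment> \<open>The homogenisation of \<open>q (Some j)\<close> to degree \<open>M\<close> by
    means of the variable \<open>x $ i\<close>.\<close>
  define p where "p = (\<lambda>j x. \<Sum>e | sum e UNIV < Suc M. a (Some j) e * (monom_fun e x * x $ i ^ (M - sum e UNIV)))"
  have p: "poly_below (Suc M) (p j)" for j
    unfolding p_def
  proof (rule poly_below_sum, rule poly_below_cmult)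
    fix e :: "'n \<Rightarrow> nat" assume e: "e \<in> {e. sum e UNIV < Suc M}"
    have "poly_below (sum e UNIV + Suc (M - sum e UNIV)) (\<lambda>x::complex^'n. monom_fun e x * x $ i ^ (M - sum e UNIV))"
      by (intro poly_below_monom_mult poly_below_coord_power) simp
    then show "poly_below (Suc M) (\<lambda>x::complex^'n. monom_fun e x * x $ i ^ (M - sum e UNIV))"
      using e by simp
  qed
  have nz: "x $ i ^ (M + r) = (\<Sum>j\<in>UNIV. p j x * G j x)" if "x $ i \<noteq> 0" for x
  proof -
    define y where "y = inverse (x $ i) *s x"
    have y: "y $ i = 1" using that by (simp add: y_def)
    have qp: "x $ i ^ M * q (Some j) y = p j x" for j
      unfolding a p_def sum_distrib_left
    proof (rule sum.cong[OF refl])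
      fix e :: "'n \<Rightarrow> nat" assume e: "e \<in> {e. sum e UNIV < Suc M}"
      then have "x $ i ^ M = x $ i ^ (M - sum e UNIV) * x $ i ^ sum e UNIV"
        by (simp flip: power_add)
      then show "x $ i ^ M * (a (Some j) e * monom_fun e y) = a (Some j) e * (monom_fun e x * x $ i ^ (M - sum e UNIV))"
        using that by (simp add: y_def monom_fun_scale power_inverse field_simps)
    qed
    have "1 = (\<Sum>j\<in>UNIV. q (Some j) y * G j y)"
      using q(2)[of y] y by (simp add: UNIV_option_conv sum.reindex G'_def)
    also have "\<dots> = (\<Sum>j\<in>UNIV. q (Some j) y * G j x) * inverse (x $ i) ^ r"
      by (simp add: y_def hom sum_distrib_left sum_distrib_right algebra_simps)
    finally have "x $ i ^ r = (\<Sum>j\<in>UNIV. q (Some j) y * G j x)"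
      using that by (simp add: field_simps power_inverse)
    then have "x $ i ^ (M + r) = x $ i ^ M * (\<Sum>j\<in>UNIV. q (Some j) y * G j x)"
      by (simp add: power_add)
    also have "\<dots> = (\<Sum>j\<in>UNIV. p j x * G j x)"
      by (simp add: sum_distrib_left qp[symmetric] mult.assoc)
    finally show ?thesis .
  qed
  have "x $ i ^ (M + r) = (\<Sum>j\<in>UNIV. p j x * G j x)" for x
  proof (cases "x $ i = 0")
    case True
    \<comment> \<open>On the hyperplane \<open>x $ i = 0\<close> one cannot divide; there the
      identity follows by continuity along the \<open>i\<close>-th axis.\<close>
    define h where "h = (\<lambda>t. (x + axis i t) $ i ^ (M + r) - (\<Sum>j\<in>UNIV. p j (x + axis i t) * G j (x + axis i t)))"
    have cont: "continuous_on UNIV (\<lambda>t. f (x + axis i t))" if "is_poly f" for f :: "complex ^ 'n \<Rightarrow> complex"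
    proof -
      have "continuous_on UNIV (\<lambda>t::complex. x $ k + (if k = i then t else 0))" for k
        by (cases "k = i") (auto intro!: continuous_intros)
      then have "continuous_on UNIV (\<lambda>t::complex. \<chi> k. x $ k + (if k = i then t else 0))"
        by (rule continuous_on_vec_lambda)
      then have "continuous_on UNIV (\<lambda>t. x + axis i t)"
        by (rule continuous_on_eq) (auto simp: vec_eq_iff axis_def)
      moreover have "continuous_on UNIV f" using that poly_below_continuous unfolding is_poly_def by blast
      ultimately show ?thesis
        using continuous_on_compose2[of UNIV f UNIV "\<lambda>t. x + axis i t"] by auto
    qed
    have "continuous_on UNIV h"
      unfolding h_def
      by (intro continuous_on_diff continuous_on_power continuous_on_sum continuous_on_mult
          cont[OF is_poly_coord] cont[OF G] cont[OF poly_below_imp_is_poly[OF p]])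
    then have "h \<midarrow>0\<rightarrow> h 0" by (simp add: continuous_on_def)
    moreover have "h \<midarrow>0\<rightarrow> 0"
    proof (rule Lim_transform_eventually)
      show "eventually (\<lambda>t. 0 = h t) (at 0)"
        unfolding eventually_at_filter
        using nz[of "x + axis i t" for t] True by (auto simp: h_def axis_def)
    qed simp
    ultimately have "h 0 = 0" using tendsto_unique by (metis trivial_limit_at)
    then show ?thesis by (simp add: h_def axis_def zero_vec_def[symmetric])
  qed (rule nz)
  then show ?thesis using p by (intro exI[of _ "M + r"] exI[of _ p]) auto
qed

text \<open>On \<open>S\<close> each form \<open>G j\<close> equals \<open>G j - Q j\<close>, which
  has lower degree, so each \<open>x $ i ^ D i\<close> can be rewritten in lower degree. All
  polynomials thus reduce on \<open>S\<close> to degree below \<open>L\<close>, and as polynomials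
  separate points, \<open>S\<close> has no more points than there are such monomials. The bound
  depends on the forms \<open>G\<close> alone, hence is uniform in \<open>Q\<close>.\<close>

theorem card_common_zeros_bounded:
  fixes G :: "'i::finite \<Rightarrow> complex ^ 'n::finite \<Rightarrow> complex"
  assumes G: "\<And>j. is_poly (G j)" and hom: "\<And>j c x. G j (c *s x) = c ^ r * G j x"
    and no_zero: "\<And>x. x \<noteq> 0 \<Longrightarrow> \<exists>j. G j x \<noteq> 0"
  obtains C where "\<And>S Q. (\<And>j. poly_below r (\<lambda>x. Q j x - G j x)) \<Longrightarrow> (\<And>s j. s \<in> S \<Longrightarrow> Q j s = 0)
    \<Longrightarrow> finite S \<and> card S \<le> C"
proof -
  have "\<forall>i. \<exists>D q. r \<le> D \<and> (\<forall>j. poly_below (Suc (D - r)) (q j)) \<and> (\<forall>x. x $ i ^ D = (\<Sum>j\<in>UNIV. q j x * G j x))"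
    by (intro allI homogeneous_nullstellensatz[where G = G and r = r] assms)
  then obtain D q where D: "\<And>i::'n. r \<le> D i" and q: "\<And>i j. poly_below (Suc (D i - r)) (q i j)"
    and Dq: "\<And>i x. x $ i ^ D i = (\<Sum>j\<in>UNIV. q i j x * G j x)" unfolding choice_iff by blast
  \<comment> \<open>A monomial of degree at least \<open>L\<close> is divisible by some
    \<open>x $ i ^ D i\<close>, by pigeonhole.\<close>
  define L where "L = sum D UNIV"
  define E where "E = {e :: 'n \<Rightarrow> nat. sum e UNIV < L}"
  have E: "finite E" unfolding E_def by (rule finite_exponents)
  show ?thesis
  proof (rule that[of "card E"])
    fix S Q
    assume Q: "\<And>j. poly_below r (\<lambda>x. Q j x - G j x)" and S: "\<And>s j. s \<in> S \<Longrightarrow> Q j s = 0"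
    have red1: "\<exists>g. poly_below (L + k) g \<and> (\<forall>s\<in>S. f s = g s)" if "poly_below (Suc (L + k)) f" for f k
      using that
    proof induction
      case zero
      then show ?case by (intro exI[of _ "\<lambda>_. 0"]) (auto intro: poly_below.zero)
    next
      case (step f e c)
      then obtain g where g: "poly_below (L + k) g" "\<And>s. s \<in> S \<Longrightarrow> f s = g s" by blast
      show ?case
      proof (cases "sum e UNIV < L + k")
        case True
        then show ?thesis using g
          by (intro exI[of _ "\<lambda>x. g x + c * monom_fun e x"]) (auto intro: poly_below.step)
      next
        case False
        then have se: "sum e UNIV = L + k" using step.hyps by simp
        have "\<exists>i. D i \<le> e i"
        proof (rule ccontr)
          assume "\<not> ?thesis"
          then have "sum e UNIV < sum D UNIV" by (intro sum_strict_mono) (auto simp: not_le)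
          then show False using se L_def by simp
        qed
        then obtain i where i: "D i \<le> e i" by blast
        define e' where "e' = e(i := e i - D i)"
        have "e j = e' j + (if j = i then D i else 0)" for j using i by (auto simp: e'_def)
        then have e_eq: "e = (\<lambda>j. e' j + (if j = i then D i else 0))" by blast
        have se': "sum e' UNIV + D i = L + k"
          using se by (subst (asm) e_eq) (simp add: sum.distrib)
        have mono: "monom_fun e x = monom_fun e' x * (\<Sum>j\<in>UNIV. q i j x * G j x)" for x :: "complex ^ 'n"
          by (subst e_eq) (simp add: monom_fun_add monom_fun_single Dq)
        define h where "h = (\<lambda>x. monom_fun e' x * (\<Sum>j\<in>UNIV. q i j x * (Q j x - G j x)))"
        have "poly_below (sum e' UNIV + (D i - r + r)) h"
          unfolding h_def by (intro poly_below_monom_mult poly_below_sum poly_below_mult q Q)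
        then have h: "poly_below (L + k) h" using D[of i] se' by simp
        have hs: "monom_fun e s = - h s" if "s \<in> S" for s
          unfolding mono h_def using S[OF that] by (simp add: sum_negf)
        show ?thesis
        proof (intro exI conjI ballI)
          show "poly_below (L + k) (\<lambda>x. g x + (- c) * h x)"
            by (rule poly_below_add[OF g(1) poly_below_cmult[OF h]])
          show "f s + c * monom_fun e s = g s + (- c) * h s" if "s \<in> S" for s
            using g(2)[OF that] hs[OF that] by simp
        qed
      qed
    qed
    have red: "\<exists>g. poly_below L g \<and> (\<forall>s\<in>S. f s = g s)" if "poly_below (L + k) f" for f k
      using that
    proof (induction k arbitrary: f)
      case (Suc k)
      then have "poly_below (Suc (L + k)) f" by simp
      from red1[OF this] obtain g where g: "poly_below (L + k) g" "\<forall>s\<in>S. f s = g s" by blast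
      from Suc.IH[OF g(1)] g(2) show ?case by auto
    qed auto
    have bound: "card T \<le> card E" if T: "T \<subseteq> S" "finite T" for T
    proof (rule ccontr)
      assume "\<not> ?thesis"
      then obtain w where w: "\<exists>s\<in>T. w s \<noteq> 0" "\<And>e. e \<in> E \<Longrightarrow> (\<Sum>s\<in>T. w s * monom_fun e s) = 0"
        using ex_nontrivial_relation[OF E T(2), of "\<lambda>s e. monom_fun e s"] by auto
      have ann: "(\<Sum>s\<in>T. w s * f s) = 0" if "is_poly f" for f
      proof -
        from that obtain m where "poly_below (Suc m) f" by (auto simp: is_poly_def)
        then have "poly_below (L + Suc m) f" by (rule poly_below_mono) simp
        from red[OF this] obtain g where g: "poly_below L g" "\<And>s. s \<in> S \<Longrightarrow> f s = g s" by blast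
        obtain b where b: "\<And>x. g x = (\<Sum>e\<in>E. b e * monom_fun e x)"
          using poly_below_coeffs[OF g(1)] unfolding E_def by blast
        have "(\<Sum>s\<in>T. w s * f s) = (\<Sum>s\<in>T. \<Sum>e\<in>E. b e * (w s * monom_fun e s))"
          using T(1) g(2) by (intro sum.cong) (auto simp: b sum_distrib_left algebra_simps subset_iff)
        also have "\<dots> = (\<Sum>e\<in>E. b e * (\<Sum>s\<in>T. w s * monom_fun e s))"
          by (subst sum.swap) (simp add: sum_distrib_left)
        also have "\<dots> = 0" using w(2) by simp
        finally show ?thesis .
      qed
      obtain s0 where s0: "s0 \<in> T" "w s0 \<noteq> 0" using w(1) by blast
      have "\<forall>s\<in>T - {s0}. \<exists>i. s0 $ i \<noteq> s $ i"
        by (auto simp: vec_eq_iff)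
      from bchoice[OF this] obtain i where i: "\<And>s. s \<in> T - {s0} \<Longrightarrow> s0 $ i s \<noteq> s $ i s" by blast
      \<comment> \<open>A polynomial that vanishes on \<open>T\<close> except at \<open>s0\<close>,
        where the relation has a nonzero weight.\<close>
      define f where "f = (\<lambda>x::complex^'n. \<Prod>s\<in>T - {s0}. (x $ i s - s $ i s))"
      have "is_poly f" unfolding f_def by (intro is_poly_intros)
      from ann[OF this] have "0 = (\<Sum>s\<in>T. w s * f s)" by simp
      also have "\<dots> = w s0 * f s0"
        using T(2) s0(1) by (subst sum.remove[of _ s0]) (auto intro!: sum.neutral prod_zero simp: f_def)
      finally have "f s0 = 0" using s0(2) by simp
      then show False using i T(2) by (auto simp: f_def)
    qed
    show "finite S \<and> card S \<le> card E"
      by (rule finite_if_finite_subsets_card_bdd) (use bound in auto)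
  qed
qed

subsection \<open>Additive characters\<close>

definition echar :: "real \<Rightarrow> complex" where "echar t = cis (2 * pi * t)"

lemma norm_echar [simp]: "norm (echar t) = 1"
  by (simp add: echar_def)

lemma echar_0 [simp]: "echar 0 = 1"
  by (simp add: echar_def)

lemma echar_add: "echar (s + t) = echar s * echar t"
  by (simp add: echar_def cis_mult algebra_simps)

lemma echar_diff: "echar (s - t) = echar s * cnj (echar t)"
  by (simp add: echar_def cis_cnj cis_mult algebra_simps)

lemma cnj_echar: "cnj (echar t) = echar (- t)"
  by (simp add: echar_def cis_cnj)

lemma echar_of_int [simp]: "echar (of_int k) = 1"
  unfolding echar_def using cis_multiple_2pi[of "of_int k"] by simp

lemma echar_add_of_int: "echar (t + of_int k) = echar t"
  by (simp add: echar_add)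

lemma echar_of_nat_mult: "echar (of_nat k * t) = echar t ^ k"
  unfolding echar_def Complex.DeMoivre by (simp add: algebra_simps)

lemma sin_ge_half:
  assumes "0 \<le> x" "x \<le> pi / 2"
  shows "x / 2 \<le> sin (x::real)"
proof (cases "x \<le> pi / 3")
  case True
  have "sin 0 - 0 / 2 \<le> sin x - x / 2"
  proof (rule DERIV_nonneg_imp_nondecreasing[of 0 x "\<lambda>x. sin x - x / 2"])
    show "0 \<le> x" by fact
    fix y assume y: "0 \<le> y" "y \<le> x"
    have "cos (pi / 3) \<le> cos y" by (rule cos_monotone_0_pi_le) (use y True pi_gt_zero in auto)
    then show "\<exists>d. ((\<lambda>x. sin x - x / 2) has_real_derivative d) (at y) \<and> 0 \<le> d"
      by (intro exI[of _ "cos y - 1 / 2"]) (auto intro!: derivative_eq_intros simp: cos_60)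
  qed
  then show ?thesis by simp
next
  case False
  have "sin (pi / 3) \<le> sin x" by (rule sin_monotone_2pi_le) (use False assms in auto)
  moreover have "x / 2 < 4 / 5"
    using assms pi_approx(2) by simp
  moreover have "(8 / 5)\<^sup>2 < (sqrt 3)\<^sup>2" by (simp add: power2_eq_square)
  then have "8 / 5 < sqrt 3" by (rule power_less_imp_less_base) simp
  ultimately show ?thesis by (simp add: sin_60)
qed

lemma norm_echar_minus_1: "norm (echar t - 1) = 2 * \<bar>sin (pi * t)\<bar>"
proof -
  have "(norm (echar t - 1))\<^sup>2 = (cos (2 * (pi * t)) - 1)\<^sup>2 + (sin (2 * (pi * t)))\<^sup>2"
    by (simp add: echar_def cmod_power2 algebra_simps)
  also have "\<dots> = 2 - 2 * cos (2 * (pi * t))"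
    using sin_cos_squared_add[of "2 * (pi * t)"] by (simp add: power2_eq_square algebra_simps)
  also have "\<dots> = (2 * \<bar>sin (pi * t)\<bar>)\<^sup>2"
    by (simp add: cos_double_sin power2_eq_square)
  finally show ?thesis by (rule power2_eq_imp_eq) auto
qed

text \<open>The chord has length \<open>2 * \<bar>sin (pi * t)\<bar>\<close>. The sharp constant is
  4; the value 3 comes from \<open>sin_ge_half\<close> and \<open>pi > 3\<close>.\<close>

lemma norm_echar_minus_1_ge:
  assumes "\<bar>t\<bar> \<le> 1 / 2"
  shows "3 * \<bar>t\<bar> \<le> norm (echar t - 1)"
proof -
  have "pi * \<bar>t\<bar> / 2 \<le> sin (pi * \<bar>t\<bar>)"
    using assms by (intro sin_ge_half) (auto simp: field_simps)
  also have "\<dots> \<le> \<bar>sin (pi * t)\<bar>" by (cases "t \<ge> 0") auto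
  finally have "pi * \<bar>t\<bar> / 2 \<le> \<bar>sin (pi * t)\<bar>" .
  moreover have "3 * \<bar>t\<bar> \<le> pi * \<bar>t\<bar>" using pi_gt3 by (intro mult_right_mono) auto
  ultimately show ?thesis by (simp add: norm_echar_minus_1)
qed

lemma norm_echar_minus_1_ge_round: "3 * \<bar>t - of_int (round t)\<bar> \<le> norm (echar t - 1)"
proof -
  have "\<bar>t - of_int (round t)\<bar> \<le> 1 / 2"
    using of_int_round_abs_le[of t] by (simp add: abs_minus_commute)
  from norm_echar_minus_1_ge[OF this] show ?thesis
    using echar_add_of_int[of t "- round t"] by simp
qed

subsection \<open>Growth of a cusp form near the real axis\<close>

lemma norm_fourier_term:
  "norm (c * exp (2 * of_real pi * \<i> * of_nat m * z)) = norm c * exp (- 2 * pi * real m * Im z)"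
  by (simp add: norm_mult)

lemma cuspidal_fourier_summable:
  assumes "has_cuspidal_fourier_expansion f a" "h > 0"
  shows "(\<lambda>m. norm (a m) * exp (- 2 * pi * real m * h)) summable_on {1..}"
proof -
  let ?z = "Complex 0 h"
  have "?z \<in> upper_half_plane" using assms by (simp add: upper_half_plane_def)
  then have "(\<lambda>m. a m * exp (2 * of_real pi * \<i> * of_nat m * ?z)) summable_on {1..}"
    using assms(1) unfolding has_cuspidal_fourier_expansion_def by (blast intro: has_sum_imp_summable)
  then have "(\<lambda>m. norm (a m * exp (2 * of_real pi * \<i> * of_nat m * ?z))) summable_on {1..}"
    by (simp add: summable_on_iff_abs_summable_on_complex)
  then show ?thesis unfolding norm_fourier_term by simp
qed

text \<open>As the expansion starts at \<open>m = 1\<close>, every term gains at least the factor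
  \<open>exp (2 * pi * (h - Im z))\<close> over its size at height \<open>h\<close>, and this factor
  comes out of the absolutely convergent series.\<close>

lemma cuspidal_exponential_decay:
  assumes f: "has_cuspidal_fourier_expansion f a" and h: "h > 0"
  obtains A where "0 \<le> A" "\<And>z. h \<le> Im z \<Longrightarrow> norm (f z) \<le> A * exp (- 2 * pi * Im z)"
proof -
  define S where "S = (\<Sum>\<^sub>\<infinity>m\<in>{1..}. norm (a m) * exp (- 2 * pi * real m * h))"
  have S: "0 \<le> S" unfolding S_def by (intro infsum_nonneg) simp
  show ?thesis
  proof (rule that[of "S * exp (2 * pi * h)"])
    fix z assume z: "h \<le> Im z"
    then have "z \<in> upper_half_plane" using h by (simp add: upper_half_plane_def)
    then have fs: "((\<lambda>m. a m * exp (2 * of_real pi * \<i> * of_nat m * z)) has_sum f z) {1..}"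
      using f unfolding has_cuspidal_fourier_expansion_def by blast
    have sm: "(\<lambda>m. norm (a m) * exp (- 2 * pi * real m * h) * exp (2 * pi * (h - Im z))) summable_on {1..}"
      by (intro summable_on_cmult_left cuspidal_fourier_summable[OF f h])
    have le: "norm (a m * exp (2 * of_real pi * \<i> * of_nat m * z))
       \<le> norm (a m) * exp (- 2 * pi * real m * h) * exp (2 * pi * (h - Im z))" if "m \<in> {1..}" for m
    proof -
      have "(real m - 1) * (h - Im z) \<le> 0" using that z by (intro mult_nonneg_nonpos) auto
      then have "pi * ((real m - 1) * (h - Im z)) \<le> 0" by (simp add: mult_nonneg_nonpos)
      then have "- 2 * pi * real m * Im z \<le> - 2 * pi * real m * h + 2 * pi * (h - Im z)"
        by (simp add: algebra_simps)
      then have "exp (- 2 * pi * real m * Im z) \<le> exp (- 2 * pi * real m * h) * exp (2 * pi * (h - Im z))"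
        by (simp flip: exp_add)
      then show ?thesis unfolding norm_fourier_term by (simp add: mult_left_mono mult.assoc)
    qed
    have "norm (f z) \<le> (\<Sum>\<^sub>\<infinity>m\<in>{1..}. norm (a m) * exp (- 2 * pi * real m * h) * exp (2 * pi * (h - Im z)))"
      using norm_infsum_le[OF fs has_sum_infsum[OF sm] le] .
    also have "\<dots> = S * exp (2 * pi * (h - Im z))"
      unfolding S_def by (intro infsum_cmult_left cuspidal_fourier_summable[OF f h])
    also have "\<dots> = S * exp (2 * pi * h) * exp (- 2 * pi * Im z)"
      by (simp add: exp_add[symmetric] algebra_simps)
    finally show "norm (f z) \<le> S * exp (2 * pi * h) * exp (- 2 * pi * Im z)" .
  qed (use S in simp)
qed

text \<open>Since \<open>p\<close> may have either sign, both ends of the range matter: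
  \<open>ln (t / s) \<le> t / s\<close> with \<open>s = \<bar>p\<bar> + 1\<close> controls large
  \<open>t\<close>, and the cutoff controls \<open>- ln t\<close>. The value \<open>1 / 5\<close> is
  the height reached in \<open>cusp_form_bound\<close>.\<close>

lemma powr_exp_bounded:
  fixes p :: real
  obtains B where "0 \<le> B" "\<And>t. 1 / 5 \<le> t \<Longrightarrow> t powr p * exp (- 2 * pi * t) \<le> B"
proof (rule that[of "exp (\<bar>p\<bar> * (ln (\<bar>p\<bar> + 1) + ln 5))"])
  fix t :: real assume t: "1 / 5 \<le> t"
  define s where "s = \<bar>p\<bar> + 1"
  have "0 < s" by (simp add: s_def add_nonneg_pos)
  then have "ln t = ln (t / s) + ln s" using t by (subst ln_div) auto
  moreover have "ln (t / s) \<le> t / s" using t \<open>0 < s\<close> by (intro order.trans[OF ln_le_minus_one]) auto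
  ultimately have "ln t \<le> t / s + ln s" by simp
  moreover have "- ln t \<le> ln 5"
  proof -
    have "ln (1 / t) \<le> ln 5" using t by (intro ln_mono) (auto simp: field_simps)
    then show ?thesis using t by (simp add: ln_div)
  qed
  moreover have "0 \<le> ln s" "(0::real) \<le> ln 5" "0 \<le> t / s" using t by (auto simp: s_def)
  ultimately have "\<bar>ln t\<bar> \<le> t / s + (ln s + ln 5)" by linarith
  then have "\<bar>p\<bar> * \<bar>ln t\<bar> \<le> \<bar>p\<bar> * (t / s + (ln s + ln 5))" by (intro mult_left_mono) auto
  moreover have "\<bar>p\<bar> * (t / s) \<le> t" using t by (simp add: s_def field_simps)
  moreover have "p * ln t \<le> \<bar>p\<bar> * \<bar>ln t\<bar>" by (metis abs_ge_self abs_mult)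
  moreover have "t \<le> 2 * pi * t" using t pi_gt3 by simp
  ultimately have "p * ln t + - 2 * pi * t \<le> \<bar>p\<bar> * (ln s + ln 5)" by (simp add: distrib_left)
  then show "t powr p * exp (- 2 * pi * t) \<le> exp (\<bar>p\<bar> * (ln (\<bar>p\<bar> + 1) + ln 5))"
    using t by (simp add: powr_def s_def flip: exp_add)
qed simp

text \<open>
  A point with small imaginary part is moved to height at least \<open>1/5\<close> by the matrix whose
  lower row is a Dirichlet approximation of its real part.
\<close>
lemma cusp_form_bound:
  assumes modular: "weakly_modular k f" and f: "has_cuspidal_fourier_expansion f a"
  obtains C where "0 \<le> C"
    "\<And>x y. 0 < y \<Longrightarrow> y \<le> 1 \<Longrightarrow> norm (f (Complex x y)) \<le> C * y powr (- (of_int k / 2))"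
proof -
  obtain A where A: "0 \<le> A" "\<And>z. 1 / 5 \<le> Im z \<Longrightarrow> norm (f z) \<le> A * exp (- 2 * pi * Im z)"
    using cuspidal_exponential_decay[OF f, of "1 / 5"] by auto
  obtain B where B: "0 \<le> B" "\<And>t. 1 / 5 \<le> t \<Longrightarrow> t powr (of_int k / 2) * exp (- 2 * pi * t) \<le> B"
    using powr_exp_bounded by blast
  show ?thesis
  proof (rule that[of "A * B"])
    fix x y :: real assume y: "0 < y" "y \<le> 1"
    define z where "z = Complex x y"
    have zH: "z \<in> upper_half_plane" using y by (simp add: z_def upper_half_plane_def)
    \<comment> \<open>This size balances the two parts of \<open>norm q\<close>: the real part is at
      most \<open>1 / N \<le> 2 * sqrt y\<close> and the imaginary part at most
      \<open>N * y \<le> sqrt y\<close>. So the square of the norm is at most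
      \<open>4 * y + y\<close>, which is the origin of the height \<open>1 / 5\<close>.\<close>
    define N where "N = nat \<lfloor>1 / sqrt y\<rfloor>"
    have "1 \<le> 1 / sqrt y" using y by simp
    then have N: "1 \<le> N" "real N \<le> 1 / sqrt y" "1 / sqrt y < real N + 1"
      unfolding N_def by linarith+
    obtain d c where dc: "coprime d c" "0 < c" "c \<le> int N" "\<bar>of_int c * x - of_int d\<bar> < 1 / real N"
      using Dirichlet_approx_coprime[of N x] N(1) by auto
    from dc(1) obtain u v where uv: "u * d + v * c = 1" by (metis bezout_int coprime_imp_gcd_eq_1)
    have det: "(- u) * (- d) - (- v) * c = 1" using uv by simp
    define q where "q = of_int c * z + of_int (- d)"
    define w where "w = (of_int (- u) * z + of_int (- v)) / q"
    have Imq: "Im q = of_int c * y" and Req: "Re q = of_int c * x - of_int d" by (auto simp: q_def z_def)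
    have "Im q \<noteq> 0" using dc(2) y by (simp add: Imq)
    then have q0: "q \<noteq> 0" by auto
    have fw: "f w = q powi k * f z"
      using modular det zH unfolding weakly_modular_def w_def q_def by blast
    have "Im w = (Im (of_int (- u) * z + of_int (- v)) * Re q - Re (of_int (- u) * z + of_int (- v)) * Im q) / (norm q)\<^sup>2"
      unfolding w_def by (rule Im_divide')
    also have "Im (of_int (- u) * z + of_int (- v)) * Re q - Re (of_int (- u) * z + of_int (- v)) * Im q
        = of_int (u * d + v * c) * y"
      by (simp add: Imq Req z_def algebra_simps)
    finally have Imw: "Im w = y / (norm q)\<^sup>2" using uv by simp
    have cN: "real_of_int c \<le> real N" using dc(3) by linarith
    have "(norm q)\<^sup>2 = (of_int c * x - of_int d)\<^sup>2 + (of_int c * y)\<^sup>2"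
      by (simp add: cmod_power2 Imq Req)
    also have "(of_int c * x - of_int d)\<^sup>2 \<le> (1 / real N)\<^sup>2"
      using dc(4) by (subst abs_le_square_iff[symmetric]) simp
    also have "(1 / real N)\<^sup>2 \<le> (2 * sqrt y)\<^sup>2"
    proof (rule power_mono)
      have "1 / sqrt y \<le> 2 * real N" using N by linarith
      then show "1 / real N \<le> 2 * sqrt y" using N(1) y by (simp add: field_simps)
    qed simp
    also have "(of_int c * y)\<^sup>2 \<le> (sqrt y)\<^sup>2"
    proof (rule power_mono)
      have "real_of_int c \<le> 1 / sqrt y" using cN N(2) by linarith
      then have "of_int c * y \<le> (1 / sqrt y) * y" using y by (intro mult_right_mono) auto
      also have "\<dots> = sqrt y" using y by (simp add: real_div_sqrt)
      finally show "of_int c * y \<le> sqrt y" .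
    qed (use dc(2) y in simp)
    finally have nq: "(norm q)\<^sup>2 \<le> 5 * y" using y by (simp add: power_mult_distrib)
    define t where "t = Im w"
    have t_eq: "t = y / (norm q)\<^sup>2" by (simp add: t_def Imw)
    have t: "1 / 5 \<le> t" using nq q0 by (simp add: t_eq field_simps)
    \<comment> \<open>Expressing the automorphy factor through the two heights splits
      \<open>f z\<close> into a power of \<open>y\<close> and a function of \<open>t\<close> that is
      bounded for \<open>t \<ge> 1 / 5\<close>.\<close>
    have q_eq: "norm q = (y / t) powr (1 / 2)"
      using y q0 by (simp add: t_eq powr_half_sqrt)
    have "norm (f w) = norm q powr of_int k * norm (f z)"
      using q0 by (simp add: fw norm_mult norm_power_int powr_real_of_int')
    then have "norm (f z) = norm q powr (- of_int k) * norm (f w)"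
      using q0 by (simp add: powr_minus)
    also have "norm q powr (- of_int k) = (y / t) powr (- (of_int k / 2))"
      unfolding q_eq powr_powr by simp
    also have "\<dots> = y powr (- (of_int k / 2)) * t powr (of_int k / 2)"
      using y t by (simp add: powr_divide powr_minus field_simps)
    also have "\<dots> * norm (f w) \<le> y powr (- (of_int k / 2)) * t powr (of_int k / 2) * (A * exp (- 2 * pi * t))"
      using A(2)[of w] t by (intro mult_left_mono) (auto simp: t_def)
    also have "\<dots> = A * y powr (- (of_int k / 2)) * (t powr (of_int k / 2) * exp (- 2 * pi * t))"
      by simp
    also have "\<dots> \<le> A * y powr (- (of_int k / 2)) * B"
      using A(1) B(2)[OF t] by (intro mult_left_mono) auto
    finally show "norm (f (Complex x y)) \<le> A * B * y powr (- (of_int k / 2))"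
      by (simp add: z_def mult_ac)
  qed (use A B in simp)
qed

subsection \<open>Additive twists of Fourier coefficients\<close>

lemma echar_has_integral:
  "((\<lambda>t. echar (of_int j * t)) has_integral (if j = 0 then 1 else 0)) {0..1}"
proof (cases "j = 0")
  case True
  then show ?thesis using has_integral_const_real[of "1::complex" 0 1] by simp
next
  case False
  define c where "c = 2 * of_real pi * \<i> * of_int j"
  have c0: "c \<noteq> 0" using False by (simp add: c_def)
  have e: "echar (of_int j * t) = exp (c * of_real t)" for t
    by (simp add: echar_def cis_conv_exp c_def algebra_simps)
  have "((\<lambda>t. exp (c * of_real t) / c) has_vector_derivative exp (c * of_real t)) (at t within {0..1})" for t
    using c0 by (intro has_vector_derivative_real_field[where f = "\<lambda>z. exp (c * z) / c"])
      (auto intro!: derivative_eq_intros)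
  then have "((\<lambda>t. exp (c * of_real t)) has_integral
      (exp (c * of_real 1) / c - exp (c * of_real 0) / c)) {0..1}"
    by (intro fundamental_theorem_of_calculus) auto
  moreover have "exp (c * of_real 1) = 1"
    using e[of 1, symmetric] by simp
  ultimately show ?thesis using False by (simp add: e)
qed

text \<open>A geometric sum whose ratio has modulus \<open>exp (2 * pi / real M)\<close>; up to
  exponent \<open>M + 1\<close> its powers stay below \<open>exp (4 * pi)\<close>, because
  \<open>(M + 1) / M \<le> 2\<close>. So the sum is bounded both by a multiple of \<open>M\<close>
  and by the inverse distance of \<open>t\<close> to the nearest integer, and adding the bounds at
  both ends avoids a minimum.\<close>

lemma norm_echar_kernel_le:
  assumes M: "1 \<le> M" and t: "0 \<le> t" "t \<le> 1"
  shows "norm (\<Sum>l=1..M. of_real (exp (2 * pi * real l / real M)) * echar (- real l * t))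
    \<le> 2 * exp (4 * pi) * (1 / (t + 1 / real M) + 1 / (1 - t + 1 / real M))"
proof -
  define r where "r = exp (2 * pi / real M)"
  define \<rho> where "\<rho> = of_real r * echar (- t)"
  define K where "K = (\<Sum>l=1..M. \<rho> ^ l)"
  have term_eq: "of_real (exp (2 * pi * real l / real M)) * echar (- real l * t) = \<rho> ^ l" for l
  proof -
    have "exp (2 * pi * real l / real M) = r ^ l"
      unfolding r_def by (simp flip: exp_of_nat_mult)
    moreover have "echar (- real l * t) = echar (- t) ^ l"
      using echar_of_nat_mult[of l "- t"] by simp
    ultimately show ?thesis by (simp add: \<rho>_def power_mult_distrib)
  qed
  have K_eq: "(\<Sum>l=1..M. of_real (exp (2 * pi * real l / real M)) * echar (- real l * t)) = K"
    unfolding K_def by (rule sum.cong[OF refl]) (rule term_eq)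
  have r1: "1 \<le> r" unfolding r_def by simp
  have norm_\<rho>: "norm \<rho> = r" using r1 by (simp add: \<rho>_def norm_mult)
  have rpow: "r ^ l = exp (2 * pi * (real l / real M))" for l
    unfolding r_def by (simp flip: exp_of_nat_mult)
  have rle: "r ^ l \<le> exp (4 * pi)" if "l \<le> Suc M" for l
  proof -
    have "real l / real M \<le> 2" using that M by (simp add: field_simps)
    then have "2 * pi * (real l / real M) \<le> 2 * pi * 2" by (intro mult_left_mono) auto
    then show ?thesis by (simp add: rpow)
  qed
  have "(\<rho> - 1) * (\<Sum>l=1..N. \<rho> ^ l) = \<rho> ^ Suc N - \<rho>" for N
    by (induction N) (auto simp: algebra_simps)
  then have "norm (\<rho> - 1) * norm K = norm (\<rho> ^ Suc M - \<rho>)" unfolding K_def by (simp flip: norm_mult)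
  also have "\<dots> \<le> norm \<rho> ^ Suc M + norm \<rho>" unfolding norm_power[symmetric] by (rule norm_triangle_ineq4)
  also have "\<dots> \<le> 2 * exp (4 * pi)" using rle[of "Suc M"] rle[of 1] M by (simp add: norm_\<rho>)
  finally have 1: "norm (\<rho> - 1) * norm K \<le> 2 * exp (4 * pi)" .
  have "norm K \<le> (\<Sum>l=1..M. norm (\<rho> ^ l))" unfolding K_def by (rule norm_sum)
  also have "\<dots> \<le> (\<Sum>l=1..M. exp (4 * pi))" by (intro sum_mono) (auto simp: norm_power norm_\<rho> intro: rle)
  finally have 2: "norm K \<le> real M * exp (4 * pi)" by simp
  define s where "s = min t (1 - t)"
  have s: "0 \<le> s" "s \<le> 1 / 2" using t by (auto simp: s_def min_def)
  have "3 * s \<le> norm (echar (- t) - 1)"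
  proof (cases "t \<le> 1 / 2")
    case True
    then show ?thesis using norm_echar_minus_1_ge[of "- t"] t by (simp add: s_def)
  next
    case False
    then show ?thesis using norm_echar_minus_1_ge[of "1 - t"] t echar_add_of_int[of "- t" 1]
      by (simp add: s_def min_def)
  qed
  \<comment> \<open>Stretching a unit vector outwards cannot bring it nearer to 1: the squared
    distances differ by \<open>(r - 1) * (r + 1 - 2 * Re u)\<close>.\<close>
  also have "\<dots> \<le> norm (\<rho> - 1)"
  proof (rule power2_le_imp_le)
    define u where "u = echar (- t)"
    have u1: "(Re u)\<^sup>2 + (Im u)\<^sup>2 = 1"
      using norm_echar[of "- t"] by (simp add: u_def norm_complex_def)
    have "(Re u)\<^sup>2 \<le> 1\<^sup>2" using u1 zero_le_power2[of "Im u"] unfolding one_power2 by linarith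
    then have "Re u \<le> 1" by (rule power2_le_imp_le) simp
    then have "0 \<le> (r - 1) * (r + 1 - 2 * Re u)" using r1 by (intro mult_nonneg_nonneg) auto
    also have "\<dots> = (r\<^sup>2 * ((Re u)\<^sup>2 + (Im u)\<^sup>2) - 2 * r * Re u + 1) - ((Re u)\<^sup>2 + (Im u)\<^sup>2 - 2 * Re u + 1)"
      unfolding u1 by (simp add: power2_eq_square algebra_simps)
    also have "\<dots> = (norm (\<rho> - 1))\<^sup>2 - (norm (echar (- t) - 1))\<^sup>2"
      unfolding cmod_power2 \<rho>_def u_def[symmetric] by (simp add: power2_eq_square algebra_simps)
    finally show "(norm (echar (- t) - 1))\<^sup>2 \<le> (norm (\<rho> - 1))\<^sup>2" by simp
  qed simp
  finally have s3: "3 * s \<le> norm (\<rho> - 1)" .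
  have "3 * (s * norm K) \<le> 2 * exp (4 * pi)"
    using 1 mult_right_mono[OF s3, of "norm K"] by simp
  moreover have "1 / real M * norm K \<le> exp (4 * pi)" using 2 M by (simp add: field_simps)
  ultimately have "(s + 1 / real M) * norm K \<le> 2 * exp (4 * pi)"
    unfolding distrib_right using exp_gt_zero[of "4 * pi"] by linarith
  moreover have pos: "0 < s + 1 / real M" using s M by (intro add_nonneg_pos) auto
  ultimately have "norm K \<le> 2 * exp (4 * pi) * (1 / (s + 1 / real M))"
    by (simp add: pos_le_divide_eq[OF pos] mult.commute)
  also have "1 / (s + 1 / real M) \<le> 1 / (t + 1 / real M) + 1 / (1 - t + 1 / real M)"
    using t M by (auto simp: s_def min_def)
  finally show ?thesis unfolding K_eq by (simp add: mult_left_mono)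
qed

text \<open>The weights of the kernel undo the decay \<open>exp (- 2 * pi * m * y)\<close> at height
  \<open>y\<close>, so orthogonality isolates the coefficients up to \<open>M\<close>; translating
  the segment by \<open>b\<close> produces the additive twist.\<close>

lemma fourier_sum_integral:
  assumes f: "has_cuspidal_fourier_expansion f a" and y: "0 < y"
  shows "((\<lambda>t. f (Complex (t + b) y) * (\<Sum>l=1..M. of_real (exp (2 * pi * real l * y)) * echar (- real l * t)))
    has_integral (\<Sum>m=1..M. a m * echar (real m * b))) {0..1}"
proof -
  define K where "K t = (\<Sum>l=1..M. of_real (exp (2 * pi * real l * y)) * echar (- real l * t))" for t
  define F where "F m t = a m * exp (2 * of_real pi * \<i> * of_nat m * Complex (t + b) y) * K t" for m t
  define B where "B = (\<Sum>l=1..M. exp (2 * pi * real l * y))"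
  have K_le: "norm (K t) \<le> B" for t
    unfolding K_def B_def by (rule sum_norm_le) (simp add: norm_mult)
  have ex: "exp (2 * of_real pi * \<i> * of_nat m * Complex (t + b) y)
      = of_real (exp (- 2 * pi * real m * y)) * echar (real m * (t + b))" for m t
    unfolding exp_of_real[symmetric] echar_def cis_conv_exp exp_add[symmetric]
    by (rule arg_cong[where f = exp]) (simp add: complex_eq_iff algebra_simps)
  have Kint: "((\<lambda>t. F m t) has_integral (if m \<in> {1..M} then a m * echar (real m * b) else 0)) {0..1}"
    if "m \<in> {1..}" for m
  proof -
    have "((\<lambda>t. (\<Sum>l=1..M. a m * of_real (exp (- 2 * pi * real m * y)) * echar (real m * b) * of_real (exp (2 * pi * real l * y))
        * echar (of_int (int m - int l) * t))) has_integral
        (\<Sum>l=1..M. a m * of_real (exp (- 2 * pi * real m * y)) * echar (real m * b) * of_real (exp (2 * pi * real l * y))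
         * (if int m - int l = 0 then 1 else 0))) {0..1}"
      by (intro has_integral_sum has_integral_mult_right echar_has_integral) auto
    moreover have "F m t = (\<Sum>l=1..M. a m * of_real (exp (- 2 * pi * real m * y)) * echar (real m * b) * of_real (exp (2 * pi * real l * y))
        * echar (of_int (int m - int l) * t))" for t
      unfolding F_def ex K_def sum_distrib_left
      by (rule sum.cong) (simp_all add: algebra_simps flip: echar_add)
    moreover have "(\<Sum>l=1..M. a m * of_real (exp (- 2 * pi * real m * y)) * echar (real m * b) * of_real (exp (2 * pi * real l * y))
         * (if int m - int l = 0 then 1 else 0)) = (\<Sum>l=1..M. if m = l then a m * echar (real m * b) else 0)"
      by (rule sum.cong) (auto simp: exp_minus)
    ultimately show ?thesis by simp
  qed
  have cont: "continuous_on {0..1} (F m)" for m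
    unfolding F_def ex K_def echar_def by (intro continuous_intros)
  have unif: "uniform_limit {0..1} (\<lambda>X t. \<Sum>m\<in>X. F m t) (\<lambda>t. \<Sum>\<^sub>\<infinity>m\<in>{1..}. F m t) (finite_subsets_at_top {1..})"
  proof (rule Weierstrass_m_test_general)
    show "(\<lambda>m. norm (a m) * exp (- 2 * pi * real m * y) * B) summable_on {1..}"
      by (intro summable_on_cmult_left cuspidal_fourier_summable[OF f y])
    show "norm (F m t) \<le> norm (a m) * exp (- 2 * pi * real m * y) * B" for m t
      unfolding F_def norm_mult[of _ "K t"] norm_fourier_term using K_le[of t]
      by (intro mult_mono) auto
  qed
  have "continuous_on {0..1} (\<lambda>t. \<Sum>m\<in>X. F m t)" for X
    by (intro continuous_intros cont)
  then obtain I J where I: "\<And>X. ((\<lambda>t. \<Sum>m\<in>X. F m t) has_integral I X) {0..1}"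
    and J: "((\<lambda>t. \<Sum>\<^sub>\<infinity>m\<in>{1..}. F m t) has_integral J) {0..1}"
    and lim: "(I \<longlongrightarrow> J) (finite_subsets_at_top {1..})"
    using uniform_limit_integral[OF unif] by auto
  \<comment> \<open>The integrals are eventually constant: once a finite index set contains
    \<open>{1..M}\<close>, orthogonality kills all further terms.\<close>
  have "eventually (\<lambda>X. I X = (\<Sum>m=1..M. a m * echar (real m * b))) (finite_subsets_at_top {1..})"
  proof (rule eventually_finite_subsets_at_top_weakI[THEN eventually_mp, rotated])
    show "eventually (\<lambda>X. {1..M} \<subseteq> X) (finite_subsets_at_top {1..})"
      unfolding eventually_finite_subsets_at_top by (intro exI[of _ "{1..M}"]) auto
    fix X :: "nat set" assume X: "finite X" "X \<subseteq> {1..}"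
    show "{1..M} \<subseteq> X \<longrightarrow> I X = (\<Sum>m=1..M. a m * echar (real m * b))"
    proof
      assume sub: "{1..M} \<subseteq> X"
      have "((\<lambda>t. \<Sum>m\<in>X. F m t) has_integral (\<Sum>m\<in>X. if m \<in> {1..M} then a m * echar (real m * b) else 0)) {0..1}"
        using X by (intro has_integral_sum Kint) auto
      with I have "I X = (\<Sum>m\<in>X. if m \<in> {1..M} then a m * echar (real m * b) else 0)"
        by (rule has_integral_unique)
      also have "\<dots> = (\<Sum>m\<in>X \<inter> {1..M}. a m * echar (real m * b))"
        using X by (subst sum.inter_restrict) auto
      finally show "I X = (\<Sum>m=1..M. a m * echar (real m * b))" using sub by (simp add: Int_absorb1)
    qed
  qed
  then have "(I \<longlongrightarrow> (\<Sum>m=1..M. a m * echar (real m * b))) (finite_subsets_at_top {1..})"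
    by (rule tendsto_eventually)
  from tendsto_unique[OF _ lim this] have J_eq: "J = (\<Sum>m=1..M. a m * echar (real m * b))" by simp
  have "(\<Sum>\<^sub>\<infinity>m\<in>{1..}. F m t) = f (Complex (t + b) y) * K t" for t
  proof -
    have "Complex (t + b) y \<in> upper_half_plane" using y by (simp add: upper_half_plane_def)
    then have "((\<lambda>m. a m * exp (2 * of_real pi * \<i> * of_nat m * Complex (t + b) y)) has_sum f (Complex (t + b) y)) {1..}"
      using f unfolding has_cuspidal_fourier_expansion_def by blast
    from has_sum_cmult_left[OF this, of "K t"] show ?thesis unfolding F_def by (rule infsumI)
  qed
  with J show ?thesis unfolding J_eq K_def by simp
qed

lemma log_kernel_has_integral:
  fixes h :: real
  assumes "0 < h"
  shows "((\<lambda>t. 1 / (t + h) + 1 / (1 - t + h)) has_integral 2 * (ln (1 + h) - ln h)) {0..1}"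
proof -
  have "((\<lambda>t. ln (t + h) - ln (1 - t + h)) has_vector_derivative 1 / (t + h) + 1 / (1 - t + h)) (at t within {0..1})"
    if "t \<in> {0..1}" for t
    using that assms unfolding has_real_derivative_iff_has_vector_derivative[symmetric]
    by (auto intro!: derivative_eq_intros simp: field_simps)
  from fundamental_theorem_of_calculus[OF _ this]
  have "((\<lambda>t. 1 / (t + h) + 1 / (1 - t + h)) has_integral
    (ln (1 + h) - ln (1 - 1 + h)) - (ln (0 + h) - ln (1 - 0 + h))) {0..1}" by simp
  then show ?thesis by (simp add: algebra_simps)
qed

text \<open>At height \<open>1 / M\<close> the form has size \<open>M powr (k / 2)\<close> and the
  kernel has an L^1 norm of order \<open>ln (M + 1)\<close>. Neither depends on \<open>b\<close>,
  which only translates the segment of integration.\<close>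

lemma cusp_form_additive_twist:
  assumes modular: "weakly_modular k f" and f: "has_cuspidal_fourier_expansion f a"
  obtains C where "0 \<le> C"
    "\<And>M b. 1 \<le> M \<Longrightarrow> norm (\<Sum>m=1..M. a m * echar (real m * b)) \<le> C * real M powr (of_int k / 2) * ln (real M + 1)"
proof -
  obtain C where C: "0 \<le> C"
    "\<And>x y. 0 < y \<Longrightarrow> y \<le> 1 \<Longrightarrow> norm (f (Complex x y)) \<le> C * y powr (- (of_int k / 2))"
    using cusp_form_bound[OF modular f] by blast
  show ?thesis
  proof (rule that[of "C * (4 * exp (4 * pi))"])
    fix M :: nat and b :: real assume M: "1 \<le> M"
    define y where "y = 1 / real M"
    have y: "0 < y" "y \<le> 1" using M by (auto simp: y_def)
    define K where "K t = (\<Sum>l=1..M. of_real (exp (2 * pi * real l * y)) * echar (- real l * t))" for t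
    have int: "((\<lambda>t. f (Complex (t + b) y) * K t) has_integral (\<Sum>m=1..M. a m * echar (real m * b))) {0..1}"
      using fourier_sum_integral[OF f y(1)] unfolding K_def .
    define c where "c = C * y powr (- (of_int k / 2)) * (2 * exp (4 * pi))"
    have bound: "((\<lambda>t. c * (1 / (t + y) + 1 / (1 - t + y))) has_integral c * (2 * (ln (1 + y) - ln y))) {0..1}"
      by (intro has_integral_mult_right log_kernel_has_integral y)
    have le: "norm (f (Complex (t + b) y) * K t) \<le> c * (1 / (t + y) + 1 / (1 - t + y))" if "t \<in> {0..1}" for t
    proof -
      have "norm (K t) \<le> 2 * exp (4 * pi) * (1 / (t + y) + 1 / (1 - t + y))"
        using norm_echar_kernel_le[OF M, of t] that unfolding K_def y_def by simp
      then have "norm (f (Complex (t + b) y)) * norm (K t)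
          \<le> (C * y powr (- (of_int k / 2))) * (2 * exp (4 * pi) * (1 / (t + y) + 1 / (1 - t + y)))"
        using C y by (intro mult_mono) auto
      then show ?thesis by (simp add: norm_mult c_def mult_ac)
    qed
    have "norm (integral {0..1} (\<lambda>t. f (Complex (t + b) y) * K t))
        \<le> integral {0..1} (\<lambda>t. c * (1 / (t + y) + 1 / (1 - t + y)))"
      using int bound le by (intro Henstock_Kurzweil_Integration.integral_norm_bound_integral)
        (auto simp: has_integral_integrable)
    then have "norm (\<Sum>m=1..M. a m * echar (real m * b)) \<le> c * (2 * (ln (1 + y) - ln y))"
      unfolding integral_unique[OF int] integral_unique[OF bound] .
    moreover have "ln (1 + y) - ln y = ln (real M + 1)"
    proof -
      have "ln (1 + y) - ln y = ln ((1 + y) / y)" using y by (simp add: ln_div)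
      moreover have "(1 + y) / y = real M + 1" using M by (simp add: y_def field_simps)
      ultimately show ?thesis by simp
    qed
    moreover have "y powr (- (of_int k / 2)) = real M powr (of_int k / 2)"
      using M by (simp add: y_def powr_def ln_div)
    ultimately show "norm (\<Sum>m=1..M. a m * echar (real m * b))
      \<le> C * (4 * exp (4 * pi)) * real M powr (of_int k / 2) * ln (real M + 1)"
      by (simp add: c_def mult_ac)
  qed (use C in simp)
qed

section \<open>Partial summation and Wilton's bound\<close>

lemma summation_by_parts:
  fixes a w :: "nat \<Rightarrow> 'a::comm_ring"
  shows "(\<Sum>m=1..M. a m * w m) =
    (\<Sum>m=1..M. (\<Sum>l=1..m. a l) * (w m - w (Suc m))) + (\<Sum>l=1..M. a l) * w (Suc M)"
  by (induction M) (auto simp: algebra_simps)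

lemma powr_Suc_le:
  assumes "1 \<le> x" "x \<le> y" "y \<le> x + 1"
  shows "(y::real) powr p \<le> 2 powr \<bar>p\<bar> * x powr p"
proof (cases "0 \<le> p")
  case True
  have "y powr p \<le> (2 * x) powr p" using assms True by (intro powr_mono2) auto
  then show ?thesis using True assms by (simp add: powr_mult)
next
  case False
  have "y powr p \<le> x powr p" using assms False by (intro powr_mono2') auto
  also have "\<dots> \<le> 2 powr \<bar>p\<bar> * x powr p"
    using ge_one_powr_ge_zero[of 2 "\<bar>p\<bar>"] by (simp add: mult_le_cancel_right1)
  finally show ?thesis .
qed

lemma powr_difference_le:
  assumes "1 \<le> (x::real)"
  shows "\<bar>x powr p - (x + 1) powr p\<bar> \<le> \<bar>p\<bar> * 2 powr \<bar>p - 1\<bar> * x powr (p - 1)"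
proof -
  have "\<exists>z>x. z < x + 1 \<and> (x + 1) powr p - x powr p = (x + 1 - x) * (p * z powr (p - 1))"
    using assms by (intro MVT2) (auto intro!: derivative_eq_intros)
  then obtain z where z: "x < z" "z < x + 1" "(x + 1) powr p - x powr p = p * z powr (p - 1)" by auto
  have "\<bar>x powr p - (x + 1) powr p\<bar> = \<bar>p\<bar> * z powr (p - 1)"
    unfolding abs_minus_commute[of "x powr p"] z(3) by (simp add: abs_mult)
  also have "\<dots> \<le> \<bar>p\<bar> * (2 powr \<bar>p - 1\<bar> * x powr (p - 1))"
    using z assms by (intro mult_left_mono powr_Suc_le) auto
  finally show ?thesis by simp
qed

lemma sum_inverse_sqrt_le: "(\<Sum>m=1..M. 1 / sqrt (real m)) \<le> 2 * sqrt (real M)"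
proof (induction M)
  case (Suc M)
  have "1 / sqrt (real (Suc M)) \<le> 2 * (sqrt (real (Suc M)) - sqrt (real M))"
  proof -
    define u v where "u = sqrt (real (Suc M))" and "v = sqrt (real M)"
    have "u\<^sup>2 - v\<^sup>2 = 1" "v \<le> u" "0 < u" "0 \<le> v" by (auto simp: u_def v_def)
    then have "(u - v) * (u + v) = 1" by (simp add: power2_eq_square algebra_simps)
    then have "1 \<le> (u - v) * (2 * u)" using \<open>v \<le> u\<close> mult_left_mono[of "u + v" "2 * u" "u - v"] by simp
    then show ?thesis using \<open>0 < u\<close> unfolding u_def[symmetric] v_def[symmetric]
      by (simp only: pos_divide_le_eq mult_ac)
  qed
  then show ?case using Suc by simp
qed simp

text \<open>The normalising factor is removed by partial summation against \<open>m powr p\<close>.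
  The twisted sums have size \<open>m powr (k / 2)\<close> up to a logarithm and the weights vary by
  \<open>m powr (p - 1)\<close>; for every weight \<open>k\<close> these exponents add up to
  \<open>- 1 / 2\<close>, whence the square root.\<close>

theorem wilton_bound:
  assumes modular: "weakly_modular k f"
    and f: "has_cuspidal_fourier_expansion f (\<lambda>m. lam m * of_real (real m powr ((of_int k - 1) / 2)))"
  obtains C where "0 \<le> C"
    "\<And>M b. norm (\<Sum>m=1..M. lam m * echar (real m * b)) \<le> C * sqrt (real M) * ln (real M + 1)"
proof -
  define p :: real where "p = (1 - of_int k) / 2"
  have p: "- p = (of_int k - 1) / 2" and p_k: "of_int k / 2 + (p - 1) = - (1 / 2)"
    and p_k': "of_int k / 2 + p = 1 / 2" by (simp_all add: p_def field_simps)
  define a where "a m = lam m * of_real (real m powr (- p))" for m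
  have a_eq: "(\<lambda>m. lam m * of_real (real m powr ((of_int k - 1) / 2))) = a"
    by (simp add: fun_eq_iff a_def p)
  obtain C where C: "0 \<le> C" "\<And>M b. 1 \<le> M \<Longrightarrow>
      norm (\<Sum>m=1..M. a m * echar (real m * b)) \<le> C * real M powr (of_int k / 2) * ln (real M + 1)"
    using cusp_form_additive_twist[OF modular f[unfolded a_eq]] by blast
  define D where "D = \<bar>p\<bar> * 2 powr \<bar>p - 1\<bar>"
  show ?thesis
  proof (rule that[of "C * D * 2 + C * 2 powr \<bar>p\<bar>"])
    fix M :: nat and b :: real
    define A where "A m = (\<Sum>l=1..m. a l * echar (real l * b))" for m
    define w where "w m = complex_of_real (real m powr p)" for m
    have "lam m * echar (real m * b) = (a m * echar (real m * b)) * w m" if "m \<in> {1..M}" for m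
    proof -
      have "complex_of_real (real m powr (- p)) * w m = of_real (real m powr (- p) * real m powr p)"
        by (simp add: w_def)
      also have "real m powr (- p) * real m powr p = 1"
        using that by (simp flip: powr_add)
      finally have "lam m * echar (real m * b) = lam m * echar (real m * b) * (of_real (real m powr (- p)) * w m)"
        by simp
      then show ?thesis by (simp only: a_def mult_ac)
    qed
    then have "(\<Sum>m=1..M. lam m * echar (real m * b)) = (\<Sum>m=1..M. (a m * echar (real m * b)) * w m)"
      by (rule sum.cong[OF refl])
    also have "\<dots> = (\<Sum>m=1..M. A m * (w m - w (Suc m))) + A M * w (Suc M)"
      unfolding A_def by (rule summation_by_parts)
    finally have eq: "(\<Sum>m=1..M. lam m * echar (real m * b)) = (\<Sum>m=1..M. A m * (w m - w (Suc m))) + A M * w (Suc M)" .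
    have A: "norm (A m) \<le> C * real m powr (of_int k / 2) * ln (real M + 1)" if "1 \<le> m" "m \<le> M" for m
    proof -
      have "norm (A m) \<le> C * real m powr (of_int k / 2) * ln (real m + 1)"
        unfolding A_def by (rule C(2)[OF that(1)])
      also have "\<dots> \<le> C * real m powr (of_int k / 2) * ln (real M + 1)"
        using C(1) that by (intro mult_left_mono) auto
      finally show ?thesis .
    qed
    have w: "norm (w m - w (Suc m)) \<le> D * real m powr (p - 1)" if "1 \<le> m" for m
    proof -
      have "norm (w m - w (Suc m)) = \<bar>real m powr p - (real m + 1) powr p\<bar>"
        unfolding w_def of_real_diff[symmetric] norm_of_real by (simp add: add.commute)
      then show ?thesis using powr_difference_le[of "real m" p] that by (simp add: D_def)
    qed
    have "norm (A m * (w m - w (Suc m))) \<le> C * D * ln (real M + 1) * (1 / sqrt (real m))"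
      if "m \<in> {1..M}" for m
    proof -
      have "norm (A m * (w m - w (Suc m))) \<le> (C * real m powr (of_int k / 2) * ln (real M + 1)) * (D * real m powr (p - 1))"
        unfolding norm_mult using that A[of m] w[of m] C(1) by (intro mult_mono) auto
      also have "\<dots> = C * D * ln (real M + 1) * (real m powr (of_int k / 2) * real m powr (p - 1))"
        by (simp only: mult_ac)
      also have "\<dots> = C * D * ln (real M + 1) * real m powr (- (1 / 2))"
        by (simp only: powr_add[symmetric] p_k)
      also have "\<dots> = C * D * ln (real M + 1) * (1 / sqrt (real m))"
        by (simp only: powr_minus_divide powr_half_sqrt[OF of_nat_0_le_iff])
      finally show ?thesis .
    qed
    then have "norm (\<Sum>m=1..M. A m * (w m - w (Suc m))) \<le> (\<Sum>m=1..M. C * D * ln (real M + 1) * (1 / sqrt (real m)))"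
      by (rule sum_norm_le)
    also have "\<dots> = C * D * ln (real M + 1) * (\<Sum>m=1..M. 1 / sqrt (real m))" by (simp add: sum_distrib_left)
    also have "\<dots> \<le> C * D * ln (real M + 1) * (2 * sqrt (real M))"
      using C(1) by (intro mult_left_mono sum_inverse_sqrt_le) (auto simp: D_def)
    finally have 1: "norm (\<Sum>m=1..M. A m * (w m - w (Suc m))) \<le> C * D * 2 * sqrt (real M) * ln (real M + 1)"
      by (simp only: mult_ac)
    have 2: "norm (A M * w (Suc M)) \<le> C * 2 powr \<bar>p\<bar> * sqrt (real M) * ln (real M + 1)"
    proof (cases "M = 0")
      case False
      have "norm (w (Suc M)) \<le> 2 powr \<bar>p\<bar> * real M powr p"
        unfolding w_def norm_of_real using False powr_Suc_le[of "real M" "real (Suc M)" p] by simp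
      then have "norm (A M * w (Suc M)) \<le> (C * real M powr (of_int k / 2) * ln (real M + 1)) * (2 powr \<bar>p\<bar> * real M powr p)"
        unfolding norm_mult using A[of M] False C(1) by (intro mult_mono) auto
      also have "\<dots> = C * 2 powr \<bar>p\<bar> * ln (real M + 1) * (real M powr (of_int k / 2) * real M powr p)"
        by (simp only: mult_ac)
      also have "\<dots> = C * 2 powr \<bar>p\<bar> * ln (real M + 1) * sqrt (real M)"
        by (simp only: powr_add[symmetric] p_k' powr_half_sqrt[OF of_nat_0_le_iff])
      also have "\<dots> = C * 2 powr \<bar>p\<bar> * sqrt (real M) * ln (real M + 1)"
        by (simp only: mult_ac)
      finally show ?thesis .
    qed (simp add: A_def)
    have "norm (\<Sum>m=1..M. lam m * echar (real m * b))
      \<le> norm (\<Sum>m=1..M. A m * (w m - w (Suc m))) + norm (A M * w (Suc M))"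
      unfolding eq by (rule norm_triangle_ineq)
    then show "norm (\<Sum>m=1..M. lam m * echar (real m * b))
      \<le> (C * D * 2 + C * 2 powr \<bar>p\<bar>) * sqrt (real M) * ln (real M + 1)"
      using 1 2 unfolding distrib_right by linarith
  qed (use C in \<open>simp add: D_def\<close>)
qed

subsection \<open>Counting lattice points in balls\<close>

lemma card_le_mult_card_image:
  assumes "finite A" "\<And>y. y \<in> f ` A \<Longrightarrow> card {x \<in> A. f x = y} \<le> K"
  shows "card A \<le> K * card (f ` A)"
proof -
  have "card A = (\<Sum>y\<in>f ` A. card {x \<in> A. f x = y})"
    using sum.image_gen[OF assms(1), of "\<lambda>_. 1::nat" f] by simp
  also have "\<dots> \<le> (\<Sum>y\<in>f ` A. K)" by (intro sum_mono assms(2))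
  finally show ?thesis by (simp add: mult.commute)
qed

text \<open>Cut \<open>W\<close> into cells of side \<open>r / DIM('a)\<close> along an orthonormal
  basis. Points of \<open>L\<close> in one cell differ by points of \<open>L\<close> of norm at most
  \<open>r\<close>, so no cell holds more points than the small ball. The exponent is the dimension
  of \<open>W\<close> instead of that of the ambient space, and this is the gain exploited in
  Davenport's lemma.\<close>

lemma card_ball_cover:
  fixes L :: "'a::euclidean_space set"
  assumes diff: "\<And>x y. x \<in> L \<Longrightarrow> y \<in> L \<Longrightarrow> x - y \<in> L"
    and W: "subspace W" "L \<inter> cball 0 R \<subseteq> W" and fin: "finite (L \<inter> cball 0 R)" and r: "0 < r" "r \<le> R"
  shows "real (card (L \<inter> cball 0 R)) \<le> (4 * DIM('a) * (R / r)) ^ dim W * real (card (L \<inter> cball 0 r))"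
proof -
  obtain B where B: "B \<subseteq> W" "pairwise orthogonal B" "\<And>x. x \<in> B \<Longrightarrow> norm x = 1"
    "independent B" "card B = dim W" "span B = W"
    using orthonormal_basis_subspace[OF W(1)] by metis
  have finB: "finite B" using B(4) by (rule finiteI_independent)
  \<comment> \<open>The inverse side length of a cell; as \<open>dim W \<le> DIM('a)\<close>, the
    sum of the coordinate differences is at most \<open>r\<close>.\<close>
  define s where "s = DIM('a) / r"
  have "r * 1 \<le> R * DIM('a)" using r DIM_positive[where 'a = 'a] by (intro mult_mono) (auto simp: Suc_leI)
  then have s: "0 < s" "1 \<le> R * s" using r by (auto simp: s_def pos_le_divide_eq)
  define c where "c p = restrict (\<lambda>b. \<lfloor>(p \<bullet> b) * s\<rfloor>) B" for p :: 'a
  let ?A = "L \<inter> cball 0 R"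
  let ?I = "{- \<lceil>R * s\<rceil>..\<lfloor>R * s\<rfloor>}"
  have fin': "finite (L \<inter> cball 0 r)"
    by (rule finite_subset[OF _ fin]) (use r in auto)
  have "card {x \<in> ?A. c x = y} \<le> card (L \<inter> cball 0 r)" if y: "y \<in> c ` ?A" for y
  proof -
    obtain p0 where p0: "p0 \<in> ?A" "y = c p0" using y by blast
    have "norm (x - p0) \<le> r" if x: "x \<in> ?A" "c x = y" for x
    proof -
      have "x - p0 \<in> span B"
        unfolding B(6) using x(1) p0(1) W by (intro subspace_diff) auto
      have "x - p0 = (\<Sum>b\<in>B. ((x - p0) \<bullet> b) *\<^sub>R b)"
        using orthonormal_basis_expand[OF B(2,3) \<open>x - p0 \<in> span B\<close> finB] by simp
      then have "norm (x - p0) \<le> (\<Sum>b\<in>B. norm (((x - p0) \<bullet> b) *\<^sub>R b))"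
        by (metis norm_sum)
      also have "\<dots> \<le> (\<Sum>b\<in>B. 1 / s)"
      proof (rule sum_mono)
        fix b assume b: "b \<in> B"
        have "\<lfloor>(x \<bullet> b) * s\<rfloor> = \<lfloor>(p0 \<bullet> b) * s\<rfloor>"
          using fun_cong[OF x(2)[unfolded p0(2) c_def], of b] b by simp
        then have "\<bar>(x \<bullet> b) * s - (p0 \<bullet> b) * s\<bar> \<le> 1" by linarith
        moreover have "(x \<bullet> b) * s - (p0 \<bullet> b) * s = ((x - p0) \<bullet> b) * s"
          by (simp add: inner_diff_left left_diff_distrib)
        ultimately have "\<bar>(x - p0) \<bullet> b\<bar> * s \<le> 1" using s(1) by (simp add: abs_mult)
        then show "norm (((x - p0) \<bullet> b) *\<^sub>R b) \<le> 1 / s"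
          using B(3)[OF b] s(1) by (simp add: pos_le_divide_eq)
      qed
      also have "\<dots> = dim W * (r / DIM('a))" by (simp add: B(5) s_def)
      also have "\<dots> \<le> DIM('a) * (r / DIM('a))"
        using r dim_subset_UNIV[of W] by (intro mult_right_mono) auto
      finally show ?thesis by simp
    qed
    then have "(\<lambda>x. x - p0) ` {x \<in> ?A. c x = y} \<subseteq> L \<inter> cball 0 r"
      using p0(1) diff by auto
    then show ?thesis by (intro card_inj_on_le[of "\<lambda>x. x - p0"] fin') (auto simp: inj_on_def)
  qed
  from card_le_mult_card_image[OF fin this]
  have 1: "card ?A \<le> card (L \<inter> cball 0 r) * card (c ` ?A)" by blast
  have "c ` ?A \<subseteq> PiE B (\<lambda>_. ?I)"
  proof (rule image_subsetI)
    fix p assume p: "p \<in> ?A"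
    show "c p \<in> PiE B (\<lambda>_. ?I)"
    proof (rule PiE_I)
      fix b assume b: "b \<in> B"
      have "\<bar>p \<bullet> b\<bar> \<le> norm p * norm b" by (rule Cauchy_Schwarz_ineq2)
      also have "\<dots> \<le> R" using B(3)[OF b] p by simp
      finally have "\<bar>(p \<bullet> b) * s\<bar> \<le> R * s" using s(1) by (simp add: abs_mult)
      then have "- (R * s) \<le> (p \<bullet> b) * s" "(p \<bullet> b) * s \<le> R * s" by linarith+
      then have "- \<lceil>R * s\<rceil> \<le> \<lfloor>(p \<bullet> b) * s\<rfloor>" "\<lfloor>(p \<bullet> b) * s\<rfloor> \<le> \<lfloor>R * s\<rfloor>"
        by linarith+
      then show "c p b \<in> ?I" using b by (simp add: c_def)
    qed (simp add: c_def)
  qed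
  then have "card (c ` ?A) \<le> card (PiE B (\<lambda>_. ?I))"
    by (intro card_mono finite_PiE finB) auto
  also have "card (PiE B (\<lambda>_. ?I)) = card ?I ^ dim W" by (simp add: card_PiE finB B(5))
  finally have "real (card (c ` ?A)) \<le> real (card ?I) ^ dim W" by (simp flip: of_nat_power)
  also have "\<dots> \<le> (4 * DIM('a) * (R / r)) ^ dim W"
  proof (rule power_mono)
    have "real (card ?I) \<le> 2 * (R * s) + 2" using s by simp linarith
    also have "\<dots> \<le> 4 * (R * s)" using s by simp
    also have "\<dots> = 4 * DIM('a) * (R / r)" by (simp add: s_def)
    finally show "real (card ?I) \<le> 4 * DIM('a) * (R / r)" .
  qed simp
  finally have "real (card (c ` ?A)) \<le> (4 * DIM('a) * (R / r)) ^ dim W" .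
  then have "real (card (L \<inter> cball 0 r)) * real (card (c ` ?A))
      \<le> real (card (L \<inter> cball 0 r)) * (4 * DIM('a) * (R / r)) ^ dim W"
    by (rule mult_left_mono) simp
  moreover have "real (card ?A) \<le> real (card (L \<inter> cball 0 r)) * real (card (c ` ?A))"
    using 1 by (simp flip: of_nat_mult)
  ultimately show ?thesis by (simp add: mult.commute)
qed

lemma dim_isotropic_le:
  fixes V :: "((real ^ 'n::finite) \<times> (real ^ 'n)) set"
  assumes "\<And>p q. p \<in> V \<Longrightarrow> q \<in> V \<Longrightarrow> fst p \<bullet> snd q - snd p \<bullet> fst q = 0"
  shows "dim (span V) \<le> CARD('n)"
proof -
  define J where "J q = (snd q, - fst q)" for q :: "(real ^ 'n) \<times> (real ^ 'n)"
  have J: "linear J" unfolding J_def by (rule linearI) (auto simp: scaleR_prod_def)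
  have inner_J: "p \<bullet> J q = fst p \<bullet> snd q - snd p \<bullet> fst q" for p q
    by (simp add: J_def inner_prod_def)
  define W where "W = span V"
  have W: "subspace W" by (simp add: W_def)
  have 1: "p \<bullet> J q = 0" if "p \<in> W" "q \<in> V" for p q
    using that(1) unfolding W_def
    by (rule span_induct) (use assms that(2) in \<open>auto simp: inner_J[symmetric] subspace_def inner_left_distrib\<close>)
  have 2: "p \<bullet> J q = 0" if "p \<in> W" "q \<in> W" for p q
    using that(2) unfolding W_def
  proof (rule span_induct)
    show "subspace {q. p \<bullet> J q = 0}"
      unfolding subspace_def using J by (auto simp: linear_add linear_scale linear_0 inner_right_distrib)
  qed (use 1 that(1) in auto)
  have "dim W = dim (J ` W)"
    by (rule dim_image_eq[OF J, symmetric]) (auto simp: inj_on_def J_def prod_eq_iff)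
  also have "\<dots> \<le> dim {y \<in> UNIV. \<forall>x\<in>W. orthogonal x y}"
    by (rule dim_subset) (use 2 in \<open>auto simp: orthogonal_def\<close>)
  finally have "2 * dim W \<le> dim {y \<in> UNIV. \<forall>x\<in>W. orthogonal x y} + dim W" by simp
  also have "\<dots> = DIM((real ^ 'n) \<times> (real ^ 'n))"
    by (subst dim_subspace_orthogonal_to_vectors[OF W subspace_UNIV subset_UNIV]) (rule dim_UNIV)
  finally show ?thesis by (simp add: W_def)
qed

lemma finite_int_vec_box: "finite {u :: int ^ 'n::finite. \<forall>j. real_of_int \<bar>u $ j\<bar> \<le> K j}"
proof -
  have "{u :: int ^ 'n. \<forall>j. real_of_int \<bar>u $ j\<bar> \<le> K j} \<subseteq> vec_lambda ` PiE UNIV (\<lambda>j. {- \<lceil>K j\<rceil>..\<lceil>K j\<rceil>})"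
  proof safe
    fix u :: "int ^ 'n" assume u: "\<forall>j. real_of_int \<bar>u $ j\<bar> \<le> K j"
    have "- \<lceil>K j\<rceil> \<le> u $ j \<and> u $ j \<le> \<lceil>K j\<rceil>" for j
      using u[rule_format, of j] by linarith
    then show "u \<in> vec_lambda ` PiE UNIV (\<lambda>j. {- \<lceil>K j\<rceil>..\<lceil>K j\<rceil>})"
      by (intro image_eqI[of _ _ "vec_nth u"]) auto
  qed
  then show ?thesis by (rule finite_subset) (intro finite_imageI finite_PiE, auto)
qed

subsection \<open>Davenport's shrinking lemma\<close>

text \<open>The approximating vector \<open>v\<close> is kept as part of the data, so that the pairs
  are points of a lattice in a box and may be subtracted.\<close>

definition near_pairs :: "('n::finite \<Rightarrow> 'n \<Rightarrow> real) \<Rightarrow> real \<Rightarrow> real \<Rightarrow> ((int ^ 'n) \<times> (int ^ 'n)) set" where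
  "near_pairs g A \<tau> = {(u, v). (\<forall>j. real_of_int \<bar>u $ j\<bar> \<le> A) \<and>
     (\<forall>j. \<bar>(\<Sum>i\<in>UNIV. g j i * of_int (u $ i)) - of_int (v $ j)\<bar> \<le> \<tau>)}"

lemma finite_near_pairs: "finite (near_pairs g A \<tau>)"
proof -
  have v_le: "real_of_int \<bar>v $ j\<bar> \<le> \<tau> + (\<Sum>i\<in>UNIV. \<bar>g j i\<bar> * A)" if "(u, v) \<in> near_pairs g A \<tau>" for u v j
  proof -
    have "\<bar>\<Sum>i\<in>UNIV. g j i * of_int (u $ i)\<bar> \<le> (\<Sum>i\<in>UNIV. \<bar>g j i * of_int (u $ i)\<bar>)" by (rule sum_abs)
    also have "\<dots> \<le> (\<Sum>i\<in>UNIV. \<bar>g j i\<bar> * A)"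
      using that by (intro sum_mono) (auto simp: near_pairs_def abs_mult intro!: mult_left_mono)
    finally have "\<bar>\<Sum>i\<in>UNIV. g j i * of_int (u $ i)\<bar> \<le> (\<Sum>i\<in>UNIV. \<bar>g j i\<bar> * A)" .
    moreover have "\<bar>(\<Sum>i\<in>UNIV. g j i * of_int (u $ i)) - of_int (v $ j)\<bar> \<le> \<tau>"
      using that by (simp add: near_pairs_def)
    ultimately show ?thesis by linarith
  qed
  have "near_pairs g A \<tau> \<subseteq> {u. \<forall>j. real_of_int \<bar>u $ j\<bar> \<le> A} \<times>
      {v. \<forall>j. real_of_int \<bar>v $ j\<bar> \<le> \<tau> + (\<Sum>i\<in>UNIV. \<bar>g j i\<bar> * A)}"
    using v_le by (auto simp: near_pairs_def)
  then show ?thesis by (rule finite_subset) (intro finite_cartesian_product finite_int_vec_box)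
qed

text \<open>The factors \<open>1 / a\<close> and \<open>a\<close> cancel in the symplectic form of
  two such points; a suitable \<open>a\<close> turns the box of \<open>near_pairs\<close> into a
  cube.\<close>

definition davenport_point :: "('n::finite \<Rightarrow> 'n \<Rightarrow> real) \<Rightarrow> real \<Rightarrow> (int ^ 'n) \<times> (int ^ 'n) \<Rightarrow> (real ^ 'n) \<times> (real ^ 'n)" where
  "davenport_point g a = (\<lambda>(u, v). (\<chi> j. of_int (u $ j) / a,
     \<chi> j. a * ((\<Sum>i\<in>UNIV. g j i * of_int (u $ i)) - of_int (v $ j))))"

lemma davenport_point_diff:
  "davenport_point g a p - davenport_point g a q = davenport_point g a (p - q)"
  by (cases p; cases q)
    (simp add: davenport_point_def vec_eq_iff diff_divide_distrib sum_subtractf algebra_simps)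

lemma inj_davenport_point: "a \<noteq> 0 \<Longrightarrow> inj (davenport_point g a)"
  by (rule injI) (auto simp: davenport_point_def vec_eq_iff)

lemma norm_fst_le': "norm (fst p) \<le> norm p"
  and norm_snd_le': "norm (snd p) \<le> norm p"
  by (cases p; simp add: norm_fst_le norm_snd_le)+

lemma norm_davenport_point_le:
  fixes Z :: real
  assumes a: "0 < a" and p: "p \<in> near_pairs g (a * Z) (Z / a)"
  shows "norm (davenport_point g a (p :: (int ^ 'n::finite) \<times> (int ^ 'n))) \<le> 2 * CARD('n) * Z"
proof -
  obtain u v where uv: "p = (u, v)" by (cases p)
  have 1: "norm (\<chi> j. real_of_int (u $ j) / a) \<le> (\<Sum>j\<in>(UNIV :: 'n set). Z)"
    by (rule order.trans[OF norm_le_l1_cart sum_mono])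
      (use a p uv in \<open>auto simp: near_pairs_def pos_divide_le_eq mult.commute\<close>)
  have 2: "norm (\<chi> j. a * ((\<Sum>i\<in>UNIV. g j i * of_int (u $ i)) - of_int (v $ j))) \<le> (\<Sum>j\<in>(UNIV :: 'n set). Z)"
    by (rule order.trans[OF norm_le_l1_cart sum_mono])
      (use a p uv in \<open>auto simp: near_pairs_def abs_mult pos_le_divide_eq mult.commute\<close>)
  have "norm (davenport_point g a p) \<le> norm (\<chi> j. real_of_int (u $ j) / a)
      + norm (\<chi> j. a * ((\<Sum>i\<in>UNIV. g j i * of_int (u $ i)) - of_int (v $ j)))"
    unfolding uv davenport_point_def prod.case by (rule norm_Pair_le)
  with 1 2 show ?thesis by simp
qed

lemma davenport_point_in_cball_imp:
  assumes a: "0 < a" and p: "davenport_point g a p \<in> cball 0 Z"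
  shows "p \<in> near_pairs g (a * Z) (Z / a)"
proof -
  obtain u v where uv: "p = (u, v)" by (cases p)
  have n: "norm (davenport_point g a p) \<le> Z" using p by simp
  have "\<bar>fst (davenport_point g a p) $ j\<bar> \<le> Z" for j
    by (rule order.trans[OF component_le_norm_cart order.trans[OF norm_fst_le' n]])
  moreover have "\<bar>snd (davenport_point g a p) $ j\<bar> \<le> Z" for j
    by (rule order.trans[OF component_le_norm_cart order.trans[OF norm_snd_le' n]])
  ultimately show ?thesis using a
    by (auto simp: near_pairs_def uv davenport_point_def abs_mult pos_divide_le_eq pos_le_divide_eq mult.commute)
qed

text \<open>
  For a symmetric matrix the lattice of the points \<open>(u/a, a (g u - v))\<close> carries an integral
  symplectic form, which is less than 1 on short vectors. So the short vectors span an isotropic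
  subspace, of half the dimension only.
\<close>
lemma davenport_isotropic:
  assumes sym: "\<And>i j. g i j = g j i" and a: "0 < a"
    and p: "norm (davenport_point g a p) \<le> 1 / 2" and q: "norm (davenport_point g a q) \<le> 1 / 2"
  shows "fst (davenport_point g a p) \<bullet> snd (davenport_point g a q)
    - snd (davenport_point g a p) \<bullet> fst (davenport_point g a q) = 0"
proof -
  define P where "P = davenport_point g a p"
  define Q where "Q = davenport_point g a q"
  obtain u v where uv: "p = (u, v)" by (cases p)
  obtain u' v' where uv': "q = (u', v')" by (cases q)
  have "(\<Sum>j\<in>UNIV. of_int (u $ j) * (\<Sum>i\<in>UNIV. g j i * of_int (u' $ i))) =
      (\<Sum>j\<in>UNIV. \<Sum>i\<in>UNIV. of_int (u $ j) * (g j i * of_int (u' $ i)))"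
    by (simp add: sum_distrib_left)
  also have "\<dots> = (\<Sum>i\<in>UNIV. \<Sum>j\<in>UNIV. of_int (u $ j) * (g j i * of_int (u' $ i)))"
    by (rule sum.swap)
  also have "\<dots> = (\<Sum>i\<in>UNIV. (\<Sum>j\<in>UNIV. g i j * of_int (u $ j)) * of_int (u' $ i))"
    unfolding sum_distrib_right by (intro sum.cong refl, subst sym, simp only: mult_ac)
  finally have swap: "(\<Sum>j\<in>UNIV. of_int (u $ j) * (\<Sum>i\<in>UNIV. g j i * of_int (u' $ i))) =
      (\<Sum>i\<in>UNIV. (\<Sum>j\<in>UNIV. g i j * of_int (u $ j)) * of_int (u' $ i))" .
  have "fst P \<bullet> snd Q - snd P \<bullet> fst Q = of_int (\<Sum>j\<in>UNIV. v $ j * u' $ j - u $ j * v' $ j)"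
  proof -
    have "fst P \<bullet> snd Q = (\<Sum>j\<in>UNIV. of_int (u $ j) * (\<Sum>i\<in>UNIV. g j i * of_int (u' $ i)) - of_int (u $ j) * of_int (v' $ j))"
      using a unfolding P_def Q_def uv uv' davenport_point_def
      by (simp add: inner_vec_def right_diff_distrib)
    moreover have "snd P \<bullet> fst Q = (\<Sum>i\<in>UNIV. (\<Sum>j\<in>UNIV. g i j * of_int (u $ j)) * of_int (u' $ i) - of_int (v $ i) * of_int (u' $ i))"
      using a unfolding P_def Q_def uv uv' davenport_point_def
      by (simp add: inner_vec_def left_diff_distrib)
    ultimately show ?thesis using swap by (simp add: sum_subtractf)
  qed
  moreover have "\<bar>fst P \<bullet> snd Q - snd P \<bullet> fst Q\<bar> < 1"
  proof -
    have "\<bar>fst P \<bullet> snd Q\<bar> \<le> norm (fst P) * norm (snd Q)" by (rule Cauchy_Schwarz_ineq2)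
    also have "\<dots> \<le> 1 / 2 * (1 / 2)"
      using p q unfolding P_def Q_def
      by (intro mult_mono order.trans[OF norm_fst_le'] order.trans[OF norm_snd_le']) auto
    finally have 1: "\<bar>fst P \<bullet> snd Q\<bar> \<le> 1 / 4" by simp
    have "\<bar>snd P \<bullet> fst Q\<bar> \<le> norm (snd P) * norm (fst Q)" by (rule Cauchy_Schwarz_ineq2)
    also have "\<dots> \<le> 1 / 2 * (1 / 2)"
      using p q unfolding P_def Q_def
      by (intro mult_mono order.trans[OF norm_fst_le'] order.trans[OF norm_snd_le']) auto
    finally show ?thesis using 1 by simp
  qed
  ultimately have "\<bar>\<Sum>j\<in>UNIV. v $ j * u' $ j - u $ j * v' $ j\<bar> < 1"
    and eq: "fst P \<bullet> snd Q - snd P \<bullet> fst Q = of_int (\<Sum>j\<in>UNIV. v $ j * u' $ j - u $ j * v' $ j)"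
    by linarith+
  then show ?thesis unfolding P_def[symmetric] Q_def[symmetric] eq by simp
qed

text \<open>With \<open>a = sqrt (A / \<tau>)\<close> both sides of the box become
  \<open>Z = sqrt (A * \<tau>)\<close>. Going down to radius \<open>1 / 2\<close> costs a bounded
  factor, since \<open>Z\<close> is bounded through \<open>K\<close>; below \<open>1 / 2\<close> the
  points span an isotropic space, so the remaining shrinking costs the power \<open>CARD('n)\<close>
  of \<open>A / A'\<close> and not twice that power.\<close>

theorem davenport_shrinking:
  fixes K :: real
  obtains C where "1 \<le> C" "\<And>(g :: 'n::finite \<Rightarrow> 'n \<Rightarrow> real) A A' \<tau>. (\<And>i j. g i j = g j i) \<Longrightarrow>
    0 < \<tau> \<Longrightarrow> 0 < A' \<Longrightarrow> A' \<le> A \<Longrightarrow> A * \<tau> \<le> K \<Longrightarrow>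
    real (card (near_pairs g A \<tau>)) \<le> C * (A / A') ^ CARD('n) * real (card (near_pairs g A' (\<tau> * (A' / A))))"
proof -
  define n where "n = CARD('n)"
  have n: "1 \<le> n" unfolding n_def by (simp add: Suc_leI)
  \<comment> \<open>\<open>8 * n\<close> is \<open>4 * DIM\<close> for the space of pairs, and the
    bracket bounds \<open>R / R1\<close>; so \<open>C0 ^ (2 * n)\<close> pays for the descent from
    radius \<open>R\<close> to \<open>R1\<close>.\<close>
  define C0 where "C0 = 8 * real n * (1 + 4 * real n * sqrt \<bar>K\<bar>)"
  define C where "C = C0 ^ (2 * n) * (8 * real n * (2 * real n)) ^ n"
  have "1 * 1 \<le> 8 * real n * (1 + 4 * real n * sqrt \<bar>K\<bar>)" using n by (intro mult_mono) auto
  then have C0: "1 \<le> C0" by (simp add: C0_def)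
  have "1 * 1 \<le> 8 * real n * (2 * real n)" using n by (intro mult_mono) auto
  then have "1 * 1 \<le> C" unfolding C_def using C0 by (intro mult_mono one_le_power) auto
  then have C: "1 \<le> C" by simp
  show ?thesis
  proof (rule that[OF C])
    fix g :: "'n \<Rightarrow> 'n \<Rightarrow> real" and A A' \<tau> :: real
    assume sym: "\<And>i j. g i j = g j i" and \<tau>: "0 < \<tau>" and A': "0 < A'" "A' \<le> A" and K: "A * \<tau> \<le> K"
    have A: "0 < A" using A' by simp
    define a where "a = sqrt (A / \<tau>)"
    define Z where "Z = sqrt (A * \<tau>)"
    have a: "0 < a" and Z: "0 < Z" using A \<tau> by (auto simp: a_def Z_def)
    have "a * Z = sqrt (A\<^sup>2)" unfolding a_def Z_def real_sqrt_mult[symmetric] using \<tau> by (simp add: power2_eq_square)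
    then have aZ: "a * Z = A" using A by simp
    have "Z / a = sqrt (\<tau>\<^sup>2)" unfolding a_def Z_def real_sqrt_divide[symmetric] using A \<tau> by (simp add: power2_eq_square)
    then have Za: "Z / a = \<tau>" using \<tau> by simp
    define L where "L = range (davenport_point g a)"
    have L_diff: "x - y \<in> L" if "x \<in> L" "y \<in> L" for x y
      using that unfolding L_def by (auto simp: davenport_point_diff)
    have inj: "inj (davenport_point g a)" using a by (intro inj_davenport_point) simp
    have L_sub: "L \<inter> cball 0 r \<subseteq> davenport_point g a ` near_pairs g (a * r) (r / a)" for r
      unfolding L_def using davenport_point_in_cball_imp[OF a] by blast
    have fin: "finite (L \<inter> cball 0 r)" for r
      by (rule finite_subset[OF L_sub]) (intro finite_imageI finite_near_pairs)
    define R where "R = 2 * real n * Z"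
    define r where "r = Z * (A' / A)"
    have r: "0 < r" using Z A' A by (simp add: r_def)
    have "r \<le> Z * 1" unfolding r_def using Z A A' by (intro mult_left_mono) auto
    moreover have "1 * Z \<le> 2 * real n * Z" using n Z by (intro mult_right_mono) auto
    ultimately have rR: "r \<le> R" by (simp add: R_def)
    \<comment> \<open>The cap \<open>1 / 2\<close> makes the isotropy of short vectors available
      between \<open>R1\<close> and \<open>r1\<close>.\<close>
    define R1 where "R1 = min R (1 / 2)"
    define r1 where "r1 = min r (1 / 2)"
    have R1: "0 < R1" "R1 \<le> R" and r1: "0 < r1" "r1 \<le> R1" "r1 \<le> r"
      using r rR by (auto simp: R1_def r1_def)
    have R_R1: "R / R1 \<le> 1 + 4 * real n * sqrt \<bar>K\<bar>"
    proof -
      have "R / R1 \<le> 1 + 2 * R" using r rR by (auto simp: R1_def min_def field_simps)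
      moreover have "Z \<le> sqrt \<bar>K\<bar>" unfolding Z_def using K by (intro real_sqrt_le_mono) simp
      then have "4 * real n * Z \<le> 4 * real n * sqrt \<bar>K\<bar>" by (intro mult_left_mono) auto
      ultimately show ?thesis by (simp add: R_def)
    qed
    have "R1 / r1 \<le> R / r"
    proof (cases "r \<le> 1 / 2")
      case True
      then show ?thesis using r R1 by (simp add: r1_def divide_right_mono)
    next
      case False
      then show ?thesis using r rR by (simp add: r1_def R1_def min_def)
    qed
    also have "\<dots> = 2 * real n * (A / A')" using Z A A' by (simp add: R_def r_def)
    finally have R1_r1: "R1 / r1 \<le> 2 * real n * (A / A')" .
    have "real (card (near_pairs g A \<tau>)) = real (card (davenport_point g a ` near_pairs g A \<tau>))"
      using inj by (simp add: card_image inj_on_subset)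
    also have "\<dots> \<le> real (card (L \<inter> cball 0 R))"
      using norm_davenport_point_le[OF a, of _ g Z] unfolding aZ Za
      by (intro of_nat_mono card_mono fin) (auto simp: L_def R_def n_def)
    also have "\<dots> \<le> (4 * DIM((real ^ 'n) \<times> (real ^ 'n)) * (R / R1)) ^ dim (UNIV :: ((real ^ 'n) \<times> (real ^ 'n)) set)
        * real (card (L \<inter> cball 0 R1))"
      using R1 by (intro card_ball_cover L_diff fin) auto
    also have "\<dots> \<le> C0 ^ (2 * n) * real (card (L \<inter> cball 0 R1))"
    proof (rule mult_right_mono)
      have "(8 * real n * (R / R1)) ^ (2 * n) \<le> C0 ^ (2 * n)"
        unfolding C0_def using R_R1 R1 by (intro power_mono mult_left_mono) auto
      then show "(4 * DIM((real ^ 'n) \<times> (real ^ 'n)) * (R / R1)) ^ dim (UNIV :: ((real ^ 'n) \<times> (real ^ 'n)) set) \<le> C0 ^ (2 * n)"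
        by (simp add: n_def mult_2)
    qed simp
    also have "real (card (L \<inter> cball 0 R1)) \<le> (8 * real n * (2 * real n)) ^ n * (A / A') ^ n * real (card (L \<inter> cball 0 r1))"
    proof -
      define W where "W = span (L \<inter> cball 0 R1)"
      have dimW: "dim W \<le> n"
        unfolding W_def n_def
      proof (rule dim_isotropic_le)
        fix x y assume xy: "x \<in> L \<inter> cball 0 R1" "y \<in> L \<inter> cball 0 R1"
        then obtain p q where pq: "x = davenport_point g a p" "y = davenport_point g a q"
          unfolding L_def by blast
        have "norm x \<le> 1 / 2" "norm y \<le> 1 / 2" using xy by (auto simp: R1_def)
        then show "fst x \<bullet> snd y - snd x \<bullet> fst y = 0"
          unfolding pq by (rule davenport_isotropic[OF sym a])
      qed
      have "real (card (L \<inter> cball 0 R1)) \<le> (4 * DIM((real ^ 'n) \<times> (real ^ 'n)) * (R1 / r1)) ^ dim W * real (card (L \<inter> cball 0 r1))"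
        using r1 by (intro card_ball_cover L_diff fin) (auto simp: W_def span_superset)
      also have "\<dots> \<le> (8 * real n * (2 * real n) * (A / A')) ^ n * real (card (L \<inter> cball 0 r1))"
      proof (rule mult_right_mono)
        have "1 * 1 \<le> 8 * real n * (R1 / r1)" using n r1 by (intro mult_mono) auto
        then have "(8 * real n * (R1 / r1)) ^ dim W \<le> (8 * real n * (R1 / r1)) ^ n"
          using dimW by (intro power_increasing) auto
        also have "\<dots> \<le> (8 * real n * (2 * real n * (A / A'))) ^ n"
          using R1_r1 r1 by (intro power_mono mult_left_mono) auto
        finally show "(4 * DIM((real ^ 'n) \<times> (real ^ 'n)) * (R1 / r1)) ^ dim W \<le> (8 * real n * (2 * real n) * (A / A')) ^ n"
          by (simp add: n_def mult_ac)
      qed simp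
      finally show ?thesis by (simp only: power_mult_distrib)
    qed
    also have "real (card (L \<inter> cball 0 r1)) \<le> real (card (near_pairs g A' (\<tau> * (A' / A))))"
    proof -
      have "card (L \<inter> cball 0 r1) \<le> card (L \<inter> cball 0 r)"
        using r1 by (intro card_mono fin) auto
      also have "\<dots> \<le> card (davenport_point g a ` near_pairs g (a * r) (r / a))"
        by (intro card_mono L_sub finite_imageI finite_near_pairs)
      also have "\<dots> \<le> card (near_pairs g (a * r) (r / a))"
        by (intro card_image_le finite_near_pairs)
      also have "a * r = A'"
      proof -
        have "a * r = (a * Z) * (A' / A)" by (simp add: r_def)
        then show ?thesis using A by (simp add: aZ)
      qed
      also have "r / a = \<tau> * (A' / A)"
      proof -
        have "r / a = (Z / a) * (A' / A)" by (simp add: r_def)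
        then show ?thesis by (simp add: Za)
      qed
      finally show ?thesis by simp
    qed
    finally show "real (card (near_pairs g A \<tau>)) \<le> C * (A / A') ^ CARD('n) * real (card (near_pairs g A' (\<tau> * (A' / A))))"
      unfolding C_def n_def[symmetric] using C0 n A A' by (simp add: mult_ac mult_left_mono)
  qed
qed

subsection \<open>Iterated differences\<close>

definition iter_diff :: "'v::ab_group_add list \<Rightarrow> ('v \<Rightarrow> 'b::ab_group_add) \<Rightarrow> 'v \<Rightarrow> 'b" where
  "iter_diff hs f = foldl (\<lambda>g h x. g (x + h) - g x) f hs"

lemma iter_diff_Nil [simp]: "iter_diff [] f = f"
  by (simp add: iter_diff_def)

lemma iter_diff_Cons: "iter_diff (h # hs) f = iter_diff hs (\<lambda>x. f (x + h) - f x)"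
  by (simp add: iter_diff_def)

lemma iter_diff_append: "iter_diff (hs @ hs') f = iter_diff hs' (iter_diff hs f)"
  by (simp add: iter_diff_def)

lemma iter_diff_snoc: "iter_diff (hs @ [h]) f = (\<lambda>x. iter_diff hs f (x + h) - iter_diff hs f x)"
  by (simp add: iter_diff_def)

lemma iter_diff_Cons': "iter_diff (h # hs) f = (\<lambda>x. iter_diff hs f (x + h) - iter_diff hs f x)"
proof (induction hs arbitrary: f)
  case (Cons h' hs)
  have "iter_diff (h # h' # hs) f = iter_diff (h # hs) (\<lambda>x. f (x + h') - f x)"
    unfolding iter_diff_Cons by (rule arg_cong[where f = "iter_diff hs"]) (simp add: fun_eq_iff algebra_simps)
  also have "\<dots> = (\<lambda>x. iter_diff (h' # hs) f (x + h) - iter_diff (h' # hs) f x)"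
    unfolding Cons.IH iter_diff_Cons[of h'] ..
  finally show ?case .
qed (simp add: iter_diff_Cons)

text \<open>Differences commute; this is the symmetry of the polar form
  \<open>iter_diff hs F 0\<close>.\<close>

lemma iter_diff_middle: "iter_diff (xs @ y # ys) f = iter_diff (y # xs @ ys) f"
  unfolding iter_diff_append iter_diff_Cons[of y ys] iter_diff_Cons'[of y "xs @ ys"]
  by (simp add: iter_diff_append[symmetric] iter_diff_Cons'[symmetric])

lemma iter_diff_additive:
  assumes "\<And>x y. \<phi> (x - y) = \<phi> x - \<phi> y"
  shows "iter_diff hs (\<lambda>x. \<phi> (f x)) x = \<phi> (iter_diff hs f x)"
  by (induction hs arbitrary: f) (simp_all add: iter_diff_Cons assms[symmetric])

lemma iter_diff_0: "iter_diff hs (\<lambda>_. 0) x = 0"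
  by (induction hs) (simp_all add: iter_diff_Cons)

lemma iter_diff_add: "iter_diff hs (\<lambda>x. f x + g x) x = iter_diff hs f x + iter_diff hs g x"
proof (induction hs arbitrary: f g)
  case (Cons h hs)
  have "iter_diff (h # hs) (\<lambda>x. f x + g x) x = iter_diff hs (\<lambda>x. (f (x + h) - f x) + (g (x + h) - g x)) x"
    unfolding iter_diff_Cons by (simp add: algebra_simps)
  then show ?case unfolding Cons.IH iter_diff_Cons .
qed simp

lemma iter_diff_sum: "iter_diff hs (\<lambda>x. \<Sum>i\<in>I. f i x) x = (\<Sum>i\<in>I. iter_diff hs (f i) x)"
  by (induction I rule: infinite_finite_induct) (simp_all add: iter_diff_0 iter_diff_add)

lemma iter_diff_mult: "iter_diff hs (\<lambda>x. c * f x) x = c * iter_diff hs f (x :: 'v::ab_group_add)" for c :: "'b::comm_ring_1"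
  by (rule iter_diff_additive) (simp add: right_diff_distrib)

lemma poly_below_iter_diff:
  "poly_below (length hs + m) f \<Longrightarrow> poly_below m (iter_diff hs f)"
  by (induction hs arbitrary: f) (auto simp: iter_diff_Cons intro: poly_below_difference)

lemma poly_below_1_const:
  assumes "poly_below (Suc 0) f"
  shows "f x = f 0"
  using poly_below_difference[OF assms, of x] unfolding poly_below_0 by (metis add_0 eq_iff_diff_eq_0)

lemma poly_below_2_affine:
  fixes f :: "'a::comm_ring_1 ^ 'n::finite \<Rightarrow> 'a"
  assumes "poly_below 2 f"
  shows "f x = f 0 + (\<Sum>j\<in>UNIV. (f (axis j 1) - f 0) * x $ j)"
  using assms
proof induction
  case (step f e c)
  have "monom_fun e x = monom_fun e 0 + (\<Sum>j\<in>UNIV. (monom_fun e (axis j 1) - monom_fun e 0) * x $ j)"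
  proof (cases "sum e UNIV = 0")
    case True
    then show ?thesis by (simp add: monom_fun_def)
  next
    case False
    then have "sum e UNIV = 1" using step.hyps(2) by linarith
    then have "\<exists>i\<in>UNIV. e i = 1 \<and> (\<forall>j\<in>UNIV. i \<noteq> j \<longrightarrow> e j = 0)"
      by (subst (asm) sum_eq_1_iff) auto
    then obtain i where "e i = 1" "\<And>j. j \<noteq> i \<Longrightarrow> e j = 0" by auto
    then have "e = (\<lambda>j. if j = i then 1 else 0)" by auto
    then have mono: "monom_fun e y = y $ i" for y :: "'a ^ 'n" by (simp add: monom_fun_single)
    show ?thesis unfolding mono by (simp add: axis_def if_distrib[of "\<lambda>t. t * _"] cong: if_cong)
  qed
  then have "c * monom_fun e x = c * monom_fun e 0 + (\<Sum>j\<in>UNIV. (c * monom_fun e (axis j 1) - c * monom_fun e 0) * x $ j)"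
    by (simp add: distrib_left sum_distrib_left right_diff_distrib left_diff_distrib mult.assoc)
  with step.IH show ?case
    by (simp add: sum.distrib[symmetric] algebra_simps)
qed simp

subsection \<open>Polarisation\<close>

text \<open>Here \<open>x\<close> is both the step and the variable. Successive differences with
  step \<open>x\<close> move the base point to multiples of \<open>x\<close>, hence the statement
  for all \<open>of_nat s *s x\<close>.\<close>

lemma poly_below_iter_diff_replicate:
  "poly_below (Suc m) f \<Longrightarrow> poly_below (Suc m) (\<lambda>x. iter_diff (replicate r x) f (of_nat s *s x))"
proof (induction r arbitrary: s)
  case 0
  then show ?case by (simp add: poly_below_scale)
next
  case (Suc r)
  have "poly_below (Suc m) (\<lambda>x. iter_diff (replicate r x) f (of_nat (Suc s) *s x) - iter_diff (replicate r x) f (of_nat s *s x))"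
    by (intro poly_below_diff Suc)
  moreover have shift: "of_nat s *s x + x = of_nat (Suc s) *s x" for x :: "'a ^ 'b"
    by (simp add: vec_eq_iff algebra_simps)
  ultimately show ?case unfolding replicate_Suc iter_diff_Cons' shift by simp
qed

lemma poly_below_polarisation_replicate:
  assumes "poly_below (Suc d) F" "length ks + r = d"
  shows "poly_below (Suc r) (\<lambda>x. iter_diff (ks @ replicate r x) F 0)"
proof -
  have "poly_below (Suc r) (iter_diff ks F)"
    by (rule poly_below_iter_diff) (use assms in simp)
  from poly_below_iter_diff_replicate[OF this, of r 0] show ?thesis
    by (simp add: iter_diff_append)
qed

text \<open>With \<open>d\<close> arguments in all, the other \<open>d - 1\<close> differences leave
  a function of degree at most one, so additivity in a slot is exact.\<close>

lemma iter_diff_add_middle: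
  assumes "poly_below (Suc d) F" "length xs + length ys + 1 = d"
  shows "iter_diff (xs @ (g + h) # ys) F 0 = iter_diff (xs @ g # ys) F 0 + iter_diff (xs @ h # ys) F 0"
proof -
  define G where "G = iter_diff (xs @ ys) F"
  have "poly_below 2 G"
    unfolding G_def by (rule poly_below_iter_diff) (use assms in \<open>simp add: eval_nat_numeral\<close>)
  from poly_below_difference[of 1 G, simplified, OF this[unfolded numeral_2_eq_2]]
  have "poly_below (Suc 0) (\<lambda>x. G (x + h) - G x)" by simp
  from poly_below_1_const[OF this, of g] have "G (g + h) - G g = G h - G 0" by simp
  then show ?thesis
    unfolding iter_diff_middle iter_diff_Cons'[of _ "xs @ ys"] G_def[symmetric] by (simp add: algebra_simps)
qed

text \<open>Expand the slots \<open>g + x\<close> one at a time: a term that takes some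
  \<open>g\<close> has fewer slots filled with \<open>x\<close> and so lower degree. The leading
  form in \<open>x\<close> is the diagonal one, whatever the \<open>gs\<close> are.\<close>

lemma poly_below_polarisation_shift:
  assumes F: "poly_below (Suc d) F"
  shows "length ks + r + length gs = d \<Longrightarrow> poly_below (r + length gs)
    (\<lambda>x. iter_diff (ks @ replicate r x @ map (\<lambda>g. g + x) gs) F 0 - iter_diff (ks @ replicate (r + length gs) x) F 0)"
proof (induction gs arbitrary: ks r)
  case Nil
  then show ?case by (simp add: poly_below.zero)
next
  case (Cons g gs)
  have len: "length (ks @ replicate r x) + length (map (\<lambda>g. g + x) gs) + 1 = d" for x
    using Cons.prems by simp
  have eq: "iter_diff (ks @ replicate r x @ map (\<lambda>g. g + x) (g # gs)) F 0 =
    iter_diff ((g # ks) @ replicate r x @ map (\<lambda>g. g + x) gs) F 0 +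
    iter_diff (ks @ replicate (Suc r) x @ map (\<lambda>g. g + x) gs) F 0" for x
  proof -
    have "iter_diff (ks @ replicate r x @ map (\<lambda>g. g + x) (g # gs)) F 0 =
      iter_diff ((ks @ replicate r x) @ g # map (\<lambda>g. g + x) gs) F 0 +
      iter_diff ((ks @ replicate r x) @ x # map (\<lambda>g. g + x) gs) F 0"
      using iter_diff_add_middle[OF F len[of x], of g x] by simp
    also have "iter_diff ((ks @ replicate r x) @ g # map (\<lambda>g. g + x) gs) F 0 =
      iter_diff ((g # ks) @ replicate r x @ map (\<lambda>g. g + x) gs) F 0"
      unfolding iter_diff_middle by simp
    also have "(ks @ replicate r x) @ x # map (\<lambda>g. g + x) gs = ks @ replicate (Suc r) x @ map (\<lambda>g. g + x) gs"
      by (simp add: replicate_app_Cons_same)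
    finally show ?thesis .
  qed
  have 1: "poly_below (Suc r + length gs) (\<lambda>x. iter_diff (ks @ replicate (Suc r) x @ map (\<lambda>g. g + x) gs) F 0
      - iter_diff (ks @ replicate (Suc r + length gs) x) F 0)"
    using Cons.prems by (intro Cons.IH) simp
  have "poly_below (r + length gs) (\<lambda>x. iter_diff ((g # ks) @ replicate r x @ map (\<lambda>g. g + x) gs) F 0
      - iter_diff ((g # ks) @ replicate (r + length gs) x) F 0)"
    using Cons.prems by (intro Cons.IH) simp
  then have "poly_below (Suc (r + length gs)) (\<lambda>x. iter_diff ((g # ks) @ replicate r x @ map (\<lambda>g. g + x) gs) F 0
      - iter_diff ((g # ks) @ replicate (r + length gs) x) F 0)"
    by (rule poly_below_mono) simp
  moreover have "poly_below (Suc (r + length gs)) (\<lambda>x. iter_diff ((g # ks) @ replicate (r + length gs) x) F 0)"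
    by (rule poly_below_polarisation_replicate[OF F]) (use Cons.prems in simp)
  ultimately have "poly_below (Suc (r + length gs)) (\<lambda>x. (iter_diff ((g # ks) @ replicate r x @ map (\<lambda>g. g + x) gs) F 0
      - iter_diff ((g # ks) @ replicate (r + length gs) x) F 0) + iter_diff ((g # ks) @ replicate (r + length gs) x) F 0)"
    by (rule poly_below_add)
  then have 2: "poly_below (Suc (r + length gs)) (\<lambda>x. iter_diff ((g # ks) @ replicate r x @ map (\<lambda>g. g + x) gs) F 0)"
    by simp
  have "poly_below (Suc (r + length gs)) (\<lambda>x. iter_diff ((g # ks) @ replicate r x @ map (\<lambda>g. g + x) gs) F 0 +
     (iter_diff (ks @ replicate (Suc r) x @ map (\<lambda>g. g + x) gs) F 0 - iter_diff (ks @ replicate (Suc r + length gs) x) F 0))"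
    using 1 by (intro poly_below_add 2) simp
  then show ?case unfolding eq by (simp add: add_diff_eq)
qed

lemma iter_diff_power:
  "i \<le> m \<Longrightarrow> iter_diff (replicate m 1) (\<lambda>t::int. t ^ i) 0 = (if i = m then fact m else 0)"
proof (induction m arbitrary: i)
  case (Suc m)
  have "(t + 1) ^ i - t ^ i = (\<Sum>l<i. int (i choose l) * t ^ l)" for t :: int
    by (subst binomial_ring) (simp add: lessThan_Suc_atMost[symmetric])
  then have "iter_diff (replicate (Suc m) 1) (\<lambda>t::int. t ^ i) 0
      = (\<Sum>l<i. int (i choose l) * iter_diff (replicate m 1) (\<lambda>t. t ^ l) 0)"
    by (simp add: iter_diff_Cons iter_diff_sum iter_diff_mult)
  also have "\<dots> = (\<Sum>l<i. if l = m then int (i choose m) * fact m else 0)"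
    using Suc.prems by (intro sum.cong) (auto simp: Suc.IH)
  also have "\<dots> = (if i = Suc m then fact (Suc m) else 0)"
    using Suc.prems by auto
  finally show ?case .
qed simp

lemma iter_diff_replicate_line:
  fixes G :: "int ^ 'n::finite \<Rightarrow> int"
  shows "iter_diff (replicate m x) G (k *s x) = iter_diff (replicate m 1) (\<lambda>t. G (t *s x)) k"
proof (induction m arbitrary: G)
  case (Suc m)
  have "t *s x + x = (t + 1) *s x" for t :: int
    by (simp add: vec_eq_iff algebra_simps)
  then show ?case by (simp add: iter_diff_Cons Suc.IH)
qed simp

text \<open>On the line through \<open>x\<close> the function is \<open>G x * t ^ m\<close>, whose
  \<open>m\<close>-th difference is \<open>fact m * G x\<close>.\<close>

lemma iter_diff_homogeneous:
  fixes G :: "int ^ 'n::finite \<Rightarrow> int"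
  assumes "\<And>c x. G (c *s x) = c ^ m * G x"
  shows "iter_diff (replicate m x) G 0 = fact m * G x"
proof -
  have "iter_diff (replicate m x) G 0 = iter_diff (replicate m 1) (\<lambda>t. G x * t ^ m) 0"
    using iter_diff_replicate_line[of m x G 0] by (simp add: assms mult.commute)
  then show ?thesis by (simp add: iter_diff_mult iter_diff_power)
qed

text \<open>The first difference, along the axis, is the partial derivative up to degree
  \<open>d - 2\<close>, and the remaining \<open>d - 1\<close> differences kill that error. So the
  diagonal of the polar form is governed by smoothness.\<close>

lemma iter_diff_coord_replicate:
  fixes F :: "'n::finite int_mpoly"
  assumes "homogeneous d F" "0 < d"
  shows "iter_diff (axis i 1 # replicate (d - 1) x) (eval_mpoly F) (0 :: int ^ 'n)
    = fact (d - 1) * eval_mpoly (partial_deriv i F) x"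
proof -
  let ?R = "\<lambda>y. eval_mpoly F (y + axis i 1) - eval_mpoly F y - eval_mpoly (partial_deriv i F) (y :: int ^ 'n)"
  have "poly_below (d - 1) ?R" by (rule poly_below_taylor[OF assms(1)])
  then have "poly_below 0 (iter_diff (replicate (d - 1) x) ?R)"
    by (intro poly_below_iter_diff) simp
  then have "iter_diff (replicate (d - 1) x) ?R 0 = 0" by (simp add: poly_below_0)
  then have "iter_diff (replicate (d - 1) x) (\<lambda>y. ?R y + eval_mpoly (partial_deriv i F) y) 0
      = iter_diff (replicate (d - 1) x) (eval_mpoly (partial_deriv i F)) 0"
    by (simp only: iter_diff_add)
  also have "\<dots> = fact (d - 1) * eval_mpoly (partial_deriv i F) x"
    by (rule iter_diff_homogeneous) (rule eval_partial_deriv_scale[OF assms(1)])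
  finally show ?thesis by (simp add: iter_diff_Cons)
qed

subsection \<open>Integral zeros of the polar forms\<close>

definition int_cube :: "real \<Rightarrow> (int ^ 'n::finite) set" where
  "int_cube R = {x. \<forall>j. real_of_int \<bar>x $ j\<bar> \<le> R}"

definition cube_lists :: "real \<Rightarrow> nat \<Rightarrow> (int ^ 'n::finite) list set" where
  "cube_lists R m = {hs. set hs \<subseteq> int_cube R \<and> length hs = m}"

lemma finite_int_cube: "finite (int_cube R)"
  unfolding int_cube_def by (rule finite_int_vec_box)

lemma finite_cube_lists: "finite (cube_lists R m)"
  unfolding cube_lists_def by (rule finite_lists_length_eq[OF finite_int_cube])

lemma card_int_cube_le:
  assumes "1 \<le> R"
  shows "real (card (int_cube R :: (int ^ 'n::finite) set)) \<le> (3 * R) ^ CARD('n)"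
proof -
  have "int_cube R \<subseteq> vec_lambda ` PiE (UNIV :: 'n set) (\<lambda>_. {- \<lfloor>R\<rfloor>..\<lfloor>R\<rfloor>})"
  proof
    fix u :: "int ^ 'n" assume u: "u \<in> int_cube R"
    have "- \<lfloor>R\<rfloor> \<le> u $ j \<and> u $ j \<le> \<lfloor>R\<rfloor>" for j
      using u unfolding int_cube_def mem_Collect_eq by (auto dest!: spec[of _ j] simp: le_floor_iff) linarith
    then show "u \<in> vec_lambda ` PiE (UNIV :: 'n set) (\<lambda>_. {- \<lfloor>R\<rfloor>..\<lfloor>R\<rfloor>})"
      by (intro image_eqI[of _ _ "vec_nth u"]) auto
  qed
  then have "card (int_cube R :: (int ^ 'n) set) \<le> card (vec_lambda ` PiE (UNIV :: 'n set) (\<lambda>_. {- \<lfloor>R\<rfloor>..\<lfloor>R\<rfloor>}))"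
    by (intro card_mono finite_imageI finite_PiE) auto
  also have "\<dots> \<le> card (PiE (UNIV :: 'n set) (\<lambda>_. {- \<lfloor>R\<rfloor>..\<lfloor>R\<rfloor>}))"
    by (intro card_image_le finite_PiE) auto
  also have "\<dots> = nat (2 * \<lfloor>R\<rfloor> + 1) ^ CARD('n)" using assms by (simp add: card_PiE)
  finally have "real (card (int_cube R :: (int ^ 'n) set)) \<le> real (nat (2 * \<lfloor>R\<rfloor> + 1)) ^ CARD('n)"
    by (simp flip: of_nat_power)
  also have "\<dots> \<le> (3 * R) ^ CARD('n)"
  proof (rule power_mono)
    have "0 \<le> \<lfloor>R\<rfloor>" using assms by simp
    then show "real (nat (2 * \<lfloor>R\<rfloor> + 1)) \<le> 3 * R" using assms by linarith
  qed simp
  finally show ?thesis .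
qed

lemma card_cube_lists: "card (cube_lists R m :: (int ^ 'n::finite) list set) = card (int_cube R :: (int ^ 'n) set) ^ m"
  unfolding cube_lists_def by (rule card_lists_length_eq[OF finite_int_cube])

lemma eval_mpoly_complex_vec: "eval_mpoly F (complex_vec x) = of_int (eval_mpoly F x)"
  by (simp add: eval_mpoly_monom_fun monom_fun_complex_vec)

lemma inj_complex_vec: "inj complex_vec"
  by (rule injI) (simp add: complex_vec_def vec_eq_iff)

text \<open>Fix the differences of the other vectors to the first one. Then only the first vector
  varies, subject to as many equations as it has coordinates, and their leading forms
  \<open>(d - 1)!\<close> times the partial derivatives are the same on every fibre. Each fibre
  therefore has boundedly many zeros, and the fibres are indexed by \<open>d - 2\<close> vectors of
  size at most \<open>2 * R\<close>.\<close>

theorem card_polar_zeros_le: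
  fixes F :: "'n::finite int_mpoly"
  assumes F: "homogeneous d F" "smooth_form F" and d: "2 \<le> d"
  obtains C where "0 \<le> C" "\<And>R. 1 \<le> R \<Longrightarrow>
    real (card {hs \<in> cube_lists R (d - 1). \<forall>j. iter_diff (axis j 1 # hs) (eval_mpoly F) (0 :: int ^ 'n) = 0})
      \<le> C * (R ^ (d - 2)) ^ CARD('n)"
proof -
  let ?F = "eval_mpoly F :: int ^ 'n \<Rightarrow> int"
  define G where "G j x = fact (d - 1) * eval_mpoly (partial_deriv j F) (x :: complex ^ 'n)" for j x
  have G: "is_poly (G j)" for j
    unfolding G_def by (intro is_poly_mult is_poly_const poly_below_imp_is_poly[OF poly_below_eval_partial_deriv[OF F(1)]])
  have hom: "G j (c *s x) = c ^ (d - 1) * G j x" for j c x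
    by (simp add: G_def eval_partial_deriv_scale[OF F(1)])
  have no_zero: "\<exists>j. G j x \<noteq> 0" if "x \<noteq> 0" for x
    using F(2) that by (auto simp: smooth_form_def G_def)
  obtain C where C: "\<And>S Q. (\<And>j. poly_below (d - 1) (\<lambda>x. Q j x - G j x)) \<Longrightarrow> (\<And>s j. s \<in> S \<Longrightarrow> Q j s = 0)
    \<Longrightarrow> finite S \<and> card S \<le> C"
    using card_common_zeros_bounded[of G "d - 1", OF G hom no_zero] by blast
  have Fpoly: "poly_below (Suc d) ?F" by (rule poly_below_eval_mpoly[OF F(1)])
  define Z where "Z R = {hs \<in> cube_lists R (d - 1). \<forall>j. iter_diff (axis j 1 # hs) ?F 0 = 0}" for R
  \<comment> \<open>The tuple of differences to the head; together with the head it determines the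
    tuple.\<close>
  define \<phi> where "\<phi> hs = map (\<lambda>h. h - hd hs) (tl hs)" for hs :: "(int ^ 'n) list"
  have fibre: "card {hs \<in> Z R. \<phi> hs = gs} \<le> C" if gs: "gs \<in> \<phi> ` Z R" for R gs
  proof -
    have len: "length gs = d - 2" using gs by (auto simp: \<phi>_def Z_def cube_lists_def)
    define P where "P j x = iter_diff (axis j 1 # x # map (\<lambda>g. g + x) gs) ?F 0" for j x
    have "poly_below (1 + length gs) (\<lambda>x. iter_diff ([axis j 1] @ replicate 1 x @ map (\<lambda>g. g + x) gs) ?F 0
        - iter_diff ([axis j 1] @ replicate (1 + length gs) x) ?F 0)" for j
      by (rule poly_below_polarisation_shift[OF Fpoly]) (use len d in simp)
    moreover have eq: "d - Suc 0 = Suc (length gs)" using len d by simp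
    ultimately have "poly_below (d - 1) (\<lambda>x. P j x - iter_diff (axis j 1 # replicate (d - 1) x) ?F 0)" for j
      by (simp add: P_def eq)
    then have "poly_below (d - 1) (\<lambda>x. P j x - fact (d - 1) * eval_mpoly (partial_deriv j F) x)" for j
      using iter_diff_coord_replicate[OF F(1)] d by simp
    then have "\<exists>q. poly_below (d - 1) q \<and> (\<forall>x. q (complex_vec x) = of_int (P j x - fact (d - 1) * eval_mpoly (partial_deriv j F) x))" for j
      using poly_below_complexify by blast
    then have "\<forall>j. \<exists>q. poly_below (d - 1) q \<and> (\<forall>x. q (complex_vec x) = of_int (P j x - fact (d - 1) * eval_mpoly (partial_deriv j F) x))"
      by blast
    then obtain q where q: "\<And>j. poly_below (d - 1) (q j)"
      "\<And>j x. q j (complex_vec x) = of_int (P j x - fact (d - 1) * eval_mpoly (partial_deriv j F) x)"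
      unfolding choice_iff by blast
    define S where "S = {x. \<forall>j. P j x = 0}"
    have Q: "q j (complex_vec x) + G j (complex_vec x) = of_int (P j x)" for j x
      unfolding q(2) G_def eval_mpoly_complex_vec by simp
    have "finite (complex_vec ` S) \<and> card (complex_vec ` S) \<le> C"
      by (rule C[of "\<lambda>j x. q j x + G j x"]) (use q(1) in \<open>auto simp: Q S_def\<close>)
    moreover have "inj_on complex_vec S"
      by (rule inj_on_subset[OF inj_complex_vec]) simp
    ultimately have S: "finite S" "card S \<le> C"
      by (auto simp: card_image dest: finite_imageD)
    have recover: "hs = hd hs # map (\<lambda>g. g + hd hs) (\<phi> hs)" if "hs \<in> Z R" for hs
    proof -
      have "hs \<noteq> []" using that d by (auto simp: Z_def cube_lists_def)
      then show ?thesis by (cases hs) (simp_all add: \<phi>_def comp_def)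
    qed
    have "hd ` {hs \<in> Z R. \<phi> hs = gs} \<subseteq> S"
    proof safe
      fix hs assume hs: "hs \<in> Z R" "gs = \<phi> hs"
      have "P j (hd hs) = iter_diff (axis j 1 # hs) ?F 0" for j
        unfolding P_def hs(2) recover[OF hs(1), symmetric] ..
      then show "hd hs \<in> S" using hs(1) by (simp add: S_def Z_def)
    qed
    moreover have "inj_on hd {hs \<in> Z R. \<phi> hs = gs}"
    proof (rule inj_onI)
      fix hs hs' assume *: "hs \<in> {hs \<in> Z R. \<phi> hs = gs}" "hs' \<in> {hs \<in> Z R. \<phi> hs = gs}" "hd hs = hd hs'"
      then have "hs = hd hs # map (\<lambda>g. g + hd hs) gs" "hs' = hd hs' # map (\<lambda>g. g + hd hs') gs"
        using recover[of hs] recover[of hs'] by auto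
      then show "hs = hs'" using *(3) by simp
    qed
    ultimately have "card {hs \<in> Z R. \<phi> hs = gs} \<le> card S"
      using S(1) by (intro card_inj_on_le)
    with S(2) show ?thesis by simp
  qed
  have finZ: "finite (Z R)" for R
    unfolding Z_def by (rule finite_subset[OF _ finite_cube_lists[of R "d - 1"]]) auto
  show ?thesis
  \<comment> \<open>The base \<open>6\<close> is \<open>3 * 2\<close>: a cube of parameter
    \<open>2 * R\<close> has at most \<open>(3 * (2 * R)) ^ CARD('n)\<close> integral
    points.\<close>
  proof (rule that[of "real C * (6 ^ CARD('n)) ^ (d - 2)"])
    fix R :: real assume R: "1 \<le> R"
    have sub: "\<phi> ` Z R \<subseteq> cube_lists (2 * R) (d - 2)"
    proof
      fix gs assume "gs \<in> \<phi> ` Z R"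
      then obtain hs where hs: "hs \<in> Z R" "gs = \<phi> hs" by blast
      then have len: "length hs = d - 1" and set: "set hs \<subseteq> int_cube R" by (auto simp: Z_def cube_lists_def)
      have ne: "hs \<noteq> []" using len d by auto
      have "h - hd hs \<in> int_cube (2 * R)" if "h \<in> set (tl hs)" for h
      proof -
        have "h \<in> int_cube R" "hd hs \<in> int_cube R"
          using set that ne by (auto dest: list.set_sel)
        then have *: "real_of_int \<bar>h $ j\<bar> \<le> R" "real_of_int \<bar>hd hs $ j\<bar> \<le> R" for j
          by (auto simp: int_cube_def)
        have "real_of_int \<bar>h $ j - hd hs $ j\<bar> \<le> 2 * R" for j
          using *[of j] by linarith
        then show ?thesis by (simp add: int_cube_def)
      qed
      then show "gs \<in> cube_lists (2 * R) (d - 2)"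
        using len by (auto simp: hs(2) \<phi>_def cube_lists_def)
    qed
    have "card (Z R) \<le> C * card (\<phi> ` Z R)"
      by (rule card_le_mult_card_image[OF finZ fibre])
    also have "\<dots> \<le> C * card (cube_lists (2 * R) (d - 2) :: (int ^ 'n) list set)"
      by (intro mult_left_mono card_mono sub finite_cube_lists) auto
    finally have "real (card (Z R)) \<le> real C * real (card (int_cube (2 * R) :: (int ^ 'n) set)) ^ (d - 2)"
      unfolding card_cube_lists by (simp flip: of_nat_mult of_nat_power)
    also have "\<dots> \<le> real C * ((3 * (2 * R)) ^ CARD('n)) ^ (d - 2)"
      using R by (intro mult_left_mono power_mono card_int_cube_le) auto
    also have "\<dots> = real C * (6 ^ CARD('n)) ^ (d - 2) * (R ^ (d - 2)) ^ CARD('n)"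
      by (simp add: power_mult_distrib mult.commute flip: power_mult)
    finally show "real (card {hs \<in> cube_lists R (d - 1). \<forall>j. iter_diff (axis j 1 # hs) ?F 0 = 0})
      \<le> real C * (6 ^ CARD('n)) ^ (d - 2) * (R ^ (d - 2)) ^ CARD('n)"
      by (simp add: Z_def)
  qed simp
qed

subsection \<open>Weyl differencing\<close>

definition exp_sum :: "'v set \<Rightarrow> ('v \<Rightarrow> real) \<Rightarrow> complex" where
  "exp_sum X \<phi> = (\<Sum>x\<in>X. echar (\<phi> x))"

text \<open>Expand the square and substitute \<open>y = x + h\<close>; both points have coordinates
  of size at most \<open>N\<close>, so \<open>h\<close> has coordinates of size at most
  \<open>2 * N\<close>.\<close>

lemma norm_exp_sum_square_le:
  fixes X :: "(int ^ 'n::finite) set"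
  assumes X: "X \<subseteq> int_cube N"
  shows "(norm (exp_sum X \<phi>))\<^sup>2 \<le>
    (\<Sum>h\<in>int_cube (2 * N). norm (exp_sum {x \<in> X. x + h \<in> X} (\<lambda>x. \<phi> (x + h) - \<phi> x)))"
proof -
  let ?H = "int_cube (2 * N) :: (int ^ 'n) set"
  have finX: "finite X" by (rule finite_subset[OF X finite_int_cube])
  have H: "y - x \<in> ?H" if "x \<in> X" "y \<in> X" for x y
  proof -
    have *: "real_of_int \<bar>x $ j\<bar> \<le> N" "real_of_int \<bar>y $ j\<bar> \<le> N" for j
      using that X by (auto simp: int_cube_def)
    have "real_of_int \<bar>y $ j - x $ j\<bar> \<le> 2 * N" for j using *[of j] by linarith
    then show ?thesis by (simp add: int_cube_def)
  qed
  have shift: "(\<Sum>y\<in>X. echar (\<phi> y - \<phi> x)) = (\<Sum>h\<in>?H. if x + h \<in> X then echar (\<phi> (x + h) - \<phi> x) else 0)"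
    if x: "x \<in> X" for x
  proof -
    have "(\<Sum>y\<in>X. echar (\<phi> y - \<phi> x)) = (\<Sum>h\<in>{h \<in> ?H. x + h \<in> X}. echar (\<phi> (x + h) - \<phi> x))"
      by (rule sum.reindex_bij_witness[of _ "\<lambda>h. x + h" "\<lambda>y. y - x"]) (use H x in auto)
    then show ?thesis by (simp add: sum.inter_filter finite_int_cube)
  qed
  have "of_real ((norm (exp_sum X \<phi>))\<^sup>2) = cnj (exp_sum X \<phi>) * exp_sum X \<phi>"
    by (simp only: complex_norm_square of_real_power[symmetric] mult.commute)
  also have "\<dots> = (\<Sum>x\<in>X. \<Sum>y\<in>X. echar (\<phi> y - \<phi> x))"
    unfolding exp_sum_def cnj_sum sum_product echar_diff by (intro sum.cong refl) (rule mult.commute)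
  also have "\<dots> = (\<Sum>x\<in>X. \<Sum>h\<in>?H. if x + h \<in> X then echar (\<phi> (x + h) - \<phi> x) else 0)"
    by (rule sum.cong[OF refl]) (rule shift)
  also have "\<dots> = (\<Sum>h\<in>?H. \<Sum>x\<in>X. if x + h \<in> X then echar (\<phi> (x + h) - \<phi> x) else 0)"
    by (rule sum.swap)
  also have "\<dots> = (\<Sum>h\<in>?H. exp_sum {x \<in> X. x + h \<in> X} (\<lambda>x. \<phi> (x + h) - \<phi> x))"
    by (simp add: exp_sum_def sum.inter_filter finX)
  finally have "(norm (exp_sum X \<phi>))\<^sup>2 = norm (\<Sum>h\<in>?H. exp_sum {x \<in> X. x + h \<in> X} (\<lambda>x. \<phi> (x + h) - \<phi> x))"
    by (metis abs_of_nonneg norm_of_real zero_le_power2)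
  also have "\<dots> \<le> (\<Sum>h\<in>?H. norm (exp_sum {x \<in> X. x + h \<in> X} (\<lambda>x. \<phi> (x + h) - \<phi> x)))"
    by (rule norm_sum)
  finally show ?thesis .
qed

text \<open>The range on which all shifted points needed by the iterated difference stay in
  \<open>X\<close>.\<close>

definition diff_set :: "'v::ab_group_add set \<Rightarrow> 'v list \<Rightarrow> 'v set" where
  "diff_set X hs = foldl (\<lambda>Y h. {x \<in> Y. x + h \<in> Y}) X hs"

lemma diff_set_Nil [simp]: "diff_set X [] = X"
  by (simp add: diff_set_def)

lemma diff_set_snoc: "diff_set X (hs @ [h]) = {x \<in> diff_set X hs. x + h \<in> diff_set X hs}"
  by (simp add: diff_set_def)

lemma diff_set_subset: "diff_set X hs \<subseteq> X"
  by (induction hs rule: rev_induct) (auto simp: diff_set_snoc)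

lemma cube_lists_0 [simp]: "cube_lists R 0 = {[]}"
  by (auto simp: cube_lists_def)

lemma sum_cube_lists_Cons:
  "(\<Sum>hs\<in>cube_lists R (Suc m). f hs) = (\<Sum>h\<in>int_cube R. \<Sum>hs\<in>cube_lists R m. f (h # hs))"
proof -
  have "(\<Sum>hs\<in>cube_lists R (Suc m). f hs) = (\<Sum>p\<in>int_cube R \<times> cube_lists R m. f (fst p # snd p))"
    by (rule sum.reindex_bij_witness[of _ "\<lambda>p. fst p # snd p" "\<lambda>hs. (hd hs, tl hs)"])
      (auto simp: cube_lists_def length_Suc_conv)
  then show ?thesis by (simp add: sum.cartesian_product split_def)
qed

lemma sum_cube_lists_snoc:
  "(\<Sum>hs\<in>cube_lists R (Suc m). f hs) = (\<Sum>hs\<in>cube_lists R m. \<Sum>h\<in>int_cube R. f (hs @ [h]))"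
proof -
  have *: "butlast hs @ [last hs] = hs \<and> butlast hs \<in> cube_lists R m \<and> last hs \<in> int_cube R" if "hs \<in> cube_lists R (Suc m)" for hs
    using that by (cases hs rule: rev_cases) (auto simp: cube_lists_def)
  have **: "hs @ [h] \<in> cube_lists R (Suc m)" if "hs \<in> cube_lists R m" "h \<in> int_cube R" for hs h
    using that by (auto simp: cube_lists_def)
  have "(\<Sum>hs\<in>cube_lists R (Suc m). f hs) = (\<Sum>p\<in>cube_lists R m \<times> int_cube R. f (fst p @ [snd p]))"
    by (rule sum.reindex_bij_witness[of _ "\<lambda>p. fst p @ [snd p]" "\<lambda>hs. (butlast hs, last hs)"])
      (use * ** in \<open>auto intro!: arg_cong[where f = f]\<close>)
  then show ?thesis by (simp add: sum.cartesian_product split_def)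
qed

text \<open>Each step squares the bound, applies Cauchy-Schwarz to the sum over the lists so far,
  and differences once more.\<close>

theorem weyl_differencing:
  fixes X :: "(int ^ 'n::finite) set"
  assumes X: "X \<subseteq> int_cube N"
  shows "norm (exp_sum X \<phi>) ^ 2 ^ m \<le> real (card (int_cube (2 * N) :: (int ^ 'n) set)) ^ (2 ^ m - 1 - m) *
    (\<Sum>hs\<in>cube_lists (2 * N) m. norm (exp_sum (diff_set X hs) (iter_diff hs \<phi>)))"
proof (induction m)
  case (Suc m)
  let ?V = "real (card (int_cube (2 * N) :: (int ^ 'n) set))"
  let ?L = "cube_lists (2 * N) m :: (int ^ 'n) list set"
  let ?e = "2 ^ m - 1 - m"
  have "norm (exp_sum X \<phi>) ^ 2 ^ Suc m = (norm (exp_sum X \<phi>) ^ 2 ^ m)\<^sup>2"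
    by (simp add: power_mult[symmetric] mult.commute)
  also have "\<dots> \<le> (?V ^ ?e * (\<Sum>hs\<in>?L. norm (exp_sum (diff_set X hs) (iter_diff hs \<phi>))))\<^sup>2"
    by (intro power_mono Suc.IH) simp
  also have "\<dots> = ?V ^ (2 * ?e) * (\<Sum>hs\<in>?L. norm (exp_sum (diff_set X hs) (iter_diff hs \<phi>)))\<^sup>2"
    by (simp add: power_mult_distrib power_mult[symmetric] mult.commute)
  also have "\<dots> \<le> ?V ^ (2 * ?e) * ((\<Sum>hs\<in>?L. (norm (exp_sum (diff_set X hs) (iter_diff hs \<phi>)))\<^sup>2) * real (card ?L))"
    by (intro mult_left_mono sum_squared_le_sum_of_squares) auto
  also have "\<dots> \<le> ?V ^ (2 * ?e) * ((\<Sum>hs\<in>cube_lists (2 * N) (Suc m). norm (exp_sum (diff_set X hs) (iter_diff hs \<phi>))) * real (card ?L))"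
  proof (intro mult_left_mono mult_right_mono)
    show "(\<Sum>hs\<in>?L. (norm (exp_sum (diff_set X hs) (iter_diff hs \<phi>)))\<^sup>2)
      \<le> (\<Sum>hs\<in>cube_lists (2 * N) (Suc m). norm (exp_sum (diff_set X hs) (iter_diff hs \<phi>)))"
      unfolding sum_cube_lists_snoc diff_set_snoc iter_diff_snoc
      by (intro sum_mono norm_exp_sum_square_le order.trans[OF diff_set_subset X])
  qed auto
  \<comment> \<open>Squaring doubles the exponent and Cauchy-Schwarz adds the number
    \<open>?V ^ m\<close> of lists.\<close>
  also have "\<dots> = ?V ^ (2 * ?e + m) * (\<Sum>hs\<in>cube_lists (2 * N) (Suc m). norm (exp_sum (diff_set X hs) (iter_diff hs \<phi>)))"
    by (simp add: card_cube_lists power_add)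
  also have "2 * ?e + m = 2 ^ Suc m - 1 - Suc m"
  proof -
    have "m < 2 ^ m" by simp
    then show ?thesis unfolding power_Suc by linarith
  qed
  finally show ?case .
qed simp

subsection \<open>Linear exponential sums\<close>

definition int_box :: "int ^ 'n \<Rightarrow> int ^ 'n \<Rightarrow> (int ^ 'n) set" where
  "int_box l u = {x. \<forall>j. l $ j \<le> x $ j \<and> x $ j \<le> u $ j}"

text \<open>A box and its translate meet in a box, possibly empty; hence the differenced sums still
  factor over the coordinates.\<close>

lemma diff_set_int_box:
  "\<exists>l' u'. diff_set (int_box l u) hs = int_box l' (u' :: int ^ 'n::finite)"
proof (induction hs rule: rev_induct)
  case (snoc h hs)
  then obtain l' u' where *: "diff_set (int_box l u) hs = int_box l' u'" by blast
  have "diff_set (int_box l u) (hs @ [h]) = int_box (\<chi> j. max (l' $ j) (l' $ j - h $ j)) (\<chi> j. min (u' $ j) (u' $ j - h $ j))"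
    unfolding diff_set_snoc * by (auto simp: int_box_def algebra_simps)
  then show ?case by blast
qed auto

text \<open>The index of the arc of length \<open>1 / K\<close> on the circle that contains
  \<open>t\<close>.\<close>

definition spacing :: "nat \<Rightarrow> real \<Rightarrow> nat" where
  "spacing K t = nat \<lfloor>real K * frac t\<rfloor>"

text \<open>The two terms are the inverse distances, in units of \<open>1 / K\<close>, from the arc
  \<open>r\<close> to the two ends of the unit interval; their sum serves in place of the distance
  to the nearest integer.\<close>

definition weight :: "nat \<Rightarrow> nat \<Rightarrow> real" where
  "weight K r = 2 * real K * (1 / (real r + 1) + 1 / (real K - real r))"

lemma spacing_less: "0 < K \<Longrightarrow> spacing K t < K"
proof -
  assume K: "0 < K"
  then have "real K * frac t < real K * 1" by (intro mult_strict_left_mono frac_lt_1) simp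
  then have "\<lfloor>real K * frac t\<rfloor> < int K" by (simp add: floor_less_iff)
  moreover have "0 \<le> \<lfloor>real K * frac t\<rfloor>" by simp
  ultimately show ?thesis by (simp add: spacing_def nat_less_iff)
qed

lemma spacing_bounds:
  "real (spacing K t) \<le> real K * frac t" "real K * frac t < real (spacing K t) + 1"
proof -
  have "0 \<le> \<lfloor>real K * frac t\<rfloor>" by simp
  then have "real (spacing K t) = of_int \<lfloor>real K * frac t\<rfloor>" by (simp add: spacing_def)
  then show "real (spacing K t) \<le> real K * frac t" "real K * frac t < real (spacing K t) + 1"
    by linarith+
qed

lemma weight_nonneg: "r < K \<Longrightarrow> 0 \<le> weight K r"
  by (simp add: weight_def)

text \<open>The geometric series gives the inverse distance to the nearest integer, and the trivial
  bound \<open>K\<close> supplies the \<open>+ 1\<close> that keeps the arcs next to an integer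
  finite.\<close>

lemma norm_geometric_echar_le:
  assumes K: "0 < K" "n \<le> K"
  shows "norm (\<Sum>i<n. echar t ^ i) \<le> weight K (spacing K t)"
proof -
  define S where "S = (\<Sum>i<n. echar t ^ i)"
  define r where "r = real (spacing K t)"
  have r: "0 \<le> r" "r < real K" "r \<le> real K * frac t" "real K * frac t < r + 1"
    using spacing_less[OF K(1), of t] spacing_bounds[of K t] by (auto simp: r_def)
  have "norm S \<le> (\<Sum>i<n. norm (echar t ^ i))" unfolding S_def by (rule norm_sum)
  then have triv: "norm S \<le> real K" using K by (simp add: norm_power)
  have "(echar t - 1) * S = echar t ^ n - 1"
    unfolding S_def by (rule power_diff_1_eq[symmetric])
  then have "norm (echar t - 1) * norm S = norm (echar t ^ n - 1)" by (simp flip: norm_mult)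
  also have "\<dots> \<le> norm (echar t ^ n) + norm (1::complex)" by (rule norm_triangle_ineq4)
  finally have geo: "norm (echar t - 1) * norm S \<le> 2" by (simp add: norm_power)
  have e_frac: "echar t = echar (frac t)" "echar t = echar (frac t - 1)"
    using echar_add_of_int[of "frac t" "\<lfloor>t\<rfloor>"] echar_add_of_int[of "frac t - 1" "\<lfloor>t\<rfloor> + 1"]
    by (simp_all add: frac_def)
  have case_bound: "(s + 1) * norm S \<le> 2 * real K"
    if s: "0 \<le> s" "s \<le> real K * z" and z: "3 * z \<le> norm (echar t - 1)" for s z
  proof -
    have "3 * (s * norm S) \<le> 3 * (real K * z * norm S)"
      using s by (intro mult_left_mono mult_right_mono) auto
    also have "\<dots> = real K * ((3 * z) * norm S)" by simp
    also have "\<dots> \<le> real K * (norm (echar t - 1) * norm S)"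
      using z by (intro mult_left_mono mult_right_mono) auto
    also have "\<dots> \<le> real K * 2" using geo by (intro mult_left_mono) auto
    finally show ?thesis using triv by (simp add: distrib_right)
  qed
  have "norm S \<le> weight K (spacing K t)"
  proof (cases "frac t \<le> 1 / 2")
    case True
    have "3 * frac t \<le> norm (echar t - 1)"
      using norm_echar_minus_1_ge[of "frac t"] True e_frac(1) by simp
    from case_bound[OF r(1) r(3) this] have "norm S \<le> 2 * real K * (1 / (r + 1))"
      using r by (simp add: pos_le_divide_eq mult.commute)
    also have "\<dots> \<le> weight K (spacing K t)"
      unfolding weight_def r_def[symmetric] using r by (intro mult_left_mono) auto
    finally show ?thesis .
  next
    case False
    have z: "3 * (1 - frac t) \<le> norm (echar t - 1)"
      using norm_echar_minus_1_ge[of "frac t - 1"] False e_frac(2) frac_lt_1[of t] by simp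
    have "r + 1 \<le> real K" using r(2) by (simp add: r_def)
    then have "(real K - r - 1 + 1) * norm S \<le> 2 * real K"
      using r(4) by (intro case_bound[OF _ _ z]) (auto simp: right_diff_distrib)
    then have "norm S \<le> 2 * real K * (1 / (real K - r))"
      using r by (simp add: pos_le_divide_eq mult.commute)
    also have "\<dots> \<le> weight K (spacing K t)"
      unfolding weight_def r_def[symmetric] using r by (intro mult_left_mono) auto
    finally show ?thesis .
  qed
  then show ?thesis by (simp add: S_def)
qed

lemma norm_interval_echar_le:
  assumes K: "0 < K" "b - a + 1 \<le> int K"
  shows "norm (\<Sum>x\<in>{a..b}. echar (t * of_int x)) \<le> weight K (spacing K t)"
proof -
  define n where "n = nat (b - a + 1)"
  have "(\<Sum>x\<in>{a..b}. echar (t * of_int x)) = (\<Sum>i<n. echar (t * of_int (a + int i)))"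
    by (rule sum.reindex_bij_witness[of _ "\<lambda>i. a + int i" "\<lambda>x. nat (x - a)"]) (auto simp: n_def)
  also have "\<dots> = (\<Sum>i<n. echar (t * of_int a) * echar t ^ i)"
    by (simp add: distrib_left echar_add flip: echar_of_nat_mult) (simp add: mult.commute)
  also have "norm \<dots> = norm (\<Sum>i<n. echar t ^ i)"
    by (simp add: norm_mult flip: sum_distrib_left)
  also have "\<dots> \<le> weight K (spacing K t)"
    using K by (intro norm_geometric_echar_le) (auto simp: n_def)
  finally show ?thesis .
qed

lemma echar_sum: "finite I \<Longrightarrow> echar (sum f I) = (\<Prod>i\<in>I. echar (f i))"
  by (induction I rule: finite_induct) (auto simp: echar_add)

lemma int_box_eq: "int_box l u = vec_lambda ` PiE UNIV (\<lambda>j. {l $ j..u $ j})"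
proof
  show "int_box l u \<subseteq> vec_lambda ` PiE UNIV (\<lambda>j. {l $ j..u $ j})"
    by (auto simp: int_box_def intro!: image_eqI[of _ _ "vec_nth _"])
qed (auto simp: int_box_def)

text \<open>The sum over a box is a product of geometric sums, and a side inside the cube has at
  most \<open>2 * N + 1\<close> integral points.\<close>

lemma norm_exp_sum_linear_le:
  fixes l u :: "int ^ 'n::finite"
  assumes box: "int_box l u \<subseteq> int_cube (real N)"
  shows "norm (exp_sum (int_box l u) (\<lambda>x. c + (\<Sum>j\<in>UNIV. b j * of_int (x $ j))))
    \<le> (\<Prod>j\<in>UNIV. weight (2 * N + 1) (spacing (2 * N + 1) (b j)))"
proof (cases "\<forall>j. l $ j \<le> u $ j")
  case False
  then obtain j where "u $ j < l $ j" by (auto simp: not_le)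
  then have "int_box l u = {}" by (auto simp: int_box_def intro!: exI[of _ j])
  then show ?thesis by (simp add: exp_sum_def prod_nonneg weight_nonneg spacing_less)
next
  case True
  then have "l \<in> int_box l u" "u \<in> int_box l u" by (auto simp: int_box_def)
  then have "l \<in> int_cube (real N)" "u \<in> int_cube (real N)" using box by auto
  then have lu: "u $ j - l $ j + 1 \<le> int (2 * N + 1)" for j
    by (auto simp: int_cube_def dest!: spec[of _ j])
  have "exp_sum (int_box l u) (\<lambda>x. c + (\<Sum>j\<in>UNIV. b j * of_int (x $ j)))
      = (\<Sum>x\<in>PiE UNIV (\<lambda>j. {l $ j..u $ j}). echar c * (\<Prod>j\<in>UNIV. echar (b j * of_int (x j))))"
    unfolding exp_sum_def int_box_eq
    by (subst sum.reindex) (auto simp: inj_on_def vec_lambda_inject echar_add echar_sum)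
  also have "\<dots> = echar c * (\<Prod>j\<in>UNIV. \<Sum>x\<in>{l $ j..u $ j}. echar (b j * of_int x))"
    by (simp add: prod_sum_PiE sum_distrib_left)
  also have "norm \<dots> = (\<Prod>j\<in>UNIV. norm (\<Sum>x\<in>{l $ j..u $ j}. echar (b j * of_int x)))"
    by (simp add: norm_mult prod_norm)
  also have "\<dots> \<le> (\<Prod>j\<in>UNIV. weight (2 * N + 1) (spacing (2 * N + 1) (b j)))"
    using lu by (intro prod_mono conjI norm_interval_echar_le) auto
  finally show ?thesis .
qed

lemma sum_weight_le:
  assumes "0 < K"
  shows "(\<Sum>r<K. weight K r) \<le> 4 * real K * (1 + ln (real K))"
proof -
  have harm: "(\<Sum>r<K. 1 / (real r + 1)) \<le> 1 + ln (real K)"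
    using assms
  proof (induction K rule: nat_induct_non_zero)
    case (Suc K)
    have "ln (real K / real (Suc K)) \<le> real K / real (Suc K) - 1"
      using Suc.hyps by (intro ln_le_minus_one) simp
    also have "\<dots> = - (1 / (real K + 1))" by (simp add: field_simps)
    finally have "1 / (real K + 1) \<le> ln (real (Suc K)) - ln (real K)"
      using Suc.hyps by (simp add: ln_div)
    then show ?case using Suc.IH by simp
  qed simp
  have "(\<Sum>r<K. 1 / (real K - real r)) = (\<Sum>r<K. 1 / (real r + 1))"
    by (rule sum.reindex_bij_witness[of _ "\<lambda>r. K - 1 - r" "\<lambda>r. K - 1 - r"]) (auto simp: of_nat_diff)
  then have "(\<Sum>r<K. weight K r) = 2 * real K * (2 * (\<Sum>r<K. 1 / (real r + 1)))"
    unfolding weight_def by (simp add: sum_distrib_left[symmetric] sum.distrib)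
  also have "\<dots> \<le> 2 * real K * (2 * (1 + ln (real K)))"
    using harm by (intro mult_left_mono) auto
  finally show ?thesis by (simp add: algebra_simps)
qed

text \<open>If two vectors \<open>h\<close> fall into the same arc for every \<open>j\<close>, their
  difference has size at most \<open>4 * N\<close> and its image under \<open>g\<close> is within
  \<open>1 / K\<close> of an integral vector. So each cell contains at most as many \<open>h\<close>
  as there are near pairs, and the weights summed over all cells factorise.\<close>

lemma sum_weight_spacing_le:
  fixes g :: "'n::finite \<Rightarrow> 'n \<Rightarrow> real" and N :: nat
  defines "K \<equiv> 2 * N + 1"
  shows "(\<Sum>h\<in>int_cube (2 * real N). \<Prod>j\<in>UNIV. weight K (spacing K (\<Sum>i\<in>UNIV. g j i * of_int (h $ i))))
    \<le> (4 * real K * (1 + ln (real K))) ^ CARD('n) * real (card (near_pairs g (4 * real N) (1 / real K)))"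
proof -
  let ?H = "int_cube (2 * real N) :: (int ^ 'n) set"
  have K: "0 < K" by (simp add: K_def)
  define t where "t h j = (\<Sum>i\<in>UNIV. g j i * of_int (h $ i))" for h :: "int ^ 'n" and j
  define \<rho> where "\<rho> h j = spacing K (t h j)" for h j
  define R where "R = PiE (UNIV :: 'n set) (\<lambda>_. {..<K})"
  have finR: "finite R" unfolding R_def by (intro finite_PiE) auto
  have \<rho>R: "\<rho> ` ?H \<subseteq> R" by (auto simp: R_def \<rho>_def spacing_less[OF K])
  have fibre: "card {h \<in> ?H. \<rho> h = r} \<le> card (near_pairs g (4 * real N) (1 / real K))" for r
  proof (cases "{h \<in> ?H. \<rho> h = r} = {}")
    case False
    then obtain h0 where h0: "h0 \<in> ?H" "\<rho> h0 = r" by blast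
    define \<psi> where "\<psi> h = (h - h0, (\<chi> j. \<lfloor>t h j\<rfloor> - \<lfloor>t h0 j\<rfloor>) :: int ^ 'n)" for h
    have "\<psi> h \<in> near_pairs g (4 * real N) (1 / real K)" if h: "h \<in> ?H" "\<rho> h = r" for h
    proof -
      have *: "real_of_int \<bar>h $ j\<bar> \<le> 2 * real N" "real_of_int \<bar>h0 $ j\<bar> \<le> 2 * real N" for j
        using h(1) h0(1) by (auto simp: int_cube_def)
      have 1: "real_of_int \<bar>h $ j - h0 $ j\<bar> \<le> 4 * real N" for j using *[of j] by linarith
      have 2: "\<bar>(t h j - t h0 j) - of_int (\<lfloor>t h j\<rfloor> - \<lfloor>t h0 j\<rfloor>)\<bar> \<le> 1 / real K" for j
      proof -
        have eq: "spacing K (t h j) = spacing K (t h0 j)"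
          using h(2) h0(2) by (metis \<rho>_def)
        have "\<bar>real K * frac (t h j) - real K * frac (t h0 j)\<bar> \<le> 1"
          using spacing_bounds[of K "t h j"] spacing_bounds[of K "t h0 j"] unfolding eq by linarith
        moreover have "real K * frac (t h j) - real K * frac (t h0 j)
            = real K * ((t h j - t h0 j) - of_int (\<lfloor>t h j\<rfloor> - \<lfloor>t h0 j\<rfloor>))"
          by (simp add: frac_def algebra_simps)
        ultimately have "real K * \<bar>(t h j - t h0 j) - of_int (\<lfloor>t h j\<rfloor> - \<lfloor>t h0 j\<rfloor>)\<bar> \<le> 1"
          by (simp add: abs_mult)
        then show ?thesis using K by (simp add: pos_le_divide_eq mult.commute)
      qed
      have "t h j - t h0 j = (\<Sum>i\<in>UNIV. g j i * of_int ((h - h0) $ i))" for j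
        by (simp add: t_def sum_subtractf right_diff_distrib)
      with 1 2 show ?thesis by (simp add: \<psi>_def near_pairs_def)
    qed
    then have "\<psi> ` {h \<in> ?H. \<rho> h = r} \<subseteq> near_pairs g (4 * real N) (1 / real K)" by auto
    then show ?thesis
      by (intro card_inj_on_le[of \<psi>] finite_near_pairs) (auto simp: inj_on_def \<psi>_def)
  next
    case True
    then show ?thesis by (simp only: card.empty)
  qed
  define w where "w r = (\<Prod>j\<in>UNIV. weight K (r j))" for r :: "'n \<Rightarrow> nat"
  have w: "0 \<le> w r" if "r \<in> R" for r
    using that unfolding w_def R_def by (intro prod_nonneg weight_nonneg) auto
  have "(\<Sum>h\<in>?H. w (\<rho> h)) = (\<Sum>r\<in>R. \<Sum>h\<in>{h \<in> ?H. \<rho> h = r}. w (\<rho> h))"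
    by (rule sum.group[OF finite_int_cube finR \<rho>R, symmetric])
  also have "\<dots> = (\<Sum>r\<in>R. w r * real (card {h \<in> ?H. \<rho> h = r}))"
    by (rule sum.cong) (simp_all add: mult.commute)
  also have "\<dots> \<le> (\<Sum>r\<in>R. w r * real (card (near_pairs g (4 * real N) (1 / real K))))"
    using fibre w by (intro sum_mono mult_left_mono) auto
  also have "\<dots> = (\<Prod>j\<in>(UNIV :: 'n set). \<Sum>r<K. weight K r) * real (card (near_pairs g (4 * real N) (1 / real K)))"
    unfolding w_def R_def by (subst prod_sum_PiE) (simp_all add: sum_distrib_right)
  also have "\<dots> \<le> (4 * real K * (1 + ln (real K))) ^ CARD('n) * real (card (near_pairs g (4 * real N) (1 / real K)))"
    using sum_weight_le[OF K]
    by (intro mult_right_mono) (auto intro!: power_mono sum_nonneg weight_nonneg)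
  finally show ?thesis by (simp add: w_def \<rho>_def t_def)
qed

subsection \<open>Weyl's inequality for smooth forms\<close>

text \<open>The matrix of the bilinear form left when \<open>d - 2\<close> arguments of the polar
  form are fixed. Its symmetry is what Davenport's lemma requires.\<close>

definition polar_matrix :: "real \<Rightarrow> (int ^ 'n::finite \<Rightarrow> int) \<Rightarrow> (int ^ 'n) list \<Rightarrow> 'n \<Rightarrow> 'n \<Rightarrow> real" where
  "polar_matrix \<alpha> F ys j i = \<alpha> * of_int (iter_diff (axis j 1 # axis i 1 # ys) F 0)"

lemma iter_diff_swap: "iter_diff (a # b # ys) F = iter_diff (b # a # ys) F"
  using iter_diff_middle[of "[a]" b ys F] by simp

lemma polar_matrix_sym: "polar_matrix \<alpha> F ys j i = polar_matrix \<alpha> F ys i j"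
  by (simp add: polar_matrix_def iter_diff_swap[of "axis j 1"])

lemma polar_matrix_apply:
  assumes F: "poly_below (Suc d) F" and ys: "length ys + 2 = d"
  shows "(\<Sum>i\<in>UNIV. polar_matrix \<alpha> F ys j i * of_int (h $ i)) = \<alpha> * of_int (iter_diff (axis j 1 # h # ys) F 0)"
proof -
  define A where "A = iter_diff (axis j 1 # ys) F"
  have "poly_below 2 A"
    unfolding A_def by (rule poly_below_iter_diff) (use assms in simp)
  from poly_below_2_affine[OF this, of h]
  have A: "A h - A 0 = (\<Sum>i\<in>UNIV. (A (axis i 1) - A 0) * h $ i)" by simp
  have "iter_diff (axis j 1 # x # ys) F 0 = A x - A 0" for x
    unfolding iter_diff_swap[of "axis j 1"] iter_diff_Cons'[of x] by (simp add: A_def)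
  then show ?thesis by (simp add: polar_matrix_def A sum_distrib_left mult.assoc)
qed

text \<open>After \<open>d - 1\<close> differences the phase is affine, with the polar form at the
  unit vectors as its slopes. Summing over one of the \<open>d - 1\<close> shifts with the others
  fixed brings in the near pairs of the polar matrix.\<close>

lemma weyl_counting_bound:
  fixes F :: "int ^ 'n::finite \<Rightarrow> int" and N :: nat
  defines "K \<equiv> 2 * N + 1"
  assumes F: "poly_below (Suc d) F" and d: "2 \<le> d" and box: "int_box l u \<subseteq> int_cube (real N)"
  shows "norm (exp_sum (int_box l u) (\<lambda>x. \<alpha> * of_int (F x))) ^ 2 ^ (d - 1) \<le>
    real (card (int_cube (2 * real N) :: (int ^ 'n) set)) ^ (2 ^ (d - 1) - d) * (4 * real K * (1 + ln (real K))) ^ CARD('n) *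
    (\<Sum>ys\<in>cube_lists (2 * real N) (d - 2). real (card (near_pairs (polar_matrix \<alpha> F ys) (4 * real N) (1 / real K))))"
proof -
  let ?V = "real (card (int_cube (2 * real N) :: (int ^ 'n) set))"
  let ?E = "\<lambda>hs. norm (exp_sum (diff_set (int_box l u) hs) (iter_diff hs (\<lambda>x. \<alpha> * of_int (F x))))"
  define W where "W hs = (\<Prod>j\<in>UNIV. weight K (spacing K (\<alpha> * of_int (iter_diff (axis j 1 # hs) F 0))))" for hs
  have E_le: "?E hs \<le> W hs" if hs: "hs \<in> cube_lists (2 * real N) (d - 1)" for hs
  proof -
    define G where "G = iter_diff hs F"
    have "poly_below 2 G"
      unfolding G_def by (rule poly_below_iter_diff) (use F hs d in \<open>simp add: cube_lists_def\<close>)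
    then have G: "G x = G 0 + (\<Sum>j\<in>UNIV. (G (axis j 1) - G 0) * x $ j)" for x
      by (rule poly_below_2_affine)
    have GW: "G (axis j 1) - G 0 = iter_diff (axis j 1 # hs) F 0" for j
      unfolding iter_diff_Cons' by (simp add: G_def)
    have "iter_diff hs (\<lambda>x. \<alpha> * of_int (F x)) x = \<alpha> * of_int (G x)" for x
      unfolding G_def by (rule iter_diff_additive) (simp add: right_diff_distrib)
    also have "\<alpha> * of_int (G x) = \<alpha> * of_int (G 0) + (\<Sum>j\<in>UNIV. (\<alpha> * of_int (iter_diff (axis j 1 # hs) F 0)) * of_int (x $ j))" for x
      unfolding GW[symmetric] by (subst G) (simp add: distrib_left sum_distrib_left mult.assoc)
    finally have eq: "iter_diff hs (\<lambda>x. \<alpha> * of_int (F x)) =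
      (\<lambda>x. \<alpha> * of_int (G 0) + (\<Sum>j\<in>UNIV. (\<alpha> * of_int (iter_diff (axis j 1 # hs) F 0)) * of_int (x $ j)))" by blast
    obtain l' u' where lu: "diff_set (int_box l u) hs = int_box l' u'" using diff_set_int_box by blast
    have "int_box l' u' \<subseteq> int_cube (real N)" using diff_set_subset[of "int_box l u" hs] box lu by simp
    from norm_exp_sum_linear_le[OF this] show ?thesis
      unfolding eq lu W_def K_def .
  qed
  have "norm (exp_sum (int_box l u) (\<lambda>x. \<alpha> * of_int (F x))) ^ 2 ^ (d - 1)
      \<le> ?V ^ (2 ^ (d - 1) - 1 - (d - 1)) * (\<Sum>hs\<in>cube_lists (2 * real N) (d - 1). ?E hs)"
    by (rule weyl_differencing[OF box])
  also have "2 ^ (d - 1) - 1 - (d - 1) = 2 ^ (d - 1) - d" using d by simp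
  also have "?V ^ (2 ^ (d - 1) - d) * (\<Sum>hs\<in>cube_lists (2 * real N) (d - 1). ?E hs)
      \<le> ?V ^ (2 ^ (d - 1) - d) * (\<Sum>hs\<in>cube_lists (2 * real N) (d - 1). W hs)"
    by (intro mult_left_mono sum_mono E_le) auto
  also have "(\<Sum>hs\<in>cube_lists (2 * real N) (d - 1). W hs)
      = (\<Sum>ys\<in>cube_lists (2 * real N) (d - 2). \<Sum>h\<in>int_cube (2 * real N). W (h # ys))"
  proof -
    have "d - 1 = Suc (d - 2)" using d by simp
    then show ?thesis by (simp only: sum_cube_lists_Cons) (rule sum.swap)
  qed
  also have "\<dots> \<le> (\<Sum>ys\<in>cube_lists (2 * real N) (d - 2). (4 * real K * (1 + ln (real K))) ^ CARD('n)
      * real (card (near_pairs (polar_matrix \<alpha> F ys) (4 * real N) (1 / real K))))"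
  proof (rule sum_mono)
    fix ys :: "(int ^ 'n) list" assume ys: "ys \<in> cube_lists (2 * real N) (d - 2)"
    then have len: "length ys + 2 = d" using d by (simp add: cube_lists_def)
    show "(\<Sum>h\<in>int_cube (2 * real N). W (h # ys)) \<le> (4 * real K * (1 + ln (real K))) ^ CARD('n)
      * real (card (near_pairs (polar_matrix \<alpha> F ys) (4 * real N) (1 / real K)))"
      using sum_weight_spacing_le[of N "polar_matrix \<alpha> F ys"]
      unfolding W_def K_def polar_matrix_apply[OF F len] .
  qed
  also have "\<dots> = (4 * real K * (1 + ln (real K))) ^ CARD('n) * (\<Sum>ys\<in>cube_lists (2 * real N) (d - 2).
      real (card (near_pairs (polar_matrix \<alpha> F ys) (4 * real N) (1 / real K))))"
    by (rule sum_distrib_left[symmetric])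
  finally show ?thesis by (simp add: mult_left_mono mult.assoc)
qed

text \<open>The fibre of \<open>near_pairs\<close> over its first component, written so that all
  \<open>d - 1\<close> arguments play the same role and can be interchanged.\<close>

definition near_int_vecs :: "real \<Rightarrow> real \<Rightarrow> (int ^ 'n::finite \<Rightarrow> int) \<Rightarrow> (int ^ 'n) list \<Rightarrow> (int ^ 'n) set" where
  "near_int_vecs \<tau> \<alpha> F hs = {v. \<forall>j. \<bar>\<alpha> * of_int (iter_diff (axis j 1 # hs) F 0) - of_int (v $ j)\<bar> \<le> \<tau>}"

lemma card_near_pairs_polar:
  assumes F: "poly_below (Suc d) F" and ys: "length ys + 2 = d"
  shows "card (near_pairs (polar_matrix \<alpha> F ys) A \<tau>) = (\<Sum>u\<in>int_cube A. card (near_int_vecs \<tau> \<alpha> F (u # ys)))"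
proof -
  have eq: "near_pairs (polar_matrix \<alpha> F ys) A \<tau> = Sigma (int_cube A) (\<lambda>u. near_int_vecs \<tau> \<alpha> F (u # ys))"
    unfolding near_pairs_def near_int_vecs_def int_cube_def polar_matrix_apply[OF F ys] by auto
  have "finite (near_int_vecs \<tau> \<alpha> F (u # ys))" if "u \<in> int_cube A" for u
  proof (rule finite_subset)
    show "near_int_vecs \<tau> \<alpha> F (u # ys) \<subseteq> snd ` near_pairs (polar_matrix \<alpha> F ys) A \<tau>"
      unfolding eq using that by force
  qed (intro finite_imageI finite_near_pairs)
  then show ?thesis unfolding eq by (intro card_SigmaI finite_int_cube) auto
qed

lemma near_int_vecs_middle: "near_int_vecs \<tau> \<alpha> F (xs @ y # ys) = near_int_vecs \<tau> \<alpha> F (y # xs @ ys)"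
proof -
  have "iter_diff (a # xs @ y # ys) F = iter_diff (a # y # xs @ ys) F" for a
    using iter_diff_middle[of "a # xs" y ys F] iter_diff_swap[of y a "xs @ ys" F] by simp
  then show ?thesis by (simp add: near_int_vecs_def)
qed

lemma near_pairs_mono: "\<tau> \<le> \<tau>' \<Longrightarrow> near_pairs g A \<tau> \<subseteq> near_pairs g A \<tau>'"
  unfolding near_pairs_def by (auto intro: order.trans)

text \<open>Davenport's lemma shrinks the argument in which the matrix acts; by symmetry any other
  argument can take its place next. Each of the \<open>d - 1\<close> rounds multiplies the tolerance
  by \<open>A' / A\<close> and costs a factor \<open>C * (A / A') ^ CARD('n)\<close>.\<close>

theorem polar_shrinking:
  obtains C where "1 \<le> C" "\<And>(F :: int ^ 'n::finite \<Rightarrow> int) d \<alpha> A A' \<tau>. poly_below (Suc d) F \<Longrightarrow> 2 \<le> d \<Longrightarrow>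
     0 < \<tau> \<Longrightarrow> 0 < A' \<Longrightarrow> A' \<le> A \<Longrightarrow> A * \<tau> \<le> 4 \<Longrightarrow>
     (\<Sum>ys\<in>cube_lists A (d - 2). real (card (near_pairs (polar_matrix \<alpha> F ys) A \<tau>))) \<le>
     (C * (A / A') ^ CARD('n)) ^ (d - 1) *
       (\<Sum>xs\<in>cube_lists A' (d - 2). real (card (near_pairs (polar_matrix \<alpha> F xs) A' (\<tau> * (A' / A) ^ (d - 1)))))"
proof -
  obtain C where C: "1 \<le> C" "\<And>(g :: 'n \<Rightarrow> 'n \<Rightarrow> real) A A' \<tau>. (\<And>i j. g i j = g j i) \<Longrightarrow>
    0 < \<tau> \<Longrightarrow> 0 < A' \<Longrightarrow> A' \<le> A \<Longrightarrow> A * \<tau> \<le> 4 \<Longrightarrow>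
    real (card (near_pairs g A \<tau>)) \<le> C * (A / A') ^ CARD('n) * real (card (near_pairs g A' (\<tau> * (A' / A))))"
    using davenport_shrinking[of 4] by blast
  show ?thesis
  proof (rule that[OF C(1)])
    fix F :: "int ^ 'n \<Rightarrow> int" and d :: nat and \<alpha> A A' \<tau> :: real
    assume F: "poly_below (Suc d) F" and d: "2 \<le> d" and \<tau>: "0 < \<tau>" and A': "0 < A'" "A' \<le> A" and A\<tau>: "A * \<tau> \<le> 4"
    define q where "q = A' / A"
    have q: "0 < q" "q \<le> 1" using A' by (auto simp: q_def)
    define D where "D = C * (A / A') ^ CARD('n)"
    have "1 * 1 \<le> D" unfolding D_def using C(1) A' by (intro mult_mono one_le_power) auto
    then have D: "0 \<le> D" by simp
    define P where "P ys = polar_matrix \<alpha> F ys" for ys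
    have shrink: "real (card (near_pairs (P ys) A (\<tau> * q ^ s))) \<le> D * real (card (near_pairs (P ys) A' (\<tau> * q ^ Suc s)))" for ys s
    proof -
      have "A * (\<tau> * q ^ s) \<le> A * (\<tau> * 1)"
        using A' \<tau> q by (intro mult_left_mono power_le_one) auto
      with A\<tau> have "A * (\<tau> * q ^ s) \<le> 4" by simp
      from C(2)[OF _ _ A' this, of "P ys"] show ?thesis
        using \<tau> q polar_matrix_sym[of \<alpha> F ys] unfolding P_def D_def by (simp add: q_def mult_ac)
    qed
    \<comment> \<open>The state after \<open>s\<close> rounds: \<open>s\<close> arguments already
      lie in the small cube, \<open>m\<close> are still in the large one, and one more large
      argument sits inside \<open>near_pairs\<close>.\<close>
    define T where "T s m = (\<Sum>xs\<in>cube_lists A' s. \<Sum>ys\<in>cube_lists A m. real (card (near_pairs (P (xs @ ys)) A (\<tau> * q ^ s))))" for s m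
    have card_P: "card (near_pairs (P ys) B \<sigma>) = (\<Sum>u\<in>int_cube B. card (near_int_vecs \<sigma> \<alpha> F (u # ys)))"
      if "length ys + 2 = d" for ys B \<sigma>
      unfolding P_def by (rule card_near_pairs_polar[OF F that])
    have step: "T s (Suc m) \<le> D * T (Suc s) m" if sm: "s + Suc m + 2 = d" for s m
    proof -
      let ?\<sigma> = "\<tau> * q ^ Suc s"
      let ?c = "\<lambda>hs. card (near_int_vecs ?\<sigma> \<alpha> F hs)"
      have "T s (Suc m) \<le> (\<Sum>xs\<in>cube_lists A' s. \<Sum>ys\<in>cube_lists A (Suc m). D * real (card (near_pairs (P (xs @ ys)) A' ?\<sigma>)))"
        unfolding T_def by (intro sum_mono shrink)
      also have "\<dots> = D * real (\<Sum>xs\<in>cube_lists A' s. \<Sum>ys\<in>cube_lists A (Suc m). card (near_pairs (P (xs @ ys)) A' ?\<sigma>))"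
        by (simp add: sum_distrib_left)
      also have "(\<Sum>xs\<in>cube_lists A' s. \<Sum>ys\<in>cube_lists A (Suc m). card (near_pairs (P (xs @ ys)) A' ?\<sigma>))
          = (\<Sum>xs\<in>cube_lists A' s. \<Sum>ys\<in>cube_lists A (Suc m). \<Sum>u\<in>int_cube A'. ?c (u # xs @ ys))"
        using sm by (intro sum.cong refl card_P) (auto simp: cube_lists_def)
      also have "\<dots> = (\<Sum>xs\<in>cube_lists A' s. \<Sum>u\<in>int_cube A'. \<Sum>ys\<in>cube_lists A (Suc m). ?c (u # xs @ ys))"
        by (intro sum.cong refl sum.swap)
      also have "\<dots> = (\<Sum>u\<in>int_cube A'. \<Sum>xs\<in>cube_lists A' s. \<Sum>ys\<in>cube_lists A (Suc m). ?c ((u # xs) @ ys))"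
        by (subst sum.swap) simp
      also have "\<dots> = (\<Sum>xs\<in>cube_lists A' (Suc s). \<Sum>ys\<in>cube_lists A (Suc m). ?c (xs @ ys))"
        by (rule sum_cube_lists_Cons[symmetric])
      also have "\<dots> = (\<Sum>xs\<in>cube_lists A' (Suc s). \<Sum>y\<in>int_cube A. \<Sum>ys\<in>cube_lists A m. ?c (xs @ y # ys))"
        by (simp only: sum_cube_lists_Cons[of _ A])
      \<comment> \<open>Symmetry makes the next large argument \<open>y\<close> the one on which the
        matrix acts.\<close>
      also have "\<dots> = (\<Sum>xs\<in>cube_lists A' (Suc s). \<Sum>ys\<in>cube_lists A m. \<Sum>y\<in>int_cube A. ?c (y # xs @ ys))"
        unfolding near_int_vecs_middle by (intro sum.cong refl sum.swap)
      also have "\<dots> = (\<Sum>xs\<in>cube_lists A' (Suc s). \<Sum>ys\<in>cube_lists A m. card (near_pairs (P (xs @ ys)) A ?\<sigma>))"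
        using sm by (intro sum.cong refl card_P[symmetric]) (auto simp: cube_lists_def)
      finally show ?thesis by (simp add: T_def)
    qed
    have iterate: "T 0 (s + m) \<le> D ^ s * T s m" if "s + m + 2 = d" for s m
      using that
    proof (induction s arbitrary: m)
      case (Suc s)
      have "T 0 (s + Suc m) \<le> D ^ s * T s (Suc m)" using Suc.prems by (intro Suc.IH) simp
      also have "\<dots> \<le> D ^ s * (D * T (Suc s) m)"
        using Suc.prems D by (intro mult_left_mono step) auto
      finally show ?case by (simp add: mult_ac)
    qed simp
    have "(\<Sum>ys\<in>cube_lists A (d - 2). real (card (near_pairs (P ys) A \<tau>))) = T 0 ((d - 2) + 0)"
      by (simp add: T_def)
    also have "\<dots> \<le> D ^ (d - 2) * T (d - 2) 0" using iterate[of "d - 2" 0] d by simp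
    also have "\<dots> \<le> D ^ (d - 2) * (\<Sum>xs\<in>cube_lists A' (d - 2). D * real (card (near_pairs (P xs) A' (\<tau> * q ^ Suc (d - 2)))))"
      unfolding T_def cube_lists_0 using D shrink
      by (intro mult_left_mono sum_mono) (auto simp del: power_Suc)
    also have "\<dots> = D ^ Suc (d - 2) * (\<Sum>xs\<in>cube_lists A' (d - 2). real (card (near_pairs (P xs) A' (\<tau> * q ^ Suc (d - 2)))))"
      by (simp add: sum_distrib_left mult_ac)
    also have "Suc (d - 2) = d - 1" using d by simp
    finally show "(\<Sum>ys\<in>cube_lists A (d - 2). real (card (near_pairs (polar_matrix \<alpha> F ys) A \<tau>))) \<le>
      (C * (A / A') ^ CARD('n)) ^ (d - 1) *
        (\<Sum>xs\<in>cube_lists A' (d - 2). real (card (near_pairs (polar_matrix \<alpha> F xs) A' (\<tau> * (A' / A) ^ (d - 1)))))"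
      by (simp add: P_def D_def q_def)
  qed
qed

lemma iter_diff_bound:
  fixes G :: "int ^ 'n::finite \<Rightarrow> int"
  assumes G: "\<And>x. x \<in> int_cube (S + real (length hs) * R) \<Longrightarrow> real_of_int \<bar>G x\<bar> \<le> D"
    and hs: "set hs \<subseteq> int_cube R" and x: "x \<in> int_cube S"
  shows "real_of_int \<bar>iter_diff hs G x\<bar> \<le> 2 ^ length hs * D"
  using G hs x
proof (induction hs arbitrary: x S)
  case (Cons h hs)
  have Rh: "\<bar>real_of_int (h $ j)\<bar> \<le> R" for j using Cons.prems(2) by (auto simp: int_cube_def)
  have sub: "\<bar>real_of_int (x $ j)\<bar> \<le> S" for j using Cons.prems(3) by (simp add: int_cube_def)
  have cube: "real_of_int \<bar>iter_diff hs G y\<bar> \<le> 2 ^ length hs * D" if "y \<in> int_cube (S + R)" for y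
    by (rule Cons.IH[OF _ _ that]) (use Cons.prems in \<open>auto simp: algebra_simps\<close>)
  have "0 \<le> R" using Rh[of undefined] by linarith
  have xh: "x + h \<in> int_cube (S + R)"
    unfolding int_cube_def mem_Collect_eq
  proof
    fix j show "real_of_int \<bar>(x + h) $ j\<bar> \<le> S + R" using Rh[of j] sub[of j] by simp
  qed
  have x: "x \<in> int_cube (S + R)"
    unfolding int_cube_def mem_Collect_eq
  proof
    fix j show "real_of_int \<bar>x $ j\<bar> \<le> S + R" using sub[of j] \<open>0 \<le> R\<close> by simp
  qed
  from cube[OF xh] cube[OF x] have "real_of_int \<bar>iter_diff hs G (x + h) - iter_diff hs G x\<bar> \<le> 2 ^ length hs * D + 2 ^ length hs * D"
    by linarith
  then show ?case by (simp add: iter_diff_Cons' mult_ac)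
qed simp

text \<open>The difference along the axis already lowers the degree to \<open>d - 1\<close>; the
  remaining differences only evaluate the result at points of size at most
  \<open>d * R\<close>.\<close>

lemma polar_form_bound:
  fixes F :: "int ^ 'n::finite \<Rightarrow> int"
  assumes F: "poly_below (Suc d) F" and d: "1 \<le> d"
  obtains C where "1 \<le> C" "\<And>R hs j. 1 \<le> R \<Longrightarrow> hs \<in> cube_lists R (d - 1) \<Longrightarrow>
    real_of_int \<bar>iter_diff (axis j 1 # hs) F 0\<bar> \<le> C * R ^ (d - 1)"
proof -
  have "\<exists>C\<ge>0. \<forall>R hs. 1 \<le> R \<longrightarrow> hs \<in> cube_lists R (d - 1) \<longrightarrow>
    real_of_int \<bar>iter_diff (axis j 1 # hs) F 0\<bar> \<le> C * R ^ (d - 1)" for j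
  proof -
    define G where "G x = F (x + axis j 1) - F x" for x
    have "poly_below (Suc (d - 1)) G"
      unfolding G_def using poly_below_difference[OF F] d by simp
    then obtain C where C: "0 \<le> C" "\<And>R x. 1 \<le> R \<Longrightarrow> (\<And>j. real_of_int \<bar>x $ j\<bar> \<le> R) \<Longrightarrow> real_of_int \<bar>G x\<bar> \<le> C * R ^ (d - 1)"
      using poly_below_bound by blast
    have "real_of_int \<bar>iter_diff (axis j 1 # hs) F 0\<bar> \<le> (2 ^ (d - 1) * (C * real d ^ (d - 1))) * R ^ (d - 1)"
      if R: "1 \<le> R" and hs: "hs \<in> cube_lists R (d - 1)" for R hs
    proof -
      have len: "length hs = d - 1" using hs by (simp add: cube_lists_def)
      have "1 * 1 \<le> real d * R" using R d by (intro mult_mono) auto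
      then have dR: "1 \<le> real d * R" by simp
      have "real_of_int \<bar>iter_diff hs G 0\<bar> \<le> 2 ^ length hs * (C * (real d * R) ^ (d - 1))"
      proof (rule iter_diff_bound)
        fix x :: "int ^ 'n" assume "x \<in> int_cube (0 + real (length hs) * R)"
        moreover have "0 + real (length hs) * R \<le> real d * R" using R by (simp add: len)
        ultimately have "real_of_int \<bar>x $ i\<bar> \<le> real d * R" for i
          unfolding int_cube_def mem_Collect_eq by (meson order.trans)
        then show "real_of_int \<bar>G x\<bar> \<le> C * (real d * R) ^ (d - 1)" by (intro C(2) dR)
      next
        show "set hs \<subseteq> int_cube R" using hs by (simp add: cube_lists_def)
      qed (simp add: int_cube_def)
      then show ?thesis unfolding iter_diff_Cons[of "axis j 1"] G_def[symmetric] len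
        by (simp add: power_mult_distrib mult_ac)
    qed
    then show ?thesis using C(1) by (intro exI[of _ "2 ^ (d - 1) * (C * real d ^ (d - 1))"]) auto
  qed
  then have "\<forall>j. \<exists>C. 0 \<le> C \<and> (\<forall>R hs. 1 \<le> R \<longrightarrow> hs \<in> cube_lists R (d - 1) \<longrightarrow>
    real_of_int \<bar>iter_diff (axis j 1 # hs) F 0\<bar> \<le> C * R ^ (d - 1))" by blast
  then obtain C where C: "\<And>j. 0 \<le> C j" "\<And>j R hs. 1 \<le> R \<Longrightarrow> hs \<in> cube_lists R (d - 1) \<Longrightarrow>
    real_of_int \<bar>iter_diff (axis j 1 # hs) F 0\<bar> \<le> C j * R ^ (d - 1)" unfolding choice_iff by blast
  show ?thesis
  proof (rule that[of "1 + sum C UNIV"])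
    show "1 \<le> 1 + sum C UNIV" using C(1) by (simp add: sum_nonneg)
    fix R :: real and hs :: "(int ^ 'n) list" and j
    assume *: "1 \<le> R" "hs \<in> cube_lists R (d - 1)"
    have "C j \<le> sum C UNIV" using C(1) by (intro member_le_sum) auto
    then have "C j * R ^ (d - 1) \<le> (1 + sum C UNIV) * R ^ (d - 1)" using *(1) by (intro mult_right_mono) auto
    with C(2)[OF *] show "real_of_int \<bar>iter_diff (axis j 1 # hs) F 0\<bar> \<le> (1 + sum C UNIV) * R ^ (d - 1)"
      by (rule order.trans)
  qed
qed

text \<open>After shrinking to size \<open>B\<close>, either some near pair has a nonzero value of
  the polar form, and that value is a denominator of size at most \<open>C * B ^ (d - 1)\<close>
  approximating \<alpha>; or all near pairs come from integral zeros of the polar forms, whose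
  number is known.\<close>

theorem weyl_dichotomy:
  fixes F :: "'n::finite int_mpoly"
  assumes hom: "homogeneous d F" and smooth: "smooth_form F" and d: "2 \<le> d"
  obtains C where "1 \<le> C" "\<And>N B l u \<alpha>. 1 \<le> N \<Longrightarrow> 1 \<le> B \<Longrightarrow> B \<le> real N \<Longrightarrow> int_box l u \<subseteq> int_cube (real N) \<Longrightarrow>
     norm (exp_sum (int_box l u) (\<lambda>x :: int ^ 'n. \<alpha> * of_int (eval_mpoly F x))) ^ 2 ^ (d - 1)
        \<le> C * (real N ^ 2 ^ (d - 1) * (1 + ln (3 * real N)) / B) ^ CARD('n) \<or>
     (\<exists>q a. 1 \<le> q \<and> real q \<le> C * B ^ (d - 1) \<and> \<bar>real q * \<alpha> - of_int a\<bar> \<le> B ^ (d - 1) / real N ^ d)"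
proof -
  let ?F = "eval_mpoly F :: int ^ 'n \<Rightarrow> int"
  let ?n = "CARD('n)"
  have F: "poly_below (Suc d) ?F" by (rule poly_below_eval_mpoly[OF hom])
  obtain C1 where C1: "1 \<le> C1" "\<And>R hs j. 1 \<le> R \<Longrightarrow> hs \<in> cube_lists R (d - 1) \<Longrightarrow>
    real_of_int \<bar>iter_diff (axis j 1 # hs) ?F 0\<bar> \<le> C1 * R ^ (d - 1)"
    using polar_form_bound[OF F] d by auto
  obtain C2 where C2: "0 \<le> C2" "\<And>R. 1 \<le> R \<Longrightarrow>
    real (card {hs \<in> cube_lists R (d - 1). \<forall>j. iter_diff (axis j 1 # hs) ?F 0 = 0}) \<le> C2 * (R ^ (d - 2)) ^ ?n"
    using card_polar_zeros_le[OF hom smooth d] by blast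
  obtain C3 where C3: "1 \<le> C3" "\<And>(F :: int ^ 'n \<Rightarrow> int) d \<alpha> A A' \<tau>. poly_below (Suc d) F \<Longrightarrow> 2 \<le> d \<Longrightarrow>
     0 < \<tau> \<Longrightarrow> 0 < A' \<Longrightarrow> A' \<le> A \<Longrightarrow> A * \<tau> \<le> 4 \<Longrightarrow>
     (\<Sum>ys\<in>cube_lists A (d - 2). real (card (near_pairs (polar_matrix \<alpha> F ys) A \<tau>))) \<le>
     (C3 * (A / A') ^ ?n) ^ (d - 1) *
       (\<Sum>xs\<in>cube_lists A' (d - 2). real (card (near_pairs (polar_matrix \<alpha> F xs) A' (\<tau> * (A' / A) ^ (d - 1)))))"
    using polar_shrinking[where 'n = 'n] by blast
  define E where "E = 2 ^ (d - 1) - d"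
  have E: "2 ^ (d - 1) = E + d"
  proof -
    have "d - 1 < 2 ^ (d - 1)" by simp
    then show ?thesis unfolding E_def by linarith
  qed
  define C4 where "C4 = (6 ^ E * (12 * 4 ^ (d - 1))) ^ ?n * (C3 ^ (d - 1) * C2)"
  have C4: "0 \<le> C4" using C2(1) C3(1) by (simp add: C4_def)
  show ?thesis
  proof (rule that[of "C1 + C4"])
    show "1 \<le> C1 + C4" using C1(1) C4 by simp
    fix N :: nat and B \<alpha> :: real and l u :: "int ^ 'n"
    assume N: "1 \<le> N" and B: "1 \<le> B" "B \<le> real N" and box: "int_box l u \<subseteq> int_cube (real N)"
    define K where "K = 2 * N + 1"
    \<comment> \<open>The tolerance \<open>1 / N\<close> after \<open>d - 1\<close> shrinkings by
      the factor \<open>B / (4 * N)\<close>.\<close>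
    define \<sigma> where "\<sigma> = 1 / real N * (B / (4 * real N)) ^ (d - 1)"
    have \<sigma>_le: "\<sigma> \<le> B ^ (d - 1) / real N ^ d"
    proof -
      have "(B / (4 * real N)) ^ (d - 1) \<le> (B / real N) ^ (d - 1)"
        using B N by (intro power_mono divide_left_mono) auto
      then have "\<sigma> \<le> 1 / real N * (B / real N) ^ (d - 1)"
        unfolding \<sigma>_def by (intro mult_left_mono) auto
      also have "\<dots> = B ^ (d - 1) / (real N * real N ^ (d - 1))" by (simp add: power_divide)
      also have "real N * real N ^ (d - 1) = real N ^ d" using d by (cases d) auto
      finally show ?thesis .
    qed
    have \<sigma>_1: "\<sigma> < 1"
    proof -
      have "(B / (4 * real N)) ^ (d - 1) \<le> (1 / 4) ^ (d - 1)" using B N by (intro power_mono) (auto simp: field_simps)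
      also have "\<dots> \<le> (1 / 4) ^ 1" using d by (intro power_decreasing) auto
      finally have "(B / (4 * real N)) ^ (d - 1) \<le> 1 / 4" by simp
      then have "\<sigma> \<le> 1 * (1 / 4)" unfolding \<sigma>_def using N B by (intro mult_mono) auto
      then show ?thesis by simp
    qed
    define P where "P = polar_matrix \<alpha> ?F"
    show "norm (exp_sum (int_box l u) (\<lambda>x. \<alpha> * of_int (?F x))) ^ 2 ^ (d - 1)
        \<le> (C1 + C4) * (real N ^ 2 ^ (d - 1) * (1 + ln (3 * real N)) / B) ^ ?n \<or>
     (\<exists>q a. 1 \<le> q \<and> real q \<le> (C1 + C4) * B ^ (d - 1) \<and> \<bar>real q * \<alpha> - of_int a\<bar> \<le> B ^ (d - 1) / real N ^ d)"
    proof (cases "\<exists>xs\<in>cube_lists B (d - 2). \<exists>(w, v)\<in>near_pairs (P xs) B \<sigma>. \<exists>j. iter_diff (axis j 1 # w # xs) ?F 0 \<noteq> 0")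
      case True
      then obtain xs w v j where xs: "xs \<in> cube_lists B (d - 2)" and wv: "(w, v) \<in> near_pairs (P xs) B \<sigma>"
        and nz: "iter_diff (axis j 1 # w # xs) ?F 0 \<noteq> 0" by blast
      have len: "length xs + 2 = d" using xs d by (simp add: cube_lists_def)
      define \<Psi> where "\<Psi> = iter_diff (axis j 1 # w # xs) ?F 0"
      have "w # xs \<in> cube_lists B (d - 1)"
        using xs wv d by (auto simp: cube_lists_def near_pairs_def int_cube_def)
      from C1(2)[OF B(1) this] have "real_of_int \<bar>\<Psi>\<bar> \<le> C1 * B ^ (d - 1)" by (simp add: \<Psi>_def)
      also have "\<dots> \<le> (C1 + C4) * B ^ (d - 1)" using C4 B by (intro mult_right_mono) auto
      finally have q: "real (nat \<bar>\<Psi>\<bar>) \<le> (C1 + C4) * B ^ (d - 1)" by simp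
      have near: "\<bar>\<alpha> * of_int \<Psi> - of_int (v $ j)\<bar> \<le> \<sigma>"
        using wv polar_matrix_apply[OF F len] unfolding P_def near_pairs_def \<Psi>_def by simp
      have "\<bar>real (nat \<bar>\<Psi>\<bar>) * \<alpha> - of_int (sgn \<Psi> * v $ j)\<bar> = \<bar>\<alpha> * of_int \<Psi> - of_int (v $ j)\<bar>"
        using nz by (cases "\<Psi> > 0") (auto simp: \<Psi>_def[symmetric] mult.commute abs_minus_commute)
      with near \<sigma>_le have "\<bar>real (nat \<bar>\<Psi>\<bar>) * \<alpha> - of_int (sgn \<Psi> * v $ j)\<bar> \<le> B ^ (d - 1) / real N ^ d" by simp
      moreover have "1 \<le> nat \<bar>\<Psi>\<bar>" using nz unfolding \<Psi>_def[symmetric] by simp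
      ultimately show ?thesis using q by blast
    next
      case False
      let ?Z = "\<lambda>hs. \<forall>j. iter_diff (axis j 1 # hs) ?F 0 = 0"
      have near_le: "card (near_pairs (P xs) B \<sigma>) \<le> (\<Sum>w\<in>int_cube B. if ?Z (w # xs) then 1 else 0)"
        if xs: "xs \<in> cube_lists B (d - 2)" for xs
      proof -
        have len: "length xs + 2 = d" using xs d by (simp add: cube_lists_def)
        have "near_pairs (P xs) B \<sigma> \<subseteq> {w \<in> int_cube B. ?Z (w # xs)} \<times> {0}"
        proof safe
          fix w v assume wv: "(w, v) \<in> near_pairs (P xs) B \<sigma>"
          show "w \<in> int_cube B" using wv by (simp add: near_pairs_def int_cube_def)
          show z: "iter_diff (axis j 1 # w # xs) ?F 0 = 0" for j using False xs wv by blast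
          \<comment> \<open>Once the polar form vanishes, \<open>v\<close> itself has entries below
            1 and must be zero; so each such \<open>w\<close> is counted once.\<close>
          have "\<bar>real_of_int (v $ j)\<bar> \<le> \<sigma>" for j
            using wv polar_matrix_apply[OF F len] z unfolding P_def near_pairs_def by simp
          then have v: "\<bar>real_of_int (v $ j)\<bar> < 1" for j using \<sigma>_1 by (rule order.strict_trans1)
          have "v $ j = 0" for j using v[of j] by linarith
          then show "v = 0" by (simp add: vec_eq_iff)
        qed
        then have "card (near_pairs (P xs) B \<sigma>) \<le> card ({w \<in> int_cube B. ?Z (w # xs)} \<times> {0 :: int ^ 'n})"
          by (intro card_mono finite_cartesian_product) (auto intro: finite_subset[OF _ finite_int_cube])
        also have "\<dots> = (\<Sum>w\<in>int_cube B. if ?Z (w # xs) then 1 else 0)"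
          by (simp add: card_cartesian_product sum.inter_filter[symmetric] finite_int_cube)
        finally show ?thesis .
      qed
      have "(\<Sum>xs\<in>cube_lists B (d - 2). card (near_pairs (P xs) B \<sigma>))
          \<le> (\<Sum>xs\<in>cube_lists B (d - 2). \<Sum>w\<in>int_cube B. if ?Z (w # xs) then 1 else 0)"
        by (intro sum_mono near_le)
      also have "\<dots> = (\<Sum>hs\<in>cube_lists B (Suc (d - 2)). if ?Z hs then 1 else 0)"
        unfolding sum_cube_lists_Cons by (rule sum.swap)
      also have "Suc (d - 2) = d - 1" using d by simp
      also have "(\<Sum>hs\<in>cube_lists B (d - 1). if ?Z hs then 1 else 0) = card {hs \<in> cube_lists B (d - 1). ?Z hs}"
        by (simp add: sum.inter_filter[symmetric] finite_cube_lists)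
      finally have "real (\<Sum>xs\<in>cube_lists B (d - 2). card (near_pairs (P xs) B \<sigma>)) \<le> C2 * (B ^ (d - 2)) ^ ?n"
        using C2(2)[OF B(1)] by linarith
      then have final: "(\<Sum>xs\<in>cube_lists B (d - 2). real (card (near_pairs (P xs) B \<sigma>))) \<le> C2 * (B ^ (d - 2)) ^ ?n"
        by simp
      \<comment> \<open>Enlarging gives all arguments the common size \<open>4 * N\<close>, and the
        tolerance \<open>1 / N\<close> makes the product \<open>A * \<tau>\<close> equal to 4, the
        constant allowed in \<open>polar_shrinking\<close>.\<close>
      have "(\<Sum>ys\<in>cube_lists (2 * real N) (d - 2). real (card (near_pairs (P ys) (4 * real N) (1 / real K))))
          \<le> (\<Sum>ys\<in>cube_lists (4 * real N) (d - 2). real (card (near_pairs (P ys) (4 * real N) (1 / real N))))"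
      proof (rule sum_le_included[where i = id])
        show "\<forall>ys\<in>cube_lists (2 * real N) (d - 2). \<exists>xs\<in>cube_lists (4 * real N) (d - 2). id xs = ys \<and>
           real (card (near_pairs (P ys) (4 * real N) (1 / real K))) \<le> real (card (near_pairs (P xs) (4 * real N) (1 / real N)))"
        proof
          fix ys :: "(int ^ 'n) list" assume "ys \<in> cube_lists (2 * real N) (d - 2)"
          moreover have "int_cube (2 * real N) \<subseteq> (int_cube (4 * real N) :: (int ^ 'n) set)"
            unfolding int_cube_def by (auto intro: order.trans)
          ultimately have "ys \<in> cube_lists (4 * real N) (d - 2)" by (auto simp: cube_lists_def)
          moreover have "1 / real K \<le> 1 / real N" using N by (simp add: K_def field_simps)
          then have "card (near_pairs (P ys) (4 * real N) (1 / real K)) \<le> card (near_pairs (P ys) (4 * real N) (1 / real N))"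
            by (intro card_mono finite_near_pairs near_pairs_mono)
          ultimately show "\<exists>xs\<in>cube_lists (4 * real N) (d - 2). id xs = ys \<and>
             real (card (near_pairs (P ys) (4 * real N) (1 / real K))) \<le> real (card (near_pairs (P xs) (4 * real N) (1 / real N)))"
            by auto
        qed
      qed (auto intro: finite_cube_lists)
      also have "\<dots> \<le> (C3 * (4 * real N / B) ^ ?n) ^ (d - 1) * (\<Sum>xs\<in>cube_lists B (d - 2). real (card (near_pairs (P xs) B \<sigma>)))"
        unfolding P_def \<sigma>_def by (rule C3(2)[OF F d]) (use N B in auto)
      also have "\<dots> \<le> (C3 * (4 * real N / B) ^ ?n) ^ (d - 1) * (C2 * (B ^ (d - 2)) ^ ?n)"
        using C3(1) B by (intro mult_left_mono final) auto
      finally have count: "(\<Sum>ys\<in>cube_lists (2 * real N) (d - 2). real (card (near_pairs (P ys) (4 * real N) (1 / real K))))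
          \<le> (C3 * (4 * real N / B) ^ ?n) ^ (d - 1) * (C2 * (B ^ (d - 2)) ^ ?n)" .
      have V: "real (card (int_cube (2 * real N) :: (int ^ 'n) set)) \<le> (3 * (2 * real N)) ^ ?n"
        using N by (intro card_int_cube_le) simp
      have K_le: "real K \<le> 3 * real N" using N by (simp add: K_def)
      have lnK: "0 \<le> 1 + ln (real K)" using ln_ge_zero[of "real K"] by (simp add: K_def)
      have L: "1 + ln (real K) \<le> 1 + ln (3 * real N)" using K_le by (simp add: K_def)
      have "norm (exp_sum (int_box l u) (\<lambda>x. \<alpha> * of_int (?F x))) ^ 2 ^ (d - 1)
          \<le> real (card (int_cube (2 * real N) :: (int ^ 'n) set)) ^ E * (4 * real K * (1 + ln (real K))) ^ ?n *
            (\<Sum>ys\<in>cube_lists (2 * real N) (d - 2). real (card (near_pairs (P ys) (4 * real N) (1 / real K))))"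
        unfolding E_def P_def K_def by (rule weyl_counting_bound[OF F d box])
      also have "\<dots> \<le> ((3 * (2 * real N)) ^ ?n) ^ E * (4 * (3 * real N) * (1 + ln (3 * real N))) ^ ?n *
            ((C3 * (4 * real N / B) ^ ?n) ^ (d - 1) * (C2 * (B ^ (d - 2)) ^ ?n))"
        using V count L lnK K_le N by (intro mult_mono power_mono) (auto intro!: sum_nonneg mult_nonneg_nonneg)
      \<comment> \<open>Inside the power \<open>CARD('n)\<close> the exponents of \<open>N\<close>
        are \<open>E\<close>, 1 and \<open>d - 1\<close>, with sum \<open>2 ^ (d - 1)\<close>; those
        of \<open>B\<close> are \<open>d - 2\<close> and \<open>- (d - 1)\<close>, which leave a
        single division by \<open>B\<close>.\<close>
      also have "\<dots> = (6 ^ E * (12 * 4 ^ (d - 1))) ^ ?n * (C3 ^ (d - 1) * C2) *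
          (real N ^ E * real N * real N ^ (d - 1) * (1 + ln (3 * real N)) * B ^ (d - 2) / B ^ (d - 1)) ^ ?n"
      proof -
        have c: "(x ^ ?n) ^ k = (x ^ k) ^ ?n" for x :: real and k
          by (simp flip: power_mult add: mult.commute)
        show ?thesis
          by (simp add: power_mult_distrib power_divide c)
      qed
      also have "real N ^ E * real N * real N ^ (d - 1) = real N ^ 2 ^ (d - 1)"
        unfolding E using d by (cases d) (simp_all add: power_add)
      also have "real N ^ 2 ^ (d - 1) * (1 + ln (3 * real N)) * B ^ (d - 2) / B ^ (d - 1)
          = real N ^ 2 ^ (d - 1) * (1 + ln (3 * real N)) / B"
      proof -
        have "B ^ (d - 1) = B * B ^ (d - 2)" using d by (cases d) (auto simp: Suc_diff_le numeral_2_eq_2 simp flip: power_Suc)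
        then show ?thesis using B by simp
      qed
      finally have "norm (exp_sum (int_box l u) (\<lambda>x. \<alpha> * of_int (?F x))) ^ 2 ^ (d - 1)
          \<le> C4 * (real N ^ 2 ^ (d - 1) * (1 + ln (3 * real N)) / B) ^ ?n" by (simp add: C4_def)
      also have "\<dots> \<le> (C1 + C4) * (real N ^ 2 ^ (d - 1) * (1 + ln (3 * real N)) / B) ^ ?n"
        using C1(1) B N by (intro mult_right_mono) auto
      finally show ?thesis ..
    qed
  qed
qed

subsection \<open>Sums of Fourier coefficients over values\<close>

lemma sum_echar_residues:
  assumes "0 < Q" "\<bar>k\<bar> < int Q"
  shows "(\<Sum>j<Q. echar (real j / real Q * of_int k)) = (if k = 0 then of_nat Q else 0)"
proof (cases "k = 0")
  case False
  define z where "z = echar (of_int k / real Q)"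
  have term_eq: "echar (real j / real Q * of_int k) = z ^ j" for j
    unfolding z_def echar_of_nat_mult[symmetric] by (simp add: mult.commute)
  have "z ^ Q = 1"
    unfolding z_def echar_of_nat_mult[symmetric] using assms by simp
  moreover have "z \<noteq> 1"
  proof
    assume "z = 1"
    define t where "t = of_int k / real Q"
    have "t = of_int (round t)"
      using norm_echar_minus_1_ge_round[of t] \<open>z = 1\<close> by (simp add: z_def t_def)
    then have "real_of_int k = of_int (round t) * real Q" using assms(1) by (simp add: t_def field_simps)
    then have "real_of_int k = of_int (round t * int Q)" by simp
    then have "k = round t * int Q" by (simp only: of_int_eq_iff)
    then have "int Q dvd k" by simp
    then show False using dvd_imp_le_int[of k "int Q"] False assms by simp
  qed
  moreover have "(z - 1) * (\<Sum>j<Q. z ^ j) = z ^ Q - 1" by (rule power_diff_1_eq[symmetric])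
  ultimately show ?thesis unfolding term_eq using False by simp
qed simp

text \<open>\<open>F x - m\<close> has absolute value at most \<open>2 * M < Q\<close>, so
  congruence modulo \<open>Q\<close> is equality and a finite character sum detects the values
  exactly.\<close>

lemma sum_positive_values_le:
  fixes F :: "'v \<Rightarrow> int" and lam :: "nat \<Rightarrow> complex"
  assumes X: "finite X" "\<And>x. x \<in> X \<Longrightarrow> \<bar>F x\<bar> \<le> int M" and Q: "2 * M < Q"
    and T: "\<And>b. norm (\<Sum>m=1..M. lam m * echar (real m * b)) \<le> T"
  shows "norm (\<Sum>x | x \<in> X \<and> 0 < F x. lam (nat (F x)))
    \<le> T * ((\<Sum>j<Q. norm (exp_sum X (\<lambda>x. real j / real Q * of_int (F x)))) / real Q)"
proof -
  have Q0: "0 < Q" using Q by simp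
  let ?T = "\<lambda>b. \<Sum>m=1..M. lam m * echar (real m * b)"
  let ?S = "\<lambda>j. exp_sum X (\<lambda>x. real j / real Q * of_int (F x))"
  have detect: "(\<Sum>j<Q. echar (real j / real Q * of_int (F x - int m))) = (if F x = int m then of_nat Q else 0)"
    if "x \<in> X" "m \<le> M" for x m
    using sum_echar_residues[OF Q0, of "F x - int m"] X(2)[OF that(1)] that(2) Q by auto
  have "of_nat Q * (\<Sum>x | x \<in> X \<and> 0 < F x. lam (nat (F x))) = (\<Sum>x\<in>X. \<Sum>m=1..M. lam m * (if F x = int m then of_nat Q else 0))"
  proof -
    have "(\<Sum>m=1..M. lam m * (if F x = int m then of_nat Q else 0)) = (if 0 < F x then of_nat Q * lam (nat (F x)) else 0)"
      if "x \<in> X" for x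
    proof -
      have "(\<Sum>m=1..M. lam m * (if F x = int m then of_nat Q else 0))
          = (\<Sum>m=1..M. if m = nat (F x) then (if 0 < F x then of_nat Q * lam (nat (F x)) else 0) else 0)"
        by (rule sum.cong) auto
      also have "\<dots> = (if nat (F x) \<in> {1..M} then (if 0 < F x then of_nat Q * lam (nat (F x)) else 0) else 0)"
        by simp
      finally show ?thesis using X(2)[OF that] by auto
    qed
    then have "(\<Sum>x\<in>X. \<Sum>m=1..M. lam m * (if F x = int m then of_nat Q else 0))
        = (\<Sum>x\<in>X. if 0 < F x then of_nat Q * lam (nat (F x)) else 0)"
      by (rule sum.cong[OF refl])
    moreover have "of_nat Q * (\<Sum>x | x \<in> X \<and> 0 < F x. lam (nat (F x)))
        = (\<Sum>x\<in>X. if 0 < F x then of_nat Q * lam (nat (F x)) else 0)"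
      unfolding sum.inter_filter[OF X(1)] sum_distrib_left by (rule sum.cong) auto
    ultimately show ?thesis by simp
  qed
  also have "\<dots> = (\<Sum>x\<in>X. \<Sum>m=1..M. \<Sum>j<Q. (lam m * echar (real m * (- (real j / real Q)))) * echar (real j / real Q * of_int (F x)))"
  proof (intro sum.cong refl)
    fix x m assume xm: "x \<in> X" "m \<in> {1..M}"
    have "lam m * (if F x = int m then of_nat Q else 0) = lam m * (\<Sum>j<Q. echar (real j / real Q * of_int (F x - int m)))"
      using detect xm by simp
    also have "\<dots> = (\<Sum>j<Q. (lam m * echar (real m * (- (real j / real Q)))) * echar (real j / real Q * of_int (F x)))"
      unfolding sum_distrib_left mult.assoc echar_add[symmetric]
      by (intro sum.cong refl arg_cong[where f = "\<lambda>t. lam m * echar t"]) (simp add: algebra_simps)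
    finally show "lam m * (if F x = int m then of_nat Q else 0)
      = (\<Sum>j<Q. (lam m * echar (real m * (- (real j / real Q)))) * echar (real j / real Q * of_int (F x)))" .
  qed
  also have "\<dots> = (\<Sum>x\<in>X. \<Sum>j<Q. \<Sum>m=1..M. (lam m * echar (real m * (- (real j / real Q)))) * echar (real j / real Q * of_int (F x)))"
    by (intro sum.cong refl sum.swap)
  also have "\<dots> = (\<Sum>j<Q. \<Sum>x\<in>X. \<Sum>m=1..M. (lam m * echar (real m * (- (real j / real Q)))) * echar (real j / real Q * of_int (F x)))"
    by (rule sum.swap)
  also have "\<dots> = (\<Sum>j<Q. ?T (- (real j / real Q)) * ?S j)"
    unfolding exp_sum_def sum_product by (intro sum.cong refl sum.swap)
  finally have eq: "of_nat Q * (\<Sum>x | x \<in> X \<and> 0 < F x. lam (nat (F x))) = (\<Sum>j<Q. ?T (- (real j / real Q)) * ?S j)" .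
  have "real Q * norm (\<Sum>x | x \<in> X \<and> 0 < F x. lam (nat (F x))) = norm (of_nat Q * (\<Sum>x | x \<in> X \<and> 0 < F x. lam (nat (F x))))"
    by (simp add: norm_mult)
  also have "\<dots> = norm (\<Sum>j<Q. ?T (- (real j / real Q)) * ?S j)" by (simp only: eq)
  also have "\<dots> \<le> (\<Sum>j<Q. T * norm (?S j))"
    by (rule sum_norm_le) (unfold norm_mult, intro mult_right_mono T norm_ge_zero)
  also have "\<dots> = T * (\<Sum>j<Q. norm (?S j))" by (rule sum_distrib_left[symmetric])
  finally show ?thesis using Q0 by (simp add: pos_le_divide_eq mult.commute)
qed

lemma sum_nonzero_values_le:
  fixes F :: "'v \<Rightarrow> int" and lam :: "nat \<Rightarrow> complex"
  assumes X: "finite X" "\<And>x. x \<in> X \<Longrightarrow> \<bar>F x\<bar> \<le> int M" and Q: "2 * M < Q"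
    and T: "0 \<le> T" "\<And>b. norm (\<Sum>m=1..M. lam m * echar (real m * b)) \<le> T"
    and A: "(\<Sum>j<Q. norm (exp_sum X (\<lambda>x. real j / real Q * of_int (F x)))) / real Q \<le> A"
  shows "norm (\<Sum>x | x \<in> X \<and> F x \<noteq> 0. lam (nat \<bar>F x\<bar>)) \<le> 2 * T * A"
proof -
  let ?S = "\<lambda>F. (\<Sum>j<Q. norm (exp_sum X (\<lambda>x. real j / real Q * of_int (F x)))) / real Q"
  \<comment> \<open>Changing the sign of \<open>F\<close> conjugates the exponential sums, so both
    signs share one mean.\<close>
  have conj: "?S (\<lambda>x. - F x) = ?S F"
  proof -
    have "exp_sum X (\<lambda>x. real j / real Q * of_int (- F x)) = cnj (exp_sum X (\<lambda>x. real j / real Q * of_int (F x)))" for j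
      by (simp add: exp_sum_def cnj_echar)
    then show ?thesis by simp
  qed
  have set_eq: "{x. x \<in> X \<and> F x \<noteq> 0} = {x. x \<in> X \<and> 0 < F x} \<union> {x. x \<in> X \<and> 0 < - F x}" by auto
  have "(\<Sum>x | x \<in> X \<and> F x \<noteq> 0. lam (nat \<bar>F x\<bar>)) =
    (\<Sum>x | x \<in> X \<and> 0 < F x. lam (nat \<bar>F x\<bar>)) + (\<Sum>x | x \<in> X \<and> 0 < - F x. lam (nat \<bar>F x\<bar>))"
    unfolding set_eq by (rule sum.union_disjoint) (use X(1) in auto)
  also have "\<dots> = (\<Sum>x | x \<in> X \<and> 0 < F x. lam (nat (F x))) + (\<Sum>x | x \<in> X \<and> 0 < - F x. lam (nat (- F x)))"
    by (intro arg_cong2[where f = "(+)"] sum.cong) auto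
  also have "norm \<dots> \<le> T * ?S F + T * ?S (\<lambda>x. - F x)"
  proof (rule order.trans[OF norm_triangle_ineq add_mono])
    show "norm (\<Sum>x | x \<in> X \<and> 0 < F x. lam (nat (F x))) \<le> T * ?S F"
      by (rule sum_positive_values_le[OF X Q T(2)])
    show "norm (\<Sum>x | x \<in> X \<and> 0 < - F x. lam (nat (- F x))) \<le> T * ?S (\<lambda>x. - F x)"
      by (rule sum_positive_values_le[OF X(1) _ Q T(2)]) (use X(2) in simp)
  qed
  also have "\<dots> = 2 * (T * ?S F)" unfolding conj by simp
  also have "\<dots> \<le> 2 * (T * A)" using A T(1) by (intro mult_left_mono) auto
  finally show ?thesis by simp
qed

subsection \<open>Major and minor arcs\<close>

lemma card_nat_interval_le:
  assumes "0 \<le> w"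
  shows "finite {j::nat. lo \<le> real j \<and> real j \<le> lo + w}"
    and "real (card {j::nat. lo \<le> real j \<and> real j \<le> lo + w}) \<le> w + 1"
proof -
  have sub: "int ` {j::nat. lo \<le> real j \<and> real j \<le> lo + w} \<subseteq> {\<lceil>lo\<rceil>..\<lfloor>lo + w\<rfloor>}"
    by (auto simp: ceiling_le_iff le_floor_iff)
  have "finite (int ` {j::nat. lo \<le> real j \<and> real j \<le> lo + w})" by (rule finite_subset[OF sub]) simp
  then show fin: "finite {j::nat. lo \<le> real j \<and> real j \<le> lo + w}" by (rule finite_imageD) simp
  have "card {j::nat. lo \<le> real j \<and> real j \<le> lo + w} = card (int ` {j::nat. lo \<le> real j \<and> real j \<le> lo + w})"
    by (simp add: card_image)
  also have "\<dots> \<le> card {\<lceil>lo\<rceil>..\<lfloor>lo + w\<rfloor>}" by (intro card_mono sub) simp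
  finally have "card {j::nat. lo \<le> real j \<and> real j \<le> lo + w} \<le> nat (\<lfloor>lo + w\<rfloor> - \<lceil>lo\<rceil> + 1)" by simp
  then show "real (card {j::nat. lo \<le> real j \<and> real j \<le> lo + w}) \<le> w + 1"
    using assms by linarith
qed

text \<open>As \<open>\<delta> \<le> 1\<close>, only the \<open>q + 3\<close> numerators from
  \<open>-1\<close> to \<open>q + 1\<close> occur; each confines \<open>j\<close> to an interval of
  length \<open>2 * \<delta> * Q / q\<close>, and \<open>q + 3 \<le> 4 * q\<close>.\<close>

lemma card_major_arc_le:
  assumes Q: "0 < Q" and q: "1 \<le> q" and \<delta>: "0 \<le> \<delta>" "\<delta> \<le> 1"
  shows "real (card {j. j < Q \<and> (\<exists>a. \<bar>real q * (real j / real Q) - of_int a\<bar> \<le> \<delta>)}) \<le> 8 * real Q * \<delta> + 4 * real q"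
proof -
  define w where "w = 2 * \<delta> * real Q / real q"
  have w: "0 \<le> w" using \<delta> by (simp add: w_def)
  define I where "I a = {j::nat. (of_int a - \<delta>) * real Q / real q \<le> real j \<and> real j \<le> (of_int a - \<delta>) * real Q / real q + w}" for a :: int
  have I: "finite (I a)" "real (card (I a)) \<le> w + 1" for a
    unfolding I_def using card_nat_interval_le[OF w] by auto
  have "{j. j < Q \<and> (\<exists>a. \<bar>real q * (real j / real Q) - of_int a\<bar> \<le> \<delta>)} \<subseteq> (\<Union>a\<in>{-1..int q + 1}. I a)"
  proof safe
    fix j a assume j: "j < Q" and a: "\<bar>real q * (real j / real Q) - of_int a\<bar> \<le> \<delta>"
    define t where "t = real q * (real j / real Q)"
    have "real j / real Q \<le> 1" using j by simp
    then have "t \<le> real q * 1" unfolding t_def by (intro mult_left_mono) auto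
    moreover have "0 \<le> t" by (simp add: t_def)
    ultimately have "a \<in> {-1..int q + 1}" using a \<delta> unfolding t_def[symmetric] by simp linarith
    moreover have "j \<in> I a"
    proof -
      have jt: "real j = t * real Q / real q" using q Q by (simp add: t_def)
      have "(of_int a - \<delta>) * real Q / real q \<le> t * real Q / real q"
        using a unfolding t_def[symmetric] by (intro divide_right_mono mult_right_mono) auto
      moreover have "t * real Q / real q \<le> (of_int a + \<delta>) * real Q / real q"
        using a unfolding t_def[symmetric] by (intro divide_right_mono mult_right_mono) auto
      moreover have "(of_int a + \<delta>) * real Q / real q = (of_int a - \<delta>) * real Q / real q + w"
        by (simp add: w_def algebra_simps add_divide_distrib diff_divide_distrib)
      ultimately show ?thesis by (simp add: I_def jt)
    qed
    ultimately show "j \<in> (\<Union>a\<in>{-1..int q + 1}. I a)" by blast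
  qed
  then have "card {j. j < Q \<and> (\<exists>a. \<bar>real q * (real j / real Q) - of_int a\<bar> \<le> \<delta>)} \<le> card (\<Union>a\<in>{-1..int q + 1}. I a)"
    by (intro card_mono) (use I in auto)
  also have "\<dots> \<le> (\<Sum>a\<in>{-1..int q + 1}. card (I a))" by (rule card_UN_le) simp
  finally have "real (card {j. j < Q \<and> (\<exists>a. \<bar>real q * (real j / real Q) - of_int a\<bar> \<le> \<delta>)})
      \<le> real (\<Sum>a\<in>{-1..int q + 1}. card (I a))" by (simp only: of_nat_le_iff)
  also have "\<dots> \<le> (\<Sum>a\<in>{-1..int q + 1}. w + 1)" using I(2) by (simp only: of_nat_sum) (intro sum_mono)
  also have "\<dots> = (real q + 3) * (w + 1)" by simp
  also have "\<dots> \<le> (4 * real q) * (w + 1)" using q w by (intro mult_right_mono) auto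
  also have "\<dots> = 8 * real Q * \<delta> + 4 * real q" using q by (simp add: w_def field_simps)
  finally show ?thesis .
qed

text \<open>The term \<open>8 * Y * \<delta>\<close> bounds the total length of the arcs with
  denominators up to \<open>Y\<close>; \<open>4 * Y * Y / Q\<close> is the price for counting
  fractions \<open>j / Q\<close> instead of measuring.\<close>

lemma average_le_minor_plus_major:
  fixes S :: "real \<Rightarrow> real"
  assumes Q: "0 < Q" and \<delta>: "0 \<le> \<delta>" "\<delta> \<le> 1" and s: "0 \<le> s" and V: "0 \<le> V" "\<And>\<alpha>. S \<alpha> \<le> V" and Y: "0 \<le> Y"
    and dich: "\<And>\<alpha>. S \<alpha> \<le> s \<or> (\<exists>q a. 1 \<le> q \<and> real q \<le> Y \<and> \<bar>real q * \<alpha> - of_int a\<bar> \<le> \<delta>)"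
  shows "(\<Sum>j<Q. S (real j / real Q)) / real Q \<le> s + V * (8 * Y * \<delta> + 4 * Y * Y / real Q)"
proof -
  define J where "J q = {j. j < Q \<and> (\<exists>a. \<bar>real q * (real j / real Q) - of_int a\<bar> \<le> \<delta>)}" for q
  define U where "U = (\<Union>q\<in>{1..nat \<lfloor>Y\<rfloor>}. J q)"
  have U: "U \<subseteq> {..<Q}" by (auto simp: U_def J_def)
  have "S (real j / real Q) \<le> s + (if j \<in> U then V else 0)" if j: "j < Q" for j
  proof (cases "S (real j / real Q) \<le> s")
    case True
    then show ?thesis using V(1) by auto
  next
    case False
    then obtain q a where q: "1 \<le> q" "real q \<le> Y" "\<bar>real q * (real j / real Q) - of_int a\<bar> \<le> \<delta>"
      using dich[of "real j / real Q"] by blast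
    then have "q \<in> {1..nat \<lfloor>Y\<rfloor>}" by (simp add: le_nat_iff le_floor_iff)
    then have "j \<in> U" using q j by (auto simp: U_def J_def)
    then show ?thesis using V(2)[of "real j / real Q"] s by simp
  qed
  then have "(\<Sum>j<Q. S (real j / real Q)) \<le> (\<Sum>j<Q. s + (if j \<in> U then V else 0))"
    by (intro sum_mono) simp
  also have "\<dots> = real Q * s + V * real (card U)"
    using U by (simp add: sum.distrib sum.inter_restrict[symmetric] Int_absorb1 mult.commute)
  also have "real (card U) \<le> Y * (8 * real Q * \<delta> + 4 * Y)"
  proof -
    have "card U \<le> (\<Sum>q\<in>{1..nat \<lfloor>Y\<rfloor>}. card (J q))" unfolding U_def by (rule card_UN_le) simp
    then have "real (card U) \<le> real (\<Sum>q\<in>{1..nat \<lfloor>Y\<rfloor>}. card (J q))" by (simp only: of_nat_le_iff)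
    also have "\<dots> = (\<Sum>q\<in>{1..nat \<lfloor>Y\<rfloor>}. real (card (J q)))" by simp
    also have "\<dots> \<le> (\<Sum>q\<in>{1..nat \<lfloor>Y\<rfloor>}. 8 * real Q * \<delta> + 4 * Y)"
    proof (rule sum_mono)
      fix q assume q: "q \<in> {1..nat \<lfloor>Y\<rfloor>}"
      then have "q \<le> nat \<lfloor>Y\<rfloor>" by simp
      then have "real q \<le> Y" using Y by linarith
      moreover have "real (card (J q)) \<le> 8 * real Q * \<delta> + 4 * real q"
        unfolding J_def using q by (intro card_major_arc_le Q \<delta>) simp
      ultimately show "real (card (J q)) \<le> 8 * real Q * \<delta> + 4 * Y" by simp
    qed
    also have "\<dots> = real (nat \<lfloor>Y\<rfloor>) * (8 * real Q * \<delta> + 4 * Y)" by simp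
    also have "\<dots> \<le> Y * (8 * real Q * \<delta> + 4 * Y)"
      using Y \<delta> by (intro mult_right_mono) auto
    finally show ?thesis .
  qed
  finally have "(\<Sum>j<Q. S (real j / real Q)) \<le> real Q * s + V * (Y * (8 * real Q * \<delta> + 4 * Y))"
    using V(1) by (simp add: mult_left_mono)
  also have "\<dots> = (s + V * (8 * Y * \<delta> + 4 * Y * Y / real Q)) * real Q"
    using Q by (simp add: field_simps)
  finally show ?thesis using Q by (simp add: pos_divide_le_eq)
qed

section \<open>Power saving in degree at least two\<close>

lemma ln_mult_le_powr:
  fixes c x e :: real
  assumes "1 \<le> c" "1 \<le> x" "0 < e"
  shows "ln (c * x) \<le> (ln c + 1 / e) * x powr e"
proof -
  have "ln (c * x) = ln c + ln x" using assms by (intro ln_mult_pos) auto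
  also have "ln x \<le> x powr e / e" using assms by (intro ln_powr_bound)
  also have "ln c \<le> ln c * x powr e"
    using assms by (simp add: mult_le_cancel_left1 ge_one_powr_ge_zero)
  finally show ?thesis by (simp add: algebra_simps)
qed

lemma twisted_sum_powr_bound:
  fixes lam :: "nat \<Rightarrow> complex"
  assumes W: "0 \<le> W" "\<And>M b. norm (\<Sum>m=1..M. lam m * echar (real m * b)) \<le> W * sqrt (real M) * ln (real M + 1)"
    and c: "0 \<le> c" and e: "0 < e"
  obtains C where "0 \<le> C" "\<And>N b. 1 \<le> N \<Longrightarrow>
    norm (\<Sum>m=1..nat \<lceil>c * real N ^ d\<rceil>. lam m * echar (real m * b)) \<le> C * real N powr (real d / 2 + e)"
proof -
  \<comment> \<open>The exponent \<open>e / (d + 1)\<close>, applied to \<open>N ^ d\<close>, costs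
    at most \<open>N powr e\<close>; the denominator \<open>d + 1\<close> avoids division by
    zero.\<close>
  define C1 where "C1 = ln (c + 2) + 1 / (e / (real d + 1))"
  have C1: "0 \<le> C1" using c e by (simp add: C1_def)
  show ?thesis
  proof (rule that[of "W * sqrt (c + 1) * C1"])
    fix N :: nat and b :: real assume N: "1 \<le> N"
    define M where "M = nat \<lceil>c * real N ^ d\<rceil>"
    have Nd: "1 \<le> real N ^ d" using N by (intro one_le_power) simp
    have "0 \<le> c * real N ^ d" using c by simp
    then have M: "real M \<le> c * real N ^ d + 1" unfolding M_def by linarith
    also have "\<dots> \<le> (c + 1) * real N ^ d" using Nd by (simp add: distrib_right)
    finally have M1: "real M \<le> (c + 1) * real N ^ d" .
    have M2: "real M + 1 \<le> (c + 2) * real N ^ d" using M1 Nd by (simp add: distrib_right)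
    have "sqrt (real M) \<le> sqrt ((c + 1) * real N ^ d)" using M1 by (rule real_sqrt_le_mono)
    also have "\<dots> = sqrt (c + 1) * real N powr (real d / 2)"
    proof -
      have "sqrt (real N ^ d) = (real N powr real d) powr (1 / 2)"
        using N by (simp add: powr_realpow powr_half_sqrt)
      also have "\<dots> = real N powr (real d / 2)" by (simp add: powr_powr)
      finally show ?thesis by (simp add: real_sqrt_mult)
    qed
    finally have 1: "sqrt (real M) \<le> sqrt (c + 1) * real N powr (real d / 2)" .
    have "ln (real M + 1) \<le> ln ((c + 2) * real N ^ d)" using M2 by (intro ln_mono) auto
    also have "\<dots> \<le> C1 * (real N ^ d) powr (e / (real d + 1))"
      unfolding C1_def using c Nd e by (intro ln_mult_le_powr) auto
    also have "(real N ^ d) powr (e / (real d + 1)) = real N powr (real d * (e / (real d + 1)))"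
      using N by (simp add: powr_powr flip: powr_realpow)
    also have "\<dots> \<le> real N powr e"
    proof (rule powr_mono)
      have "real d * e \<le> (real d + 1) * e" using e by (intro mult_right_mono) auto
      then show "real d * (e / (real d + 1)) \<le> e" by (simp add: pos_divide_le_eq mult.commute add_nonneg_pos)
    qed (use N in simp)
    finally have 2: "ln (real M + 1) \<le> C1 * real N powr e" using C1 by (simp add: mult_left_mono)
    have "norm (\<Sum>m=1..M. lam m * echar (real m * b)) \<le> W * sqrt (real M) * ln (real M + 1)" by (rule W(2))
    also have "\<dots> \<le> W * (sqrt (c + 1) * real N powr (real d / 2)) * (C1 * real N powr e)"
      using 1 2 W(1) c by (intro mult_mono) auto
    also have "\<dots> = W * sqrt (c + 1) * C1 * real N powr (real d / 2 + e)"
      by (simp only: powr_add mult_ac)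
    finally show "norm (\<Sum>m=1..nat \<lceil>c * real N ^ d\<rceil>. lam m * echar (real m * b))
      \<le> W * sqrt (c + 1) * C1 * real N powr (real d / 2 + e)" by (simp only: M_def)
  qed (use W(1) c C1 in simp)
qed

lemma norm_exp_sum_le_card: "norm (exp_sum X \<phi>) \<le> real (card X)"
proof -
  have "norm (exp_sum X \<phi>) \<le> (\<Sum>x\<in>X. norm (echar (\<phi> x)))" unfolding exp_sum_def by (rule norm_sum)
  then show ?thesis by simp
qed

lemma eval_mpoly_box_bound:
  fixes F :: "'n::finite int_mpoly"
  assumes "homogeneous d F"
  obtains c where "0 \<le> c" "\<And>N x. 1 \<le> N \<Longrightarrow> x \<in> int_cube (real N) \<Longrightarrow>
    \<bar>eval_mpoly F (x :: int ^ 'n)\<bar> \<le> int (nat \<lceil>c * real N ^ d\<rceil>)"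
proof -
  obtain c where c: "0 \<le> c" "\<And>R x. 1 \<le> R \<Longrightarrow> (\<And>j. real_of_int \<bar>x $ j\<bar> \<le> R) \<Longrightarrow> real_of_int \<bar>eval_mpoly F (x :: int ^ 'n)\<bar> \<le> c * R ^ d"
    using poly_below_bound[OF poly_below_eval_mpoly[OF assms]] by blast
  have "\<bar>eval_mpoly F x\<bar> \<le> int (nat \<lceil>c * real N ^ d\<rceil>)" if "1 \<le> N" "x \<in> int_cube (real N)" for N and x :: "int ^ 'n"
  proof -
    have "real_of_int \<bar>eval_mpoly F x\<bar> \<le> c * real N ^ d"
      using that by (intro c(2)) (auto simp: int_cube_def)
    then show ?thesis by linarith
  qed
  with c(1) that show ?thesis by blast
qed

theorem power_saving_nonlinear:
  fixes F :: "'n::finite int_mpoly" and lam :: "nat \<Rightarrow> complex"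
  assumes W: "0 \<le> W" "\<And>M b. norm (\<Sum>m=1..M. lam m * echar (real m * b)) \<le> W * sqrt (real M) * ln (real M + 1)"
    and hom: "homogeneous d F" and smooth: "smooth_form F" and d: "2 \<le> d"
    and n: "CARD('n) > 2 ^ d * (d - 1)"
  shows "\<exists>C \<eta>. 0 < \<eta> \<and> (\<forall>N l u. 1 \<le> N \<longrightarrow> int_box l u \<subseteq> int_cube (real N) \<longrightarrow>
     norm (\<Sum>x | x \<in> int_box l (u :: int ^ 'n) \<and> eval_mpoly F x \<noteq> 0. lam (nat \<bar>eval_mpoly F x\<bar>))
       \<le> C * real N powr (real CARD('n) - \<eta>))"
proof -
  let ?n = "CARD('n)"
  define k :: nat where "k = 2 ^ (d - 1)"
  define r where "r = real ?n / real k"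
  have k: "0 < k" by (simp add: k_def)
  have d1: "1 \<le> real d - 1" using d by simp
  have r: "2 * (real d - 1) < r"
  proof -
    have "2 ^ d = 2 * k" using d by (cases d) (auto simp: k_def)
    then have "2 * k * (d - 1) < ?n" using n by simp
    then have "real (2 * k * (d - 1)) < real ?n" by (simp only: of_nat_less_iff)
    then have "2 * (real d - 1) * real k < real ?n" using d by (simp add: of_nat_diff mult_ac)
    then show ?thesis using k by (simp add: r_def pos_less_divide_eq)
  qed
  have "0 < 2 * (real d - 1)" using d1 by simp
  then have r0: "0 < r" using r by (rule order.strict_trans)
  \<comment> \<open>Above \<open>t1\<close> the saving \<open>\<theta> * r\<close> on the minor arcs
    exceeds \<open>d / 2\<close>; below \<open>t2\<close> the major arcs also save more than
    \<open>d / 2\<close>. The hypothesis on the number of variables says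
    \<open>r > 2 * (d - 1)\<close>, which is \<open>t1 < t2\<close>.\<close>
  define t1 where "t1 = real d / (2 * r)"
  define t2 where "t2 = real d / (4 * (real d - 1))"
  define \<theta> where "\<theta> = (t1 + t2) / 2"
  have t1: "0 < t1" using d r0 by (simp add: t1_def)
  have "t1 < t2" unfolding t1_def t2_def using r d d1 by (intro divide_strict_left_mono mult_pos_pos) auto
  then have \<theta>: "t1 < \<theta>" "\<theta> < t2" by (auto simp: \<theta>_def)
  have t2: "t2 \<le> 1" using d1 by (simp add: t2_def pos_divide_le_eq)
  have \<theta>0: "0 < \<theta>" "\<theta> \<le> 1" using t1 t2 \<theta> by linarith+
  define \<eta>0 where "\<eta>0 = min (\<theta> * r - real d / 2) (real d / 2 - 2 * (real d - 1) * \<theta>)"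
  have "real d / 2 < \<theta> * r" using \<theta>(1) r0 by (simp add: t1_def pos_divide_less_eq mult_ac)
  moreover have "2 * (real d - 1) * \<theta> < real d / 2" using \<theta>(2) d1 by (simp add: t2_def pos_less_divide_eq mult_ac)
  ultimately have \<eta>0: "0 < \<eta>0" by (simp add: \<eta>0_def)
  \<comment> \<open>Powers of this exponent absorb the logarithms: one from Wilton's bound, and one
    from Weyl's inequality that is raised to the power \<open>r\<close>. Together they use half of
    the margin \<open>\<eta>0\<close>.\<close>
  define e where "e = \<eta>0 / (2 * (r + 1))"
  have e: "0 < e" "e * (r + 1) = \<eta>0 / 2" using \<eta>0 r0 by (auto simp: e_def field_simps)
  have "e * 1 \<le> e * (r + 1)" using e r0 by (intro mult_left_mono) auto
  then have e_le: "e \<le> \<eta>0 / 2" using e by simp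
  obtain C1 where C1: "1 \<le> C1" "\<And>N B l u \<alpha>. 1 \<le> N \<Longrightarrow> 1 \<le> B \<Longrightarrow> B \<le> real N \<Longrightarrow> int_box l u \<subseteq> int_cube (real N) \<Longrightarrow>
     norm (exp_sum (int_box l u) (\<lambda>x :: int ^ 'n. \<alpha> * of_int (eval_mpoly F x))) ^ 2 ^ (d - 1)
        \<le> C1 * (real N ^ 2 ^ (d - 1) * (1 + ln (3 * real N)) / B) ^ ?n \<or>
     (\<exists>q a. 1 \<le> q \<and> real q \<le> C1 * B ^ (d - 1) \<and> \<bar>real q * \<alpha> - of_int a\<bar> \<le> B ^ (d - 1) / real N ^ d)"
    using weyl_dichotomy[OF hom smooth d] by blast
  obtain c where c: "0 \<le> c" "\<And>N x. 1 \<le> N \<Longrightarrow> x \<in> int_cube (real N) \<Longrightarrow>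
    \<bar>eval_mpoly F (x :: int ^ 'n)\<bar> \<le> int (nat \<lceil>c * real N ^ d\<rceil>)"
    using eval_mpoly_box_bound[OF hom] by blast
  obtain CT where CT: "0 \<le> CT" "\<And>N b. 1 \<le> N \<Longrightarrow>
    norm (\<Sum>m=1..nat \<lceil>c * real N ^ d\<rceil>. lam m * echar (real m * b)) \<le> CT * real N powr (real d / 2 + e)"
    using twisted_sum_powr_bound[OF W c(1) e(1), of d] by blast
  define CL where "CL = 1 + (ln 3 + 1 / e)"
  have CL: "0 \<le> CL" using e by (simp add: CL_def)
  define Cs where "Cs = C1 powr (1 / real k) * (CL ^ ?n) powr (1 / real k)"
  have Cs: "0 \<le> Cs" by (simp add: Cs_def)
  define Cm where "Cm = 3 ^ ?n * (8 * C1 + 4 * C1 * C1)"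
  have Cm: "0 \<le> Cm" using C1 by (simp add: Cm_def)
  have main: "norm (\<Sum>x | x \<in> int_box l (u :: int ^ 'n) \<and> eval_mpoly F x \<noteq> 0. lam (nat \<bar>eval_mpoly F x\<bar>))
       \<le> (2 * CT * (Cs + Cm)) * real N powr (real ?n - \<eta>0 / 2)"
    if N: "1 \<le> N" and box: "int_box l u \<subseteq> int_cube (real N)" for N l u
  proof -
    define B where "B = real N powr \<theta>"
    have B: "1 \<le> B" "B \<le> real N"
      using N \<theta>0 powr_mono[of \<theta> 1 "real N"] by (auto simp: B_def ge_one_powr_ge_zero)
    define X where "X = int_box l u"
    have X: "finite X" unfolding X_def by (rule finite_subset[OF box finite_int_cube])
    define M where "M = nat \<lceil>c * real N ^ d\<rceil>"
    \<comment> \<open>The summand \<open>N ^ d\<close> makes the discretisation term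
      \<open>Y * Y / Q\<close> no larger than the order of the major arc measure.\<close>
    define Q where "Q = 2 * M + 1 + N ^ d"
    define S where "S \<alpha> = norm (exp_sum X (\<lambda>x. \<alpha> * of_int (eval_mpoly F x)))" for \<alpha>
    define Y where "Y = C1 * B ^ (d - 1)"
    define \<delta> where "\<delta> = B ^ (d - 1) / real N ^ d"
    define s where "s = Cs * real N powr (real ?n + (e - \<theta>) * r)"
    have Bd: "B ^ (d - 1) = real N powr (\<theta> * (real d - 1))"
      using d N by (simp add: B_def powr_powr of_nat_diff flip: powr_realpow)
    have Nd: "real N ^ d = real N powr real d" using N by (simp add: powr_realpow)
    have \<delta>: "0 \<le> \<delta>" "\<delta> \<le> 1"
    proof -
      have "B ^ (d - 1) \<le> real N ^ (d - 1)" using B by (intro power_mono) auto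
      also have "\<dots> \<le> real N ^ d" using N by (intro power_increasing) auto
      finally show "\<delta> \<le> 1" using N by (simp add: \<delta>_def pos_divide_le_eq)
    qed (use B in \<open>simp add: \<delta>_def\<close>)
    have minor: "S \<alpha> \<le> s" if "S \<alpha> ^ 2 ^ (d - 1) \<le> C1 * (real N ^ 2 ^ (d - 1) * (1 + ln (3 * real N)) / B) ^ ?n" for \<alpha>
    proof -
      have L: "1 + ln (3 * real N) \<le> CL * real N powr e"
      proof -
        have "ln (3 * real N) \<le> (ln 3 + 1 / e) * real N powr e" using N e by (intro ln_mult_le_powr) auto
        moreover have "1 \<le> real N powr e" using N e by (intro ge_one_powr_ge_zero) auto
        ultimately show ?thesis by (simp add: CL_def algebra_simps)
      qed
      have "0 \<le> 1 + ln (3 * real N)" using N by simp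
      then have "real N ^ k * (1 + ln (3 * real N)) / B \<le> real N ^ k * (CL * real N powr e) / B"
        using L B by (intro divide_right_mono mult_left_mono) auto
      also have "\<dots> = CL * real N powr (real k + e - \<theta>)"
        using N by (simp add: B_def powr_add powr_diff powr_realpow)
      finally have "(real N ^ k * (1 + ln (3 * real N)) / B) ^ ?n \<le> (CL * real N powr (real k + e - \<theta>)) ^ ?n"
        using \<open>0 \<le> 1 + ln (3 * real N)\<close> B by (intro power_mono) auto
      also have "\<dots> = CL ^ ?n * real N powr ((real k + e - \<theta>) * real ?n)"
        using N by (simp add: power_mult_distrib powr_powr[symmetric] powr_realpow)
      finally have "S \<alpha> ^ k \<le> C1 * (CL ^ ?n * real N powr ((real k + e - \<theta>) * real ?n))"
        using that C1(1) unfolding k_def[symmetric] by (meson mult_left_mono order.trans zero_le_one)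
      then have "(S \<alpha> ^ k) powr (1 / real k) \<le> (C1 * (CL ^ ?n * real N powr ((real k + e - \<theta>) * real ?n))) powr (1 / real k)"
        by (intro powr_mono2) (auto simp: S_def)
      also have "\<dots> = Cs * real N powr ((real k + e - \<theta>) * real ?n * (1 / real k))"
        using C1 CL by (simp add: powr_mult powr_powr Cs_def)
      also have "(real k + e - \<theta>) * real ?n * (1 / real k) = real ?n + (e - \<theta>) * r"
        using k by (simp add: r_def field_simps)
      also have "(S \<alpha> ^ k) powr (1 / real k) = S \<alpha>"
        using k by (cases "S \<alpha> = 0") (auto simp: S_def powr_powr simp flip: powr_realpow)
      finally show ?thesis by (simp add: s_def)
    qed
    have "(\<Sum>j<Q. S (real j / real Q)) / real Q \<le> s + (3 * real N) ^ ?n * (8 * Y * \<delta> + 4 * Y * Y / real Q)"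
    proof (rule average_le_minor_plus_major)
      show "S \<alpha> \<le> s \<or> (\<exists>q a. 1 \<le> q \<and> real q \<le> Y \<and> \<bar>real q * \<alpha> - of_int a\<bar> \<le> \<delta>)" for \<alpha>
        using C1(2)[OF N B box, of \<alpha>] minor[of \<alpha>] unfolding S_def X_def Y_def \<delta>_def by blast
      show "S \<alpha> \<le> (3 * real N) ^ ?n" for \<alpha>
      proof -
        have "S \<alpha> \<le> real (card X)" unfolding S_def by (rule norm_exp_sum_le_card)
        also have "\<dots> \<le> real (card (int_cube (real N) :: (int ^ 'n) set))"
          unfolding X_def by (intro of_nat_mono card_mono box finite_int_cube)
        also have "\<dots> \<le> (3 * real N) ^ ?n" using N by (intro card_int_cube_le) simp
        finally show ?thesis .
      qed
    qed (use \<delta> Cs C1 B in \<open>auto simp: Q_def s_def Y_def\<close>)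
    also have "\<dots> \<le> Cs * real N powr (real ?n + (e - \<theta>) * r) + Cm * real N powr (real ?n + 2 * (real d - 1) * \<theta> - real d)"
    proof -
      have "0 < Q" by (simp add: Q_def)
      have NQ: "real N ^ d \<le> real Q" and N0: "0 < real N ^ d" using N by (auto simp: Q_def)
      have "0 \<le> 4 * Y * Y" using C1(1) B by (simp add: Y_def)
      then have "4 * Y * Y / real Q \<le> 4 * Y * Y / real N ^ d"
        using NQ N0 \<open>0 < Q\<close> by (intro divide_left_mono mult_pos_pos) auto
      then have "8 * Y * \<delta> + 4 * Y * Y / real Q \<le> (8 * C1 + 4 * C1 * C1) * (B ^ (d - 1) * B ^ (d - 1) / real N ^ d)"
        by (simp add: Y_def \<delta>_def algebra_simps add_divide_distrib)
      also have "B ^ (d - 1) * B ^ (d - 1) / real N ^ d = real N powr (2 * (real d - 1) * \<theta> - real d)"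
        unfolding Bd Nd by (simp add: powr_diff algebra_simps flip: powr_add)
      finally have "(3 * real N) ^ ?n * (8 * Y * \<delta> + 4 * Y * Y / real Q)
          \<le> (3 * real N) ^ ?n * ((8 * C1 + 4 * C1 * C1) * real N powr (2 * (real d - 1) * \<theta> - real d))"
        by (intro mult_left_mono) auto
      also have "\<dots> = Cm * (real N powr real ?n * real N powr (2 * (real d - 1) * \<theta> - real d))"
        using N by (simp add: Cm_def power_mult_distrib powr_realpow)
      also have "\<dots> = Cm * real N powr (real ?n + 2 * (real d - 1) * \<theta> - real d)"
        by (simp add: add_diff_eq flip: powr_add)
      finally show ?thesis by (simp add: s_def)
    qed
    finally have A: "(\<Sum>j<Q. S (real j / real Q)) / real Q \<le> Cs * real N powr (real ?n + (e - \<theta>) * r) + Cm * real N powr (real ?n + 2 * (real d - 1) * \<theta> - real d)" .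
    have "norm (\<Sum>x | x \<in> X \<and> eval_mpoly F x \<noteq> 0. lam (nat \<bar>eval_mpoly F x\<bar>))
      \<le> 2 * (CT * real N powr (real d / 2 + e)) * (Cs * real N powr (real ?n + (e - \<theta>) * r) + Cm * real N powr (real ?n + 2 * (real d - 1) * \<theta> - real d))"
    proof (rule sum_nonzero_values_le[where M = M and Q = Q])
      show "\<bar>eval_mpoly F x\<bar> \<le> int M" if "x \<in> X" for x
        unfolding M_def using that box by (intro c(2)[OF N]) (auto simp: X_def)
      show "norm (\<Sum>m=1..M. lam m * echar (real m * b)) \<le> CT * real N powr (real d / 2 + e)" for b
        unfolding M_def by (rule CT(2)[OF N])
    qed (use X CT A in \<open>auto simp: Q_def S_def\<close>)
    also have "\<dots> = 2 * CT * (Cs * real N powr (real d / 2 + e + (real ?n + (e - \<theta>) * r))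
        + Cm * real N powr (real d / 2 + e + (real ?n + 2 * (real d - 1) * \<theta> - real d)))"
      by (simp only: powr_add[of _ "real d / 2 + e"] distrib_left mult_ac)
    also have "\<dots> \<le> 2 * CT * (Cs * real N powr (real ?n - \<eta>0 / 2) + Cm * real N powr (real ?n - \<eta>0 / 2))"
    proof (intro mult_left_mono add_mono powr_mono)
      have "\<eta>0 \<le> \<theta> * r - real d / 2" by (simp add: \<eta>0_def)
      then show "real d / 2 + e + (real ?n + (e - \<theta>) * r) \<le> real ?n - \<eta>0 / 2"
        using e(2) by (simp add: algebra_simps)
      have "\<eta>0 \<le> real d / 2 - 2 * (real d - 1) * \<theta>" by (simp add: \<eta>0_def)
      then show "real d / 2 + e + (real ?n + 2 * (real d - 1) * \<theta> - real d) \<le> real ?n - \<eta>0 / 2"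
        using e_le by (simp add: field_simps)
    qed (use N Cs Cm CT in auto)
    also have "\<dots> = (2 * CT * (Cs + Cm)) * real N powr (real ?n - \<eta>0 / 2)"
      by (simp only: distrib_left distrib_right mult.assoc)
    finally show ?thesis by (simp add: X_def)
  qed
  show ?thesis
    using main \<eta>0 by (intro exI[of _ "2 * CT * (Cs + Cm)"] exI[of _ "\<eta>0 / 2"]) auto
qed

subsection \<open>Linear forms\<close>

text \<open>Multiplication by a unit permutes the residues modulo \<open>Q\<close>.\<close>

lemma sum_frac_coprime:
  fixes g :: "real \<Rightarrow> 'a::comm_monoid_add" and c :: int
  assumes Q: "0 < Q" and cop: "coprime c (int Q)"
  shows "(\<Sum>j<Q. g (frac (real j / real Q * of_int c))) = (\<Sum>k<Q. g (real k / real Q))"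
proof -
  define \<pi> where "\<pi> j = nat ((int j * c) mod int Q)" for j
  have int_\<pi>: "int (\<pi> j) = (int j * c) mod int Q" for j using Q by (simp add: \<pi>_def)
  have \<pi>_less: "\<pi> j < Q" for j
    using Q pos_mod_bound[of "int Q" "int j * c"] unfolding int_\<pi>[symmetric] by simp
  have frac: "frac (real j / real Q * of_int c) = real (\<pi> j) / real Q" for j
  proof -
    have "real j / real Q * of_int c = of_int (int j * c) / of_int (int Q)" by simp
    then have "frac (real j / real Q * of_int c) = of_int (int j * c) / of_int (int Q) - of_int ((int j * c) div int Q)"
      unfolding frac_def by (simp only: floor_divide_of_int_eq)
    also have "real_of_int (int j * c) = of_int ((int j * c) div int Q) * of_int (int Q) + of_int (int (\<pi> j))"
      unfolding int_\<pi> of_int_mult[symmetric] of_int_add[symmetric] by simp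
    finally show ?thesis using Q by (simp add: field_simps)
  qed
  have "inj_on \<pi> {..<Q}"
  proof (rule inj_onI)
    fix i j assume ij: "i \<in> {..<Q}" "j \<in> {..<Q}" "\<pi> i = \<pi> j"
    have "(int i * c) mod int Q = (int j * c) mod int Q"
      unfolding int_\<pi>[symmetric] using ij(3) by simp
    then have "int Q dvd (int i - int j) * c"
      by (simp add: mod_eq_dvd_iff left_diff_distrib)
    then have "int Q dvd int i - int j"
      using cop by (simp add: coprime_dvd_mult_left_iff coprime_commute)
    then show "i = j" using dvd_imp_le_int[of "int i - int j" "int Q"] ij by force
  qed
  moreover have "\<pi> ` {..<Q} = {..<Q}"
    by (rule endo_inj_surj) (use \<pi>_less calculation in auto)
  ultimately have "(\<Sum>k<Q. g (real k / real Q)) = (\<Sum>j<Q. g (real (\<pi> j) / real Q))"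
    using sum.reindex[of \<pi> "{..<Q}" "\<lambda>k. g (real k / real Q)"] by simp
  then show ?thesis unfolding frac by simp
qed

text \<open>An arc of length \<open>1 / K\<close> contains at most \<open>Q / K + 1\<close> of the
  fractions \<open>k / Q\<close>.\<close>

lemma sum_weight_rational_le:
  assumes Q: "0 < Q" and K: "0 < K"
  shows "(\<Sum>k<Q. weight K (spacing K (real k / real Q))) \<le> (real Q / real K + 1) * (4 * real K * (1 + ln (real K)))"
proof -
  let ?s = "\<lambda>k. spacing K (real k / real Q)"
  have fibre: "real (card {k \<in> {..<Q}. ?s k = r}) \<le> real Q / real K + 1" for r
  proof -
    let ?I = "{k::nat. real r * real Q / real K \<le> real k \<and> real k \<le> real r * real Q / real K + real Q / real K}"
    have "{k \<in> {..<Q}. ?s k = r} \<subseteq> ?I"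
    proof safe
      fix k assume k: "k < Q"
      have "frac (real k / real Q) = real k / real Q" using k by (simp add: frac_eq)
      then have *: "real (?s k) \<le> real K * (real k / real Q)" "real K * (real k / real Q) < real (?s k) + 1"
        using spacing_bounds[of K "real k / real Q"] by simp_all
      then show "real (?s k) * real Q / real K \<le> real k"
        using Q K by (simp add: field_simps)
      show "real k \<le> real (?s k) * real Q / real K + real Q / real K"
        using *(2) Q K by (simp add: field_simps)
    qed
    then have "card {k \<in> {..<Q}. ?s k = r} \<le> card ?I"
      by (intro card_mono card_nat_interval_le) auto
    also have "real (card ?I) \<le> real Q / real K + 1" by (rule card_nat_interval_le) simp
    finally show ?thesis by simp
  qed
  have "(\<Sum>k<Q. weight K (?s k)) = (\<Sum>r<K. \<Sum>k\<in>{k \<in> {..<Q}. ?s k = r}. weight K (?s k))"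
    by (rule sum.group[symmetric]) (use spacing_less[OF K] in auto)
  also have "\<dots> = (\<Sum>r<K. real (card {k \<in> {..<Q}. ?s k = r}) * weight K r)"
    by (rule sum.cong) auto
  also have "\<dots> \<le> (\<Sum>r<K. (real Q / real K + 1) * weight K r)"
    using fibre by (intro sum_mono mult_right_mono weight_nonneg) auto
  also have "\<dots> = (real Q / real K + 1) * (\<Sum>r<K. weight K r)" by (rule sum_distrib_left[symmetric])
  also have "\<dots> \<le> (real Q / real K + 1) * (4 * real K * (1 + ln (real K)))"
    by (intro mult_left_mono sum_weight_le K) simp
  finally show ?thesis .
qed

lemma weight_le: "r < K \<Longrightarrow> weight K r \<le> 4 * real K"
proof -
  assume r: "r < K"
  then have "1 / (real r + 1) + 1 / (real K - real r) \<le> 1 + 1"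
    by (intro add_mono) (auto simp: divide_le_eq)
  then have "2 * real K * (1 / (real r + 1) + 1 / (real K - real r)) \<le> 2 * real K * (1 + 1)"
    by (intro mult_left_mono) auto
  then show ?thesis by (simp add: weight_def)
qed

text \<open>Only one coordinate with a nontrivial coefficient is averaged; its frequencies run
  through all fractions with denominator \<open>Q\<close>, so its mean is logarithmic. The other
  coordinates are estimated trivially.\<close>

lemma average_linear_le:
  fixes c :: "'n::finite \<Rightarrow> int" and N :: nat
  defines "K \<equiv> 2 * N + 1"
  assumes box: "int_box l u \<subseteq> int_cube (real N)" and cop: "coprime (c i) (int Q)" and Q: "K \<le> Q"
  shows "(\<Sum>j<Q. norm (exp_sum (int_box l u) (\<lambda>x. real j / real Q * of_int (\<Sum>i\<in>UNIV. c i * x $ i)))) / real Q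
    \<le> (4 * real K) ^ (CARD('n) - 1) * (8 * (1 + ln (real K)))"
proof -
  have K: "0 < K" by (simp add: K_def)
  then have Q0: "0 < Q" using Q by simp
  have lnK: "0 \<le> ln (real K)" using K by simp
  have "norm (exp_sum (int_box l u) (\<lambda>x. real j / real Q * of_int (\<Sum>i\<in>UNIV. c i * x $ i)))
      \<le> weight K (spacing K (frac (real j / real Q * of_int (c i)))) * (4 * real K) ^ (CARD('n) - 1)" for j
  proof -
    let ?w = "\<lambda>i. weight K (spacing K (real j / real Q * of_int (c i)))"
    have "(\<lambda>x. real j / real Q * of_int (\<Sum>i\<in>UNIV. c i * x $ i))
        = (\<lambda>x. 0 + (\<Sum>i\<in>UNIV. (real j / real Q * of_int (c i)) * of_int (x $ i)))"
      by (simp add: sum_distrib_left mult.assoc)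
    then have "norm (exp_sum (int_box l u) (\<lambda>x. real j / real Q * of_int (\<Sum>i\<in>UNIV. c i * x $ i))) \<le> (\<Prod>i\<in>UNIV. ?w i)"
      using norm_exp_sum_linear_le[OF box, of 0 "\<lambda>i. real j / real Q * of_int (c i)"] unfolding K_def by simp
    also have "\<dots> = ?w i * (\<Prod>i\<in>UNIV - {i}. ?w i)" by (rule prod.remove) auto
    also have "\<dots> \<le> ?w i * (\<Prod>i\<in>UNIV - {i}. 4 * real K)"
      using spacing_less[OF K] by (intro mult_left_mono prod_mono conjI weight_nonneg weight_le) auto
    finally show ?thesis by (simp add: spacing_def)
  qed
  then have "(\<Sum>j<Q. norm (exp_sum (int_box l u) (\<lambda>x. real j / real Q * of_int (\<Sum>i\<in>UNIV. c i * x $ i))))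
      \<le> (\<Sum>j<Q. weight K (spacing K (frac (real j / real Q * of_int (c i)))) * (4 * real K) ^ (CARD('n) - 1))"
    by (intro sum_mono)
  also have "\<dots> = (\<Sum>j<Q. weight K (spacing K (frac (real j / real Q * of_int (c i))))) * (4 * real K) ^ (CARD('n) - 1)"
    by (rule sum_distrib_right[symmetric])
  also have "(\<Sum>j<Q. weight K (spacing K (frac (real j / real Q * of_int (c i))))) = (\<Sum>k<Q. weight K (spacing K (real k / real Q)))"
    by (rule sum_frac_coprime[OF Q0 cop])
  also have "\<dots> \<le> (real Q / real K + 1) * (4 * real K * (1 + ln (real K)))"
    by (rule sum_weight_rational_le[OF Q0 K])
  also have "\<dots> \<le> (2 * (real Q / real K)) * (4 * real K * (1 + ln (real K)))"
  proof (rule mult_right_mono)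
    have "1 \<le> real Q / real K" using Q K by (simp add: pos_le_divide_eq)
    then show "real Q / real K + 1 \<le> 2 * (real Q / real K)" by linarith
  qed (use lnK in simp)
  also have "\<dots> = real Q * (8 * (1 + ln (real K)))" using K by simp
  finally have "(\<Sum>j<Q. norm (exp_sum (int_box l u) (\<lambda>x. real j / real Q * of_int (\<Sum>i\<in>UNIV. c i * x $ i))))
      \<le> real Q * (8 * (1 + ln (real K))) * (4 * real K) ^ (CARD('n) - 1)"
    by (simp add: mult_right_mono)
  then show ?thesis using Q0 by (simp add: pos_divide_le_eq mult_ac)
qed

text \<open>In degree one the partial derivatives are the constant coefficients, so smoothness says
  that one of them is nonzero.\<close>

lemma linear_form_coeffs:
  fixes F :: "'n::finite int_mpoly"
  assumes hom: "homogeneous 1 F" and smooth: "smooth_form F"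
  obtains c :: "'n \<Rightarrow> int" and i where "c i \<noteq> 0" "\<And>x :: int ^ 'n. eval_mpoly F x = (\<Sum>i\<in>UNIV. c i * x $ i)"
proof -
  let ?F = "eval_mpoly F :: int ^ 'n \<Rightarrow> int"
  define c where "c i = ?F (axis i 1)" for i
  have F0: "?F 0 = 0" using eval_mpoly_scale[OF hom, of 0 "0 :: int ^ 'n"] by simp
  have "poly_below 2 ?F" using poly_below_eval_mpoly[OF hom] by (simp add: numeral_2_eq_2)
  then have F: "?F x = (\<Sum>i\<in>UNIV. c i * x $ i)" for x
    by (subst poly_below_2_affine) (simp_all add: F0 c_def)
  have "\<exists>i. c i \<noteq> 0"
  proof (rule ccontr)
    assume "\<not> ?thesis"
    then have c0: "c i = 0" for i by simp
    have "eval_mpoly (partial_deriv i F) (z :: complex ^ 'n) = 0" for i z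
    proof -
      have "poly_below (Suc 0) (eval_mpoly (partial_deriv i F) :: complex ^ 'n \<Rightarrow> complex)"
        using poly_below_eval_partial_deriv[OF hom] by simp
      then have "eval_mpoly (partial_deriv i F) z = eval_mpoly (partial_deriv i F) (0 :: complex ^ 'n)"
        by (rule poly_below_1_const)
      also have "\<dots> = eval_mpoly (partial_deriv i F) (complex_vec (0 :: int ^ 'n))"
        by (rule arg_cong[where f = "eval_mpoly (partial_deriv i F)"]) (simp add: complex_vec_def vec_eq_iff)
      also have "\<dots> = of_int (eval_mpoly (partial_deriv i F) (0 :: int ^ 'n))"
        by (rule eval_mpoly_complex_vec)
      finally have 1: "eval_mpoly (partial_deriv i F) z = of_int (eval_mpoly (partial_deriv i F) (0 :: int ^ 'n))" .
      have "poly_below (1 - 1) (\<lambda>x. ?F (x + axis i 1) - ?F x - eval_mpoly (partial_deriv i F) x)"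
        by (rule poly_below_taylor[OF hom])
      then have "(\<lambda>x. ?F (x + axis i 1) - ?F x - eval_mpoly (partial_deriv i F) x) = (\<lambda>_. 0)"
        by (simp only: diff_self_eq_0 poly_below_0)
      from fun_cong[OF this, of 0] have "?F (0 + axis i 1) - ?F 0 = eval_mpoly (partial_deriv i F) 0" by simp
      with 1 show ?thesis using c0[of i] F0 by (simp add: c_def)
    qed
    moreover have "(\<chi> i. 1) \<noteq> (0 :: complex ^ 'n)" by (simp add: vec_eq_iff)
    ultimately show False using smooth unfolding smooth_form_def by blast
  qed
  with F that show ?thesis by blast
qed

text \<open>Differencing has nothing to offer here, since \<open>n = 1\<close> is allowed. The mean
  of \<open>\<bar>S\<bar>\<close> has order \<open>N ^ (n - 1)\<close> up to a logarithm, against a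
  loss of \<open>N powr (1 / 2)\<close>; two logarithms, absorbed in \<open>N powr (1 / 8)\<close>
  each, leave the saving \<open>1 / 4\<close>.\<close>

theorem power_saving_linear:
  fixes F :: "'n::finite int_mpoly" and lam :: "nat \<Rightarrow> complex"
  assumes W: "0 \<le> W" "\<And>M b. norm (\<Sum>m=1..M. lam m * echar (real m * b)) \<le> W * sqrt (real M) * ln (real M + 1)"
    and hom: "homogeneous 1 F" and smooth: "smooth_form F"
  shows "\<exists>C \<eta>. 0 < \<eta> \<and> (\<forall>N l u. 1 \<le> N \<longrightarrow> int_box l u \<subseteq> int_cube (real N) \<longrightarrow>
     norm (\<Sum>x | x \<in> int_box l (u :: int ^ 'n) \<and> eval_mpoly F x \<noteq> 0. lam (nat \<bar>eval_mpoly F x\<bar>))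
       \<le> C * real N powr (real CARD('n) - \<eta>))"
proof -
  let ?n = "CARD('n)"
  obtain a :: "'n \<Rightarrow> int" and i where a: "a i \<noteq> 0" "\<And>x :: int ^ 'n. eval_mpoly F x = (\<Sum>i\<in>UNIV. a i * x $ i)"
    using linear_form_coeffs[OF hom smooth] by blast
  obtain c where c: "0 \<le> c" "\<And>N x. 1 \<le> N \<Longrightarrow> x \<in> int_cube (real N) \<Longrightarrow>
    \<bar>eval_mpoly F (x :: int ^ 'n)\<bar> \<le> int (nat \<lceil>c * real N ^ 1\<rceil>)"
    using eval_mpoly_box_bound[OF hom] by blast
  obtain CT where CT: "0 \<le> CT" "\<And>N b. 1 \<le> N \<Longrightarrow>
    norm (\<Sum>m=1..nat \<lceil>c * real N ^ 1\<rceil>. lam m * echar (real m * b)) \<le> CT * real N powr (real 1 / 2 + 1 / 8)"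
    using twisted_sum_powr_bound[OF W c(1), of "1 / 8" 1] by auto
  define CL :: real where "CL = 1 + (ln 3 + 1 / (1 / 8))"
  have CL: "0 \<le> CL" by (simp add: CL_def)
  define D where "D = 2 * CT * (12 ^ (?n - 1) * (8 * CL))"
  have main: "norm (\<Sum>x | x \<in> int_box l (u :: int ^ 'n) \<and> eval_mpoly F x \<noteq> 0. lam (nat \<bar>eval_mpoly F x\<bar>))
       \<le> D * real N powr (real ?n - 1 / 4)"
    if N: "1 \<le> N" and box: "int_box l u \<subseteq> int_cube (real N)" for N l u
  proof -
    define X where "X = int_box l u"
    have X: "finite X" unfolding X_def by (rule finite_subset[OF box finite_int_cube])
    define M where "M = nat \<lceil>c * real N ^ 1\<rceil>"
    define K where "K = 2 * N + 1"
    \<comment> \<open>Congruent to 1 modulo \<open>a i\<close>, hence coprime to it, and larger than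
      both \<open>2 * M\<close> and \<open>K\<close>.\<close>
    define Q where "Q = nat \<bar>a i\<bar> * (2 * M + K) + 1"
    have "1 * (2 * M + K) \<le> nat \<bar>a i\<bar> * (2 * M + K)" using a(1) by (intro mult_right_mono) auto
    then have "2 * M + K < Q" unfolding Q_def Suc_eq_plus1[symmetric] less_Suc_eq_le mult_1 .
    then have Q: "2 * M < Q" "K \<le> Q" by auto
    have cop: "coprime (a i) (int Q)"
    proof (rule coprimeI)
      fix t assume t: "t dvd a i" "t dvd int Q"
      then have "t dvd int Q - \<bar>a i\<bar> * int (2 * M + K)" by (intro dvd_diff dvd_mult2) auto
      then show "is_unit t" by (simp add: Q_def)
    qed
    have K_le: "real K \<le> 3 * real N" using N by (simp add: K_def)
    have L: "1 + ln (real K) \<le> CL * real N powr (1 / 8)"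
    proof -
      have "ln (real K) \<le> ln (3 * real N)" using K_le by (intro ln_mono) (auto simp: K_def)
      also have "\<dots> \<le> (ln 3 + 1 / (1 / 8)) * real N powr (1 / 8)" using N by (intro ln_mult_le_powr) auto
      finally have "ln (real K) \<le> (ln 3 + 1 / (1 / 8)) * real N powr (1 / 8)" .
      moreover have "1 \<le> real N powr (1 / 8)" using N by (intro ge_one_powr_ge_zero) auto
      ultimately show ?thesis unfolding CL_def distrib_right by linarith
    qed
    have "(\<Sum>j<Q. norm (exp_sum X (\<lambda>x. real j / real Q * of_int (eval_mpoly F x)))) / real Q
        \<le> (4 * real K) ^ (?n - 1) * (8 * (1 + ln (real K)))"
      unfolding a(2) X_def K_def by (rule average_linear_le[where c = a and i = i, OF box cop]) (use Q(2) in \<open>simp add: K_def\<close>)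
    also have "\<dots> \<le> (4 * (3 * real N)) ^ (?n - 1) * (8 * (CL * real N powr (1 / 8)))"
      using K_le L by (intro mult_mono power_mono) (auto simp: K_def)
    also have "\<dots> = 12 ^ (?n - 1) * (8 * CL) * (real N ^ (?n - 1) * real N powr (1 / 8))"
      by (simp add: power_mult_distrib)
    also have "real N ^ (?n - 1) = real N powr (real ?n - 1)"
      using N by (simp add: powr_realpow[symmetric] of_nat_diff Suc_leI)
    also have "12 ^ (?n - 1) * (8 * CL) * (real N powr (real ?n - 1) * real N powr (1 / 8))
        = 12 ^ (?n - 1) * (8 * CL) * real N powr (real ?n - 1 + 1 / 8)"
      by (simp only: powr_add)
    finally have A: "(\<Sum>j<Q. norm (exp_sum X (\<lambda>x. real j / real Q * of_int (eval_mpoly F x)))) / real Q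
        \<le> 12 ^ (?n - 1) * (8 * CL) * real N powr (real ?n - 1 + 1 / 8)" .
    have "norm (\<Sum>x | x \<in> X \<and> eval_mpoly F x \<noteq> 0. lam (nat \<bar>eval_mpoly F x\<bar>))
      \<le> 2 * (CT * real N powr (real 1 / 2 + 1 / 8)) * (12 ^ (?n - 1) * (8 * CL) * real N powr (real ?n - 1 + 1 / 8))"
    proof (rule sum_nonzero_values_le[where M = M and Q = Q])
      show "\<bar>eval_mpoly F x\<bar> \<le> int M" if "x \<in> X" for x
        unfolding M_def using that box by (intro c(2)[OF N]) (auto simp: X_def)
      show "norm (\<Sum>m=1..M. lam m * echar (real m * b)) \<le> CT * real N powr (real 1 / 2 + 1 / 8)" for b
        unfolding M_def by (rule CT(2)[OF N])
    qed (use X CT(1) A Q in auto)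
    also have "\<dots> = D * (real N powr (real 1 / 2 + 1 / 8) * real N powr (real ?n - 1 + 1 / 8))"
      by (simp only: D_def mult_ac)
    also have "real N powr (real 1 / 2 + 1 / 8) * real N powr (real ?n - 1 + 1 / 8) = real N powr (real ?n - 1 / 4)"
      by (simp flip: powr_add)
    finally show ?thesis by (simp add: X_def)
  qed
  then show ?thesis by (intro exI[of _ D] exI[of _ "1 / 4"]) auto
qed

section \<open>Dilated boxes and the passage to the limit\<close>

lemma smooth_form_degree_pos:
  fixes F :: "'n::finite int_mpoly"
  assumes "homogeneous d F" "smooth_form F"
  shows "0 < d"
proof (rule ccontr)
  assume "\<not> 0 < d"
  then have "poly_below 0 (eval_mpoly (partial_deriv i F) :: complex ^ 'n \<Rightarrow> complex)" for i
    using poly_below_eval_partial_deriv[OF assms(1)] by simp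
  then have "eval_mpoly (partial_deriv i F) (z :: complex ^ 'n) = 0" for i z by (simp add: poly_below_0)
  moreover have "(\<chi> i. 1) \<noteq> (0 :: complex ^ 'n)" by (simp add: vec_eq_iff)
  ultimately show False using assms(2) unfolding smooth_form_def by blast
qed

text \<open>Integral coordinates bounded by \<open>P\<close> are bounded by its integer part, so the
  real dilation can be replaced by a natural number.\<close>

lemma scaled_box_integral_points:
  assumes "is_box B" "0 < P"
  obtains l u :: "int ^ 'n::finite" where "{x. real_vec x \<in> (\<lambda>t. P *\<^sub>R t) ` B} = int_box l u"
    "int_box l u \<subseteq> int_cube (real (nat \<lfloor>P\<rfloor>))"
proof -
  obtain a b where sub: "B \<subseteq> {t. \<forall>j. t $ j \<in> {-1..1}}" and B: "B = {t. \<forall>j. t $ j \<in> {a $ j..b $ j}}"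
    using assms(1) unfolding is_box_def by blast
  have mem: "real_vec x \<in> (\<lambda>t. P *\<^sub>R t) ` B \<longleftrightarrow> (1 / P) *\<^sub>R real_vec x \<in> B" for x :: "int ^ 'n"
  proof
    assume "real_vec x \<in> (\<lambda>t. P *\<^sub>R t) ` B"
    then obtain t where "t \<in> B" "real_vec x = P *\<^sub>R t" by blast
    then show "(1 / P) *\<^sub>R real_vec x \<in> B" using assms(2) by simp
  next
    assume "(1 / P) *\<^sub>R real_vec x \<in> B"
    then show "real_vec x \<in> (\<lambda>t. P *\<^sub>R t) ` B"
      using assms(2) by (intro image_eqI[of _ _ "(1 / P) *\<^sub>R real_vec x"]) auto
  qed
  have eq: "{x. real_vec x \<in> (\<lambda>t. P *\<^sub>R t) ` B} = int_box (\<chi> j. \<lceil>P * a $ j\<rceil>) (\<chi> j. \<lfloor>P * b $ j\<rfloor>)"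
    unfolding mem using assms(2)
    by (auto simp: B int_box_def real_vec_def ceiling_le_iff le_floor_iff field_simps)
  have "x \<in> int_cube (real (nat \<lfloor>P\<rfloor>))" if "real_vec x \<in> (\<lambda>t. P *\<^sub>R t) ` B" for x :: "int ^ 'n"
    unfolding int_cube_def mem_Collect_eq
  proof
    fix j
    have "((1 / P) *\<^sub>R real_vec x) $ j \<in> {-1..1}" using that sub unfolding mem by blast
    then have "- P \<le> real_of_int (x $ j)" "real_of_int (x $ j) \<le> P"
      using assms(2) by (auto simp: real_vec_def field_simps)
    then have "\<bar>x $ j\<bar> \<le> \<lfloor>P\<rfloor>" by linarith
    then show "real_of_int \<bar>x $ j\<bar> \<le> real (nat \<lfloor>P\<rfloor>)" using assms(2) by simp
  qed
  then have "int_box (\<chi> j. \<lceil>P * a $ j\<rceil>) (\<chi> j. \<lfloor>P * b $ j\<rfloor>) \<subseteq> int_cube (real (nat \<lfloor>P\<rfloor>))"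
    unfolding eq[symmetric] by blast
  with eq that show ?thesis by blast
qed

theorem theorem1p7:
  fixes f :: "complex \<Rightarrow> complex" and k :: int and lam :: "nat \<Rightarrow> complex"
    and F :: "'n::finite int_mpoly" and d :: nat and B :: "(real ^ 'n) set"
  assumes "cusp_form k f"
    and "hecke_eigenform k f"
    and "has_cuspidal_fourier_expansion f
           (\<lambda>m. lam m * of_real (real m powr ((of_int k - 1) / 2)))"
    and "lam 1 = 1"
    and "homogeneous d F"
    and "smooth_form F"
    and "CARD('n) > 2 ^ d * (d - 1)"
    and "is_box B"
  shows "((\<lambda>P::real.
            (\<Sum>x | real_vec x \<in> (\<lambda>t. P *\<^sub>R t) ` B \<and> eval_mpoly F x \<noteq> 0.
               lam (nat \<bar>eval_mpoly F x\<bar>)) / of_real (P ^ CARD('n))) \<longlongrightarrow> 0) at_top"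
proof -
  have "weakly_modular k f" using assms(1) by (simp add: cusp_form_def)
  from wilton_bound[OF this assms(3)] obtain W where W: "0 \<le> W"
    "\<And>M b. norm (\<Sum>m=1..M. lam m * echar (real m * b)) \<le> W * sqrt (real M) * ln (real M + 1)" by blast
  \<comment> \<open>The constants must be uniform in the corners \<open>l\<close> and
    \<open>u\<close>, because the box of integral points changes with \<open>P\<close>.\<close>
  have "\<exists>C \<eta>. 0 < \<eta> \<and> (\<forall>N l u. 1 \<le> N \<longrightarrow> int_box l u \<subseteq> int_cube (real N) \<longrightarrow>
     norm (\<Sum>x | x \<in> int_box l (u :: int ^ 'n) \<and> eval_mpoly F x \<noteq> 0. lam (nat \<bar>eval_mpoly F x\<bar>))
       \<le> C * real N powr (real CARD('n) - \<eta>))"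
  proof (cases "d = 1")
    case True
    then show ?thesis using power_saving_linear[OF W] assms(5,6) by simp
  next
    case False
    then have "2 \<le> d" using smooth_form_degree_pos[OF assms(5,6)] by simp
    then show ?thesis by (rule power_saving_nonlinear[OF W assms(5,6) _ assms(7)])
  qed
  then obtain C \<eta> where \<eta>: "0 < \<eta>" and C: "\<And>N l u. 1 \<le> N \<Longrightarrow> int_box l u \<subseteq> int_cube (real N) \<Longrightarrow>
     norm (\<Sum>x | x \<in> int_box l (u :: int ^ 'n) \<and> eval_mpoly F x \<noteq> 0. lam (nat \<bar>eval_mpoly F x\<bar>))
       \<le> C * real N powr (real CARD('n) - \<eta>)" by blast
  let ?s = "\<lambda>P::real. (\<Sum>x | real_vec x \<in> (\<lambda>t. P *\<^sub>R t) ` B \<and> eval_mpoly F x \<noteq> 0. lam (nat \<bar>eval_mpoly F x\<bar>)) / of_real (P ^ CARD('n))"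
  have bound: "norm (?s P) \<le> \<bar>C\<bar> * real (nat \<lfloor>P\<rfloor>) powr (- \<eta>)" if P: "1 \<le> P" for P
  proof -
    define N where "N = nat \<lfloor>P\<rfloor>"
    have N: "1 \<le> N" "real N \<le> P" using P by (auto simp: N_def le_nat_iff le_floor_iff)
    obtain l u :: "int ^ 'n" where lu: "{x. real_vec x \<in> (\<lambda>t. P *\<^sub>R t) ` B} = int_box l u" "int_box l u \<subseteq> int_cube (real N)"
      using scaled_box_integral_points[OF assms(8), of P] P unfolding N_def by auto
    have "{x. real_vec x \<in> (\<lambda>t. P *\<^sub>R t) ` B \<and> eval_mpoly F x \<noteq> 0} = {x. x \<in> int_box l u \<and> eval_mpoly F x \<noteq> 0}"
      using lu(1) by blast
    then have "norm (?s P) = norm (\<Sum>x | x \<in> int_box l u \<and> eval_mpoly F x \<noteq> 0. lam (nat \<bar>eval_mpoly F x\<bar>)) / P ^ CARD('n)"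
      using P by (simp add: norm_divide norm_power)
    also have "\<dots> \<le> (C * real N powr (real CARD('n) - \<eta>)) / P ^ CARD('n)"
      using P by (intro divide_right_mono C[OF N(1) lu(2)]) auto
    also have "\<dots> \<le> (\<bar>C\<bar> * real N powr (real CARD('n) - \<eta>)) / P ^ CARD('n)"
      using P by (intro divide_right_mono mult_right_mono) auto
    also have "\<dots> \<le> (\<bar>C\<bar> * real N powr (real CARD('n) - \<eta>)) / real N ^ CARD('n)"
      using P N by (intro divide_left_mono power_mono mult_pos_pos) auto
    also have "\<dots> = \<bar>C\<bar> * real N powr (- \<eta>)"
      using N(1) by (simp add: powr_diff powr_realpow powr_minus divide_inverse)
    finally show ?thesis by (simp add: N_def)
  qed
  have "((\<lambda>P::real. \<bar>C\<bar> * real (nat \<lfloor>P\<rfloor>) powr (- \<eta>)) \<longlongrightarrow> \<bar>C\<bar> * 0) at_top"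
  proof (intro tendsto_mult tendsto_const)
    have "filterlim (\<lambda>P::real. nat \<lfloor>P\<rfloor>) at_top at_top"
      by (rule filterlim_compose[OF filterlim_nat_sequentially filterlim_floor_sequentially])
    then have "filterlim (\<lambda>P::real. real (nat \<lfloor>P\<rfloor>)) at_top at_top"
      by (rule filterlim_compose[OF filterlim_real_sequentially])
    then show "((\<lambda>P::real. real (nat \<lfloor>P\<rfloor>) powr (- \<eta>)) \<longlongrightarrow> 0) at_top"
      using \<eta> by (intro tendsto_neg_powr) auto
  qed
  then have lim: "((\<lambda>P::real. \<bar>C\<bar> * real (nat \<lfloor>P\<rfloor>) powr (- \<eta>)) \<longlongrightarrow> 0) at_top" by simp
  show ?thesis
    by (rule Lim_null_comparison[OF eventually_mono[OF eventually_ge_at_top[of 1] bound] lim])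
qed

end
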